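(* Let $\mu\in X$ and $1\le k\le n$. Let $f\in\Pi$ and write $\delta(f)=\sum_s g_s\otimes g_s'$. Then in $\check{\mathcal X}^{\underline\lambda,*}$ the following local relation holds for the red string labelled $(k)$ with the region immediately to its right of weight $\mu$ (so the region immediately to its left has weight $\mu+\lambda^{(k)}$): $$\big(b_{\mu+\lambda^{(k)}}(f)\text{ placed immediately to the left of the red string }(k)\big)=\sum_s a_k(g_s')\cdot\big(b_\mu(g_s)\text{ placed immediately to the right of the red string }(k)\big),$$ where $a_k(g'_s)\in\mathbb A_{\underline\lambda}$ acts as a scalar coefficient.
   Context: **Cartan datum.** $\Bbbk$ is a field of characteristic $0$. Fix a simply-laced Cartan datum of finite (ADE) type: a finite set $I$, a free $\mathbb Z$-module $X$ with simple roots $\alpha_i$, fundamental weights $\Lambda_i$, and simple coroots $\alpha_i^\vee\in\operatorname{Hom}(X,\mathbb Z)$ ($i\in I$). Write $\langle i,\mu\rangle=\alpha_i^\vee(\mu)$, $\langle i,j\rangle=\langle i,\alpha_j\rangle$; so $\langle i,i\rangle=2$, $\langle i,j\rangle=\langle j,i\rangle\in\{0,-1\}$ for $i\ne j$, the Cartan matrix is invertible, $\langle i,\Lambda_j\rangle=\delta_{ij}$. $X^+=\bigoplus_i\mathbb Z_{\ge0}\Lambda_i$. $\pm I=I\sqcup(-I)$, $\alpha_{-i}=-\alpha_i$. Fix an orientation of the Dynkin graph and set $t_{ij}=1$ if $i=j$, $\langle i,j\rangle=0$, or there is an arrow $j\to i$; $t_{ij}=-1$ if there is an arrow $i\to j$.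 Fix any $c_{i,\mu}\in\Bbbk^\times$ ($i\in I,\mu\in X$) with $c_{i,\mu+\alpha_j}=t_{ij}c_{i,\mu}$. Fix $\underline\lambda=(\lambda^{(1)},\dots,\lambda^{(n)})$, $\lambda^{(k)}\in X^+$, and put $\lambda^{(k)}_i=\langle i,\lambda^{(k)}\rangle$. **Symmetric functions.** $\Pi=\bigotimes_{i\in I}\mathrm{Sym}$ (symmetric functions over $\Bbbk$), with power sums $p_{i,r}$, elementary $e_{i,r}$, complete $h_{i,r}$ in the $i$th factor, all of degree $2r$. The coproduct $\delta:\Pi\to\Pi\otimes\Pi$ is the algebra homomorphism with $\delta(p_{i,r})=p_{i,r}\otimes1+1\otimes p_{i,r}$ ($r\ge1$). For each $k,i$ let $Z^{(k)}_i$ be a set of $\lambda^{(k)}_i$ indeterminates of degree $2$ (all disjoint), $Z$ their union, $\mathbb A_{\lambda^{(k)}}=\bigotimes_i\Bbbk[Z^{(k)}_i]^{\mathrm{sym}}$ (symmetric polynomials), $\mathbb A_{\underline\lambda}=\bigotimes_k\mathbb A_{\lambda^{(k)}}\subseteq\Bbbk[Z]$. $a_k:\Pi\to\mathbb A_{\lambda^{(k)}}\subseteq\mathbb A_{\underline\lambda}$ evaluates symmetric functions of the $i$th factor at $Z^{(k)}_i$. **Stendhal diagrams.** A Stendhal pair is $(\underline i,\kappa)$ with $\underline i\in(\pm I)^m$, $m\ge0$, and $\kappa:\{1,\dots,n+1\}\to\{0,\dots,m\}$ weakly increasing with $\kappa(n+1)=m$; it records a horizontal row of $m$ oriented black points ($+i$: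 upward, $-i$: downward, label $i$) and red points $(n),\dots,(1)$ from left to right, with $\kappa(k)$ black points to the right of red $(k)$. A Stendhal diagram is a diagram in $\mathbb R\times[0,1]$ of oriented black strings labelled in $I$, carrying dots, possibly closed, and of $n$ red strings $(n),\dots,(1)$ from left to right, which have no critical points and do not cross each other; no triple points or tangencies; open ends lie on the top and bottom lines at distinct points. Regions carry weights: the rightmost is $0$; if the region right of a string has weight $\mu$, the region left of it has weight $\mu+\alpha_i$ (upward $i$), $\mu-\alpha_i$ (downward $i$), $\mu+\lambda^{(k)}$ (red $(k)$). Degrees: dot $2$; black crossing of strings $i,j$ of the same orientation $-\langle i,j\rangle$; cup or cap labelled $i$ in exterior region $\mu$: $1-\langle i,\mu\rangle$ if its legs from left to right are $\uparrow\downarrow$, $1+\langle i,\mu\rangle$ if $\downarrow\uparrow$; crossing of red $(k)$ with an upward black string $0$, with a downward $i$-string $\lambda^{(k)}_i$. Composition is vertical stacking. A diagram of degree $d$ from $S$ (bottom) to $S'$ (top) is a degree-$0$ morphism $S\to S'\langle d\rangle$. $y$ denotes a dot. **Black relations** (those of the cyclic form of the categorified quantum group). (B1) Black strings may be moved by planar isotopy (zigzag relations, dots slide along cups and caps; crossings of other orientations are rotations of the upward crossing by cups and caps, and left and right rotations by $180^\circ$ agree). (B2) On upward strings numbered left to right, with $\psi_l$ the crossing of strings $l,l+1$ and products read with the right factor at the bottom: $y_l\psi_l=\psi_ly_{l+1}+\delta_{ij}$ and $\psi_ly_l=y_{l+1}\psi_l+\delta_{ij}$ on labels $(i,j)$;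 $\psi_l^2$ on labels $(i,j)$ is $0$ if $i=j$, identity if $\langle i,j\rangle=0$, $t_{ij}y_l+t_{ji}y_{l+1}$ if $\langle i,j\rangle=-1$; $\psi_l\psi_{l+1}\psi_l-\psi_{l+1}\psi_l\psi_{l+1}$ on bottom labels $(i,j,k)$ is $t_{ij}$ if $i=k$, $\langle i,j\rangle=-1$, and $0$ otherwise. (B3) For $i\ne j$, double crossings of an upward $i$-string and a downward $j$-string (either order) equal the identity. (B4) Bubbles: in a region of weight $\mu$, $\circlearrowright_{i,\spadesuit+r}$ is the clockwise $i$-circle with $\langle i,\mu\rangle-1+r$ dots and $\circlearrowleft_{i,\spadesuit+r}$ the counterclockwise one with $-\langle i,\mu\rangle-1+r$ dots, both of degree $2r$; when the number of dots is negative they are formal symbols (fake bubbles). They vanish for $r<0$; $\circlearrowright_{i,\spadesuit+0}=c_{i,\mu}$, $\circlearrowleft_{i,\spadesuit+0}=c_{i,\mu}^{-1}$; $\big(\sum_r\circlearrowleft_{i,\spadesuit+r}x^r\big)\big(\sum_s\circlearrowright_{i,\spadesuit+s}x^s\big)=1$. $b_\mu$ is the algebra homomorphism from $\Pi$ to endomorphism diagrams in a region $\mu$ with $(-1)^re_{i,r}\mapsto c_{i,\mu}\circlearrowleft_{i,\spadesuit+r}$, $h_{i,r}\mapsto c_{i,\mu}^{-1}\circlearrowright_{i,\spadesuit+r}$. (B5) With right-hand region $\mu$: identity on $\uparrow_i\downarrow_i$ equals minus the double crossing plus $\sum_{\alpha+\beta+\gamma=\langle i,\mu\rangle-1}$ (cup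 with $\alpha$ dots on top, $\circlearrowleft_{i,\spadesuit+\beta}$ in the middle, cap with $\gamma$ dots at the bottom); identity on $\downarrow_i\uparrow_i$ equals minus the double crossing plus $\sum_{\alpha+\beta+\gamma=-\langle i,\mu\rangle-1}$ (same with $\circlearrowright_{i,\spadesuit+\beta}$); $\alpha,\beta,\gamma\ge0$. **Red relations.** (R1) Dots slide through red-black crossings. (R2) A double crossing of an upward black string with a red string (in either order) equals the two uncrossed strings. (R3) If a red string has one end between the legs of a black cup or cap, the diagram in which it crosses the left leg equals the diagram in which it crosses the right leg, for all labels and orientations. (R4) A red string moves freely past a crossing of two upward strings, for all labels. (R5) A double crossing of a downward $i$-string with red $(k)$ equals $\sum_{p+q=\lambda^{(k)}_i}(-1)^pa_k(e_{i,p})$ times the uncrossed strings with $q$ dots on the black string (also the mirror image). (R6) For two downward strings with bottom labels $i,j$ from left to right crossing each other, red $(k)$ between them at top and bottom: (red passing right of the crossing) $=$ (red passing left of the crossing) $+\,\delta_{ij}\sum_{r=0}^{\lambda^{(k)}_i-1}\sum_{p+q=\lambda^{(k)}_i-r-1}(-1)^ra_k(e_{i,r})\cdot$(three uncrossed strings, $p$ dots on the left and $q$ on the right black string). (R7) A diagram with, at some height, a black string to the right of all red strings is $0$. **Category.** $\check{\mathcal X}^{\underline\lambda}$ is the idempotent completion of the graded $\Bbbk$-linear category with objects formal finite direct sums of grading shifts of Stendhal pairs and morphisms the degree-$0$ $\mathbb A_{\underline\lambda}$-linear combinations of Stendhal diagrams modulo all these relations. $\check{\mathcal X}^{\underline\lambda,*}$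 has the same objects, with morphisms $\bigoplus_{s\in\mathbb Z}\check{\mathcal X}^{\underline\lambda}(x,y\langle s\rangle)$; its morphism spaces are graded right $\mathbb A_{\underline\lambda}$-modules. *)

theory Defs
  imports Complex_Main "HOL-Library.Poly_Mapping" "HOL-Library.Product_Plus"
    "HOL-Combinatorics.Permutations"
begin

abbreviation single :: "'a \<Rightarrow> 'b \<Rightarrow> 'a \<Rightarrow>\<^sub>0 'b::zero" where "single \<equiv> Poly_Mapping.single"
abbreviation lookup :: "('a \<Rightarrow>\<^sub>0 'b::zero) \<Rightarrow> 'a \<Rightarrow> 'b" where "lookup \<equiv> Poly_Mapping.lookup"
abbreviation keys :: "('a \<Rightarrow>\<^sub>0 'b::zero) \<Rightarrow> 'a set" where "keys \<equiv> Poly_Mapping.keys"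

definition push :: "('a \<Rightarrow> 'b) \<Rightarrow> ('a \<Rightarrow>\<^sub>0 'c::comm_monoid_add) \<Rightarrow> 'b \<Rightarrow>\<^sub>0 'c" where
  "push \<phi> u = (\<Sum>a\<in>keys u. single (\<phi> a) (lookup u a))"


section \<open>Cartan data\<close>

(* X is the free abelian group on an arbitrary basis 'r; the index set I is the finite type 'i. *)
type_synonym 'r weight = "'r \<Rightarrow>\<^sub>0 int"

(* arrow i j: there is an arrow i -> j;  red_weight k is lambda^(k), used for 1 <= k <= num_red *)
record ('i, 'r, 'k) stendhal_data =
  coroot :: "'i \<Rightarrow> 'r weight \<Rightarrow> int"
  simple_root :: "'i \<Rightarrow> 'r weight"
  fund_weight :: "'i \<Rightarrow> 'r weight"
  arrow :: "'i \<Rightarrow> 'i \<Rightarrow> bool"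
  bub_param :: "'i \<Rightarrow> 'r weight \<Rightarrow> 'k"
  num_red :: nat
  red_weight :: "nat \<Rightarrow> 'r weight"

definition cartan :: "('i, 'r, 'k) stendhal_data \<Rightarrow> 'i \<Rightarrow> 'i \<Rightarrow> int" where
  "cartan D i j = coroot D i (simple_root D j)"

definition tsign :: "('i, 'r, 'k::field) stendhal_data \<Rightarrow> 'i \<Rightarrow> 'i \<Rightarrow> 'k" where
  "tsign D i j = (if arrow D i j then -1 else 1)"

definition dominant :: "('i::finite, 'r, 'k) stendhal_data \<Rightarrow> 'r weight set" where
  "dominant D = {\<Sum>i\<in>UNIV. frag_cmul (int (a i)) (fund_weight D i) | a :: 'i \<Rightarrow> nat. True}"

definition stendhal_datum :: "('i::finite, 'r, 'k::field) stendhal_data \<Rightarrow> bool" where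
  "stendhal_datum D \<longleftrightarrow>
     (\<forall>i x y. coroot D i (x + y) = coroot D i x + coroot D i y) \<and>
     (\<forall>i. cartan D i i = 2) \<and>
     (\<forall>i j. cartan D i j = cartan D j i) \<and>
     (\<forall>i j. i \<noteq> j \<longrightarrow> cartan D i j \<in> {0, -1}) \<and>
     \<comment> \<open>finite type: the symmetric Cartan matrix is positive definite\<close>
     (\<forall>v :: 'i \<Rightarrow> real. v \<noteq> (\<lambda>_. 0) \<longrightarrow> (\<Sum>i\<in>UNIV. \<Sum>j\<in>UNIV. v i * v j * of_int (cartan D i j)) > 0) \<and>
     (\<forall>i j. coroot D i (fund_weight D j) = (if i = j then 1 else 0)) \<and>
     \<comment> \<open>each edge of the Dynkin graph carries exactly one of the two possible arrows\<close>
     (\<forall>i j. arrow D i j \<longrightarrow> cartan D i j = -1) \<and>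
     (\<forall>i j. cartan D i j = -1 \<longrightarrow> (arrow D i j \<longleftrightarrow> \<not> arrow D j i)) \<and>
     (\<forall>i \<mu>. bub_param D i \<mu> \<noteq> 0) \<and>
     (\<forall>i j \<mu>. bub_param D i (\<mu> + simple_root D j) = tsign D i j * bub_param D i \<mu>) \<and>
     (\<forall>k\<in>{1..num_red D}. red_weight D k \<in> dominant D)"

(* lambda^(k)_i *)
definition red_mult :: "('i, 'r, 'k) stendhal_data \<Rightarrow> nat \<Rightarrow> 'i \<Rightarrow> nat" where
  "red_mult D k i = nat (coroot D i (red_weight D k))"


section \<open>Symmetric functions\<close>

(* Pi is realised as the formal power series of bounded degree in the variables (i, j), i in I,
   j a natural number, which are separately symmetric in each alphabet {(i, j) | j}; a series is
   its coefficient function on monomials.  Pi \<otimes> Pi lies in the series in two copies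
   of these variables, i.e. the functions on pairs of monomials. *)
type_synonym 'i mono = "('i \<times> nat) \<Rightarrow>\<^sub>0 nat"
type_synonym ('i, 'k) ser = "'i mono \<Rightarrow> 'k"
type_synonym ('i, 'k) ser2 = "'i mono \<times> 'i mono \<Rightarrow> 'k"

definition mdeg :: "('v \<Rightarrow>\<^sub>0 nat) \<Rightarrow> nat" where
  "mdeg m = (\<Sum>v\<in>keys m. lookup m v)"

definition ser_mult :: "('m::monoid_add \<Rightarrow> 'k::comm_ring_1) \<Rightarrow> ('m \<Rightarrow> 'k) \<Rightarrow> 'm \<Rightarrow> 'k" where
  "ser_mult f g = (\<lambda>m. \<Sum>(a, b)\<in>{(a, b). a + b = m}. f a * g b)"

definition ser_one :: "'m::zero \<Rightarrow> 'k::comm_ring_1" where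
  "ser_one = (\<lambda>m. if m = 0 then 1 else 0)"

definition SymI :: "('i, 'k::comm_ring_1) ser set" where
  "SymI = {f. (\<exists>N. \<forall>m. f m \<noteq> 0 \<longrightarrow> mdeg m \<le> N) \<and>
              (\<forall>\<sigma>. bij \<sigma> \<longrightarrow> (\<forall>v. fst (\<sigma> v) = fst v) \<longrightarrow> (\<forall>m. f (push \<sigma> m) = f m))}"

definition sym_p :: "'i \<Rightarrow> nat \<Rightarrow> ('i, 'k::comm_ring_1) ser" where
  "sym_p i r = (\<lambda>m. if \<exists>j. m = single (i, j) r then 1 else 0)"

definition sym_e :: "'i \<Rightarrow> nat \<Rightarrow> ('i, 'k::comm_ring_1) ser" where
  "sym_e i r = (\<lambda>m. if keys m \<subseteq> {i} \<times> UNIV \<and> (\<forall>v. lookup m v \<le> 1) \<and> mdeg m = r then 1 else 0)"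

definition sym_h :: "'i \<Rightarrow> nat \<Rightarrow> ('i, 'k::comm_ring_1) ser" where
  "sym_h i r = (\<lambda>m. if keys m \<subseteq> {i} \<times> UNIV \<and> mdeg m = r then 1 else 0)"

definition tensor :: "('i, 'k::comm_ring_1) ser \<Rightarrow> ('i, 'k) ser \<Rightarrow> ('i, 'k) ser2"
    (infixr \<open>\<otimes>\<close> 72) where
  "g \<otimes> h = (\<lambda>(m, m'). g m * h m')"

definition SymI2 :: "('i, 'k::comm_ring_1) ser2 set" where
  "SymI2 = {(\<lambda>x. \<Sum>s<N. (g s \<otimes> h s) x) | N g h. \<forall>s<(N::nat). g s \<in> SymI \<and> h s \<in> SymI}"

(* the defining property of the coproduct delta *)
definition is_coproduct :: "(('i, 'k::comm_ring_1) ser \<Rightarrow> ('i, 'k) ser2) \<Rightarrow> bool" where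
  "is_coproduct \<delta> \<longleftrightarrow>
     (\<forall>f\<in>SymI. \<delta> f \<in> SymI2) \<and>
     (\<forall>f\<in>SymI. \<forall>g\<in>SymI. \<delta> (\<lambda>m. f m + g m) = (\<lambda>x. \<delta> f x + \<delta> g x)) \<and>
     (\<forall>a. \<forall>f\<in>SymI. \<delta> (\<lambda>m. a * f m) = (\<lambda>x. a * \<delta> f x)) \<and>
     \<delta> ser_one = ser_one \<and>
     (\<forall>f\<in>SymI. \<forall>g\<in>SymI. \<delta> (ser_mult f g) = ser_mult (\<delta> f) (\<delta> g)) \<and>
     (\<forall>i. \<forall>r\<ge>1. \<delta> (sym_p i r) = (\<lambda>x. (sym_p i r \<otimes> ser_one) x + (ser_one \<otimes> sym_p i r) x))"

(* Polynomials in indeterminates (k, i, j); those with j < lambda^(k)_i form Z^(k)_i. *)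
type_synonym 'i zvar = "nat \<times> 'i \<times> nat"
type_synonym ('i, 'k) zpoly = "('i zvar \<Rightarrow>\<^sub>0 nat) \<Rightarrow>\<^sub>0 'k"

definition zvars :: "('i, 'r, 'k) stendhal_data \<Rightarrow> 'i zvar set" where
  "zvars D = {(k, i, j). 1 \<le> k \<and> k \<le> num_red D \<and> j < red_mult D k i}"

(* A_lambda: the polynomials separately symmetric in each set Z^(k)_i *)
definition Alam :: "('i, 'r, 'k::comm_ring_1) stendhal_data \<Rightarrow> ('i, 'k) zpoly set" where
  "Alam D = {P. (\<forall>M\<in>keys P. keys M \<subseteq> zvars D) \<and>
                (\<forall>\<sigma>. \<sigma> permutes zvars D \<longrightarrow>
                     (\<forall>z. fst (\<sigma> z) = fst z \<and> fst (snd (\<sigma> z)) = fst (snd z)) \<longrightarrow>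
                     (\<forall>M. lookup P (push \<sigma> M) = lookup P M))}"

(* a_k: the variable (i, j) is sent to (k, i, j) if j < lambda^(k)_i and to 0 otherwise *)
definition eval_red :: "('i, 'r, 'k::comm_ring_1) stendhal_data \<Rightarrow> nat \<Rightarrow> ('i, 'k) ser \<Rightarrow> ('i, 'k) zpoly"
  where "eval_red D k f =
    (\<Sum>m | f m \<noteq> 0 \<and> (\<forall>(i, j)\<in>keys m. j < red_mult D k i). single (push (\<lambda>(i, j). (k, i, j)) m) (f m))"


section \<open>Diagrams\<close>

datatype 'i strand = Up 'i | Down 'i | Red nat

fun is_black :: "'i strand \<Rightarrow> bool" where
  "is_black (Red k) = False" | "is_black _ = True"

fun dual :: "'i strand \<Rightarrow> 'i strand" where
  "dual (Up i) = Down i" | "dual (Down i) = Up i" | "dual (Red k) = Red k"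

(* the points on a horizontal line, from left to right *)
type_synonym 'i word = "'i strand list"

fun wt :: "('i, 'r, 'k) stendhal_data \<Rightarrow> 'i strand \<Rightarrow> 'r weight" where
  "wt D (Up i) = simple_root D i"
| "wt D (Down i) = - simple_root D i"
| "wt D (Red k) = red_weight D k"

definition wtw :: "('i, 'r, 'k) stendhal_data \<Rightarrow> 'i word \<Rightarrow> 'r weight" where
  "wtw D w = sum_list (map (wt D) w)"

(* A Stendhal pair, as the word of its points: kappa(k) is the number of black letters to the
   right of Red k. *)
definition stendhal_word :: "('i, 'r, 'k) stendhal_data \<Rightarrow> 'i word \<Rightarrow> bool" where
  "stendhal_word D w \<longleftrightarrow> filter (\<lambda>s. \<not> is_black s) w = map Red (rev [1..<Suc (num_red D)])"

(* Elementary pieces.  Cross x y has bottom x y and top y x; Cup x creates, and Cap x removes,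
   neighbouring legs x (left) and dual x (right).  Fake x d, d < 0, is the formal bubble with d dots,
   clockwise for x = Up i and counterclockwise for x = Down i. *)
datatype 'i gen =
  Dot "'i strand" | Cross "'i strand" "'i strand" | Cup "'i strand" | Cap "'i strand"
| Fake "'i strand" int

fun valid_gen :: "'i gen \<Rightarrow> bool" where
  "valid_gen (Dot x) = is_black x"
| "valid_gen (Cross x y) = (is_black x \<or> is_black y)"
| "valid_gen (Cup x) = is_black x"
| "valid_gen (Cap x) = is_black x"
| "valid_gen (Fake x d) = (is_black x \<and> d < 0)"

fun gbot :: "'i gen \<Rightarrow> 'i word" where
  "gbot (Dot x) = [x]"
| "gbot (Cross x y) = [x, y]"
| "gbot (Cup x) = []"
| "gbot (Cap x) = [x, dual x]"
| "gbot (Fake x d) = []"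

fun gtop :: "'i gen \<Rightarrow> 'i word" where
  "gtop (Dot x) = [x]"
| "gtop (Cross x y) = [y, x]"
| "gtop (Cup x) = [x, dual x]"
| "gtop (Cap x) = []"
| "gtop (Fake x d) = []"

(* A diagram in general position is cut by horizontal lines into slices (L, g, R), consisting of an
   elementary piece g between vertical strands L and R.  Slices are listed from top to bottom, so
   that in d + e the diagram d is stacked on top of e. *)
type_synonym 'i slice = "'i word \<times> 'i gen \<times> 'i word"

datatype 'i diagram = Diagram (slices: "'i slice list")

instantiation diagram :: (type) monoid_add
begin
definition "0 = Diagram []"
definition "d + e = Diagram (slices d @ slices e)"
instance by standard (auto simp: zero_diagram_def plus_diagram_def)
end

fun slices_from_to :: "'i word \<Rightarrow> 'i slice list \<Rightarrow> 'i word \<Rightarrow> bool" where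
  "slices_from_to S [] T \<longleftrightarrow> S = T"
| "slices_from_to S ((L, g, R) # ds) T \<longleftrightarrow>
     valid_gen g \<and> T = L @ gtop g @ R \<and> slices_from_to S ds (L @ gbot g @ R)"

definition diag :: "'i word \<Rightarrow> 'i diagram \<Rightarrow> 'i word \<Rightarrow> bool" where
  "diag S d T \<longleftrightarrow> slices_from_to S (slices d) T"

fun whisker_slice :: "'i word \<Rightarrow> 'i word \<Rightarrow> 'i slice \<Rightarrow> 'i slice" where
  "whisker_slice L R (L', g, R') = (L @ L', g, R' @ R)"

definition whisker_diag :: "'i word \<Rightarrow> 'i word \<Rightarrow> 'i diagram \<Rightarrow> 'i diagram" where
  "whisker_diag L R d = Diagram (map (whisker_slice L R) (slices d))"

(* Linear combinations of diagrams; the ring multiplication is (bilinear) vertical stacking, right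
   factor at the bottom, and 1 is the diagram without slices on any word. *)
type_synonym ('i, 'k) lin = "'i diagram \<Rightarrow>\<^sub>0 ('i, 'k) zpoly"

definition hom :: "('i, 'r, 'k::comm_ring_1) stendhal_data \<Rightarrow> 'i word \<Rightarrow> 'i word \<Rightarrow> ('i, 'k) lin set" where
  "hom D S T = {u. \<forall>d\<in>keys u. diag S d T \<and> lookup u d \<in> Alam D}"

definition scal :: "('i, 'k::comm_ring_1) zpoly \<Rightarrow> ('i, 'k) lin" where
  "scal a = single 0 a"

definition kscal :: "'k::comm_ring_1 \<Rightarrow> ('i, 'k) lin" where
  "kscal a = scal (single 0 a)"

definition dgm :: "'i diagram \<Rightarrow> ('i, 'k::comm_ring_1) lin" where
  "dgm d = single d 1"

definition sl :: "'i word \<Rightarrow> 'i gen \<Rightarrow> 'i word \<Rightarrow> ('i, 'k::comm_ring_1) lin" where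
  "sl L g R = dgm (Diagram [(L, g, R)])"

definition whisker :: "'i word \<Rightarrow> ('i, 'k::comm_ring_1) lin \<Rightarrow> 'i word \<Rightarrow> ('i, 'k) lin" where
  "whisker L u R = push (whisker_diag L R) u"


section \<open>Degrees\<close>

(* mu is the weight of the region to the right of the piece, which for cups, caps and bubbles is the
   exterior region.  Isotopy invariance forces degree 0 for crossings of opposite orientations and
   2 r for the formal bubble with spade + r dots. *)
fun gen_deg :: "('i, 'r, 'k) stendhal_data \<Rightarrow> 'r weight \<Rightarrow> 'i gen \<Rightarrow> int" where
  "gen_deg D \<mu> (Dot x) = 2"
| "gen_deg D \<mu> (Cross (Up i) (Up j)) = - cartan D i j"
| "gen_deg D \<mu> (Cross (Down i) (Down j)) = - cartan D i j"
| "gen_deg D \<mu> (Cross (Red k) (Down i)) = int (red_mult D k i)"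
| "gen_deg D \<mu> (Cross (Down i) (Red k)) = int (red_mult D k i)"
| "gen_deg D \<mu> (Cross x y) = 0"
| "gen_deg D \<mu> (Cup (Up i)) = 1 - coroot D i \<mu>"
| "gen_deg D \<mu> (Cup (Down i)) = 1 + coroot D i \<mu>"
| "gen_deg D \<mu> (Cap (Up i)) = 1 - coroot D i \<mu>"
| "gen_deg D \<mu> (Cap (Down i)) = 1 + coroot D i \<mu>"
| "gen_deg D \<mu> (Fake (Up i) d) = 2 * (d + 1 - coroot D i \<mu>)"
| "gen_deg D \<mu> (Fake (Down i) d) = 2 * (d + 1 + coroot D i \<mu>)"
| "gen_deg D \<mu> _ = 0"

definition diag_deg :: "('i, 'r, 'k) stendhal_data \<Rightarrow> 'i diagram \<Rightarrow> int" where
  "diag_deg D d = (\<Sum>(L, g, R)\<leftarrow>slices d. gen_deg D (wtw D R) g)"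

definition hpart :: "('i, 'r, 'k::comm_ring_1) stendhal_data \<Rightarrow> int \<Rightarrow> ('i, 'k) lin \<Rightarrow> ('i, 'k) lin" where
  "hpart D s u =
     (\<Sum>d\<in>keys u. \<Sum>M | M \<in> keys (lookup u d) \<and> diag_deg D d + 2 * int (mdeg M) = s.
        single d (single M (lookup (lookup u d) M)))"


section \<open>Relations\<close>

(* clockwise for x = Up i and counterclockwise for x = Down i *)
definition bubble :: "'i strand \<Rightarrow> int \<Rightarrow> ('i, 'k::comm_ring_1) lin" where
  "bubble x d = (if d \<ge> 0 then sl [] (Cap x) [] * sl [] (Dot x) [dual x] ^ nat d * sl [] (Cup x) []
                 else sl [] (Fake x d) [])"

definition cw :: "('i, 'r, 'k::comm_ring_1) stendhal_data \<Rightarrow> 'r weight \<Rightarrow> 'i \<Rightarrow> int \<Rightarrow> ('i, 'k) lin" where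
  "cw D \<mu> i r = bubble (Up i) (coroot D i \<mu> - 1 + r)"

definition ccw :: "('i, 'r, 'k::comm_ring_1) stendhal_data \<Rightarrow> 'r weight \<Rightarrow> 'i \<Rightarrow> int \<Rightarrow> ('i, 'k) lin" where
  "ccw D \<mu> i r = bubble (Down i) (- coroot D i \<mu> - 1 + r)"

(* black_rel D mu S T u v: the local relation u = v between combinations of diagrams from S to T
   with right-hand region mu.  Planar isotopy of diagrams in general position is generated by the
   rules interchange, zigzag_*, dot_cap, dot_cup and pitchfork_*; the pitchforks also express the
   crossings of the other orientations as rotations of the upward ones.  In dot_cross_left, ... the
   term 1 is the uncrossed diagram. *)
inductive black_rel ::
  "('i, 'r, 'k::field) stendhal_data \<Rightarrow> 'r weight \<Rightarrow> 'i word \<Rightarrow> 'i word \<Rightarrow> ('i, 'k) lin \<Rightarrow> ('i, 'k) lin \<Rightarrow> bool"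
  for D \<mu> where
  interchange: "valid_gen g \<Longrightarrow> valid_gen h \<Longrightarrow> black_rel D \<mu> (gbot g @ M @ gbot h) (gtop g @ M @ gtop h)
     (sl [] g (M @ gtop h) * sl (gbot g @ M) h [])
     (sl (gtop g @ M) h [] * sl [] g (M @ gbot h))"
| zigzag_left: "is_black x \<Longrightarrow> black_rel D \<mu> [x] [x] (sl [] (Cap x) [x] * sl [x] (Cup (dual x)) []) 1"
| zigzag_right: "is_black x \<Longrightarrow> black_rel D \<mu> [x] [x] (sl [x] (Cap (dual x)) [] * sl [] (Cup x) [x]) 1"
| dot_cap: "is_black x \<Longrightarrow> black_rel D \<mu> [x, dual x] []
     (sl [] (Cap x) [] * sl [] (Dot x) [dual x]) (sl [] (Cap x) [] * sl [x] (Dot (dual x)) [])"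
| dot_cup: "is_black x \<Longrightarrow> black_rel D \<mu> [] [x, dual x]
     (sl [] (Dot x) [dual x] * sl [] (Cup x) []) (sl [x] (Dot (dual x)) [] * sl [] (Cup x) [])"
| pitchfork_cap: "is_black x \<Longrightarrow> is_black y \<Longrightarrow> black_rel D \<mu> [x, y, dual x] [y]
     (sl [y] (Cap x) [] * sl [] (Cross x y) [dual x]) (sl [] (Cap x) [y] * sl [x] (Cross y (dual x)) [])"
| pitchfork_cup: "is_black x \<Longrightarrow> is_black y \<Longrightarrow> black_rel D \<mu> [y] [x, y, dual x]
     (sl [] (Cross y x) [dual x] * sl [y] (Cup x) []) (sl [x] (Cross (dual x) y) [] * sl [] (Cup x) [y])"
| dot_cross_left: "black_rel D \<mu> [Up i, Up j] [Up j, Up i]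
     (sl [] (Dot (Up j)) [Up i] * sl [] (Cross (Up i) (Up j)) [])
     (sl [] (Cross (Up i) (Up j)) [] * sl [Up i] (Dot (Up j)) [] + (if i = j then 1 else 0))"
| dot_cross_right: "black_rel D \<mu> [Up i, Up j] [Up j, Up i]
     (sl [] (Cross (Up i) (Up j)) [] * sl [] (Dot (Up i)) [Up j])
     (sl [Up j] (Dot (Up i)) [] * sl [] (Cross (Up i) (Up j)) [] + (if i = j then 1 else 0))"
| cross_cross: "black_rel D \<mu> [Up i, Up j] [Up i, Up j]
     (sl [] (Cross (Up j) (Up i)) [] * sl [] (Cross (Up i) (Up j)) [])
     (if i = j then 0 else if cartan D i j = 0 then 1
      else kscal (tsign D i j) * sl [] (Dot (Up i)) [Up j] + kscal (tsign D j i) * sl [Up i] (Dot (Up j)) [])"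
| braid: "black_rel D \<mu> [Up i, Up j, Up k] [Up k, Up j, Up i]
     (sl [] (Cross (Up j) (Up k)) [Up i] * sl [Up j] (Cross (Up i) (Up k)) [] * sl [] (Cross (Up i) (Up j)) [Up k]
      - sl [Up k] (Cross (Up i) (Up j)) [] * sl [] (Cross (Up i) (Up k)) [Up j] * sl [Up i] (Cross (Up j) (Up k)) [])
     (if i = k \<and> cartan D i j = -1 then kscal (tsign D i j) else 0)"
| mixed_up_down: "i \<noteq> j \<Longrightarrow> black_rel D \<mu> [Up i, Down j] [Up i, Down j]
     (sl [] (Cross (Down j) (Up i)) [] * sl [] (Cross (Up i) (Down j)) []) 1"
| mixed_down_up: "i \<noteq> j \<Longrightarrow> black_rel D \<mu> [Down j, Up i] [Down j, Up i]
     (sl [] (Cross (Up i) (Down j)) [] * sl [] (Cross (Down j) (Up i)) []) 1"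
| cw_neg: "r < 0 \<Longrightarrow> black_rel D \<mu> [] [] (cw D \<mu> i r) 0"
| ccw_neg: "r < 0 \<Longrightarrow> black_rel D \<mu> [] [] (ccw D \<mu> i r) 0"
| cw_zero: "black_rel D \<mu> [] [] (cw D \<mu> i 0) (kscal (bub_param D i \<mu>))"
| ccw_zero: "black_rel D \<mu> [] [] (ccw D \<mu> i 0) (kscal (inverse (bub_param D i \<mu>)))"
| grassmannian: "black_rel D \<mu> [] [] (\<Sum>r\<le>N. ccw D \<mu> i (int r) * cw D \<mu> i (int (N - r))) (if N = 0 then 1 else 0)"
| inverse_up_down: "black_rel D \<mu> [Up i, Down i] [Up i, Down i] 1
     (- (sl [] (Cross (Down i) (Up i)) [] * sl [] (Cross (Up i) (Down i)) [])
      + (\<Sum>(a, b, c)\<in>{(a, b, c :: nat). int (a + b + c) = coroot D i \<mu> - 1}.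
           sl [] (Dot (Up i)) [Down i] ^ a * sl [] (Cup (Up i)) [] * ccw D \<mu> i (int b)
           * sl [] (Cap (Up i)) [] * sl [] (Dot (Up i)) [Down i] ^ c))"
| inverse_down_up: "black_rel D \<mu> [Down i, Up i] [Down i, Up i] 1
     (- (sl [] (Cross (Up i) (Down i)) [] * sl [] (Cross (Down i) (Up i)) [])
      + (\<Sum>(a, b, c)\<in>{(a, b, c :: nat). int (a + b + c) = - coroot D i \<mu> - 1}.
           sl [] (Dot (Down i)) [Up i] ^ a * sl [] (Cup (Down i)) [] * cw D \<mu> i (int b)
           * sl [] (Cap (Down i)) [] * sl [] (Dot (Down i)) [Up i] ^ c))"

inductive red_rel ::
  "('i, 'r, 'k::field) stendhal_data \<Rightarrow> 'i word \<Rightarrow> 'i word \<Rightarrow> ('i, 'k) lin \<Rightarrow> ('i, 'k) lin \<Rightarrow> bool"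
  for D where
  dot_right: "is_black x \<Longrightarrow> red_rel D [x, Red k] [Red k, x]
     (sl [] (Cross x (Red k)) [] * sl [] (Dot x) [Red k]) (sl [Red k] (Dot x) [] * sl [] (Cross x (Red k)) [])"
| dot_left: "is_black x \<Longrightarrow> red_rel D [Red k, x] [x, Red k]
     (sl [] (Cross (Red k) x) [] * sl [Red k] (Dot x) []) (sl [] (Dot x) [Red k] * sl [] (Cross (Red k) x) [])"
| up_red: "red_rel D [Up i, Red k] [Up i, Red k]
     (sl [] (Cross (Red k) (Up i)) [] * sl [] (Cross (Up i) (Red k)) []) 1"
| red_up: "red_rel D [Red k, Up i] [Red k, Up i]
     (sl [] (Cross (Up i) (Red k)) [] * sl [] (Cross (Red k) (Up i)) []) 1"
| red_cap: "is_black x \<Longrightarrow> red_rel D [x, Red k, dual x] [Red k]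
     (sl [Red k] (Cap x) [] * sl [] (Cross x (Red k)) [dual x])
     (sl [] (Cap x) [Red k] * sl [x] (Cross (Red k) (dual x)) [])"
| red_cup: "is_black x \<Longrightarrow> red_rel D [Red k] [x, Red k, dual x]
     (sl [] (Cross (Red k) x) [dual x] * sl [Red k] (Cup x) [])
     (sl [x] (Cross (dual x) (Red k)) [] * sl [] (Cup x) [Red k])"
| red_left_to_right: "red_rel D [Red k, Up i, Up j] [Up j, Up i, Red k]
     (sl [Up j] (Cross (Red k) (Up i)) [] * sl [] (Cross (Red k) (Up j)) [Up i] * sl [Red k] (Cross (Up i) (Up j)) [])
     (sl [] (Cross (Up i) (Up j)) [Red k] * sl [Up i] (Cross (Red k) (Up j)) [] * sl [] (Cross (Red k) (Up i)) [Up j])"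
| red_right_to_left: "red_rel D [Up i, Up j, Red k] [Red k, Up j, Up i]
     (sl [Red k] (Cross (Up i) (Up j)) [] * sl [] (Cross (Up i) (Red k)) [Up j] * sl [Up i] (Cross (Up j) (Red k)) [])
     (sl [] (Cross (Up j) (Red k)) [Up i] * sl [Up j] (Cross (Up i) (Red k)) [] * sl [] (Cross (Up i) (Up j)) [Red k])"
| red_middle: "red_rel D [Up i, Red k, Up j] [Up j, Red k, Up i]
     (sl [Up j] (Cross (Up i) (Red k)) [] * sl [] (Cross (Up i) (Up j)) [Red k] * sl [Up i] (Cross (Red k) (Up j)) [])
     (sl [] (Cross (Red k) (Up j)) [Up i] * sl [Red k] (Cross (Up i) (Up j)) [] * sl [] (Cross (Up i) (Red k)) [Up j])"
| down_red: "red_rel D [Down i, Red k] [Down i, Red k]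
     (sl [] (Cross (Red k) (Down i)) [] * sl [] (Cross (Down i) (Red k)) [])
     (\<Sum>p\<le>red_mult D k i. scal ((-1) ^ p * eval_red D k (sym_e i p)) * sl [] (Dot (Down i)) [Red k] ^ (red_mult D k i - p))"
| red_down: "red_rel D [Red k, Down i] [Red k, Down i]
     (sl [] (Cross (Down i) (Red k)) [] * sl [] (Cross (Red k) (Down i)) [])
     (\<Sum>p\<le>red_mult D k i. scal ((-1) ^ p * eval_red D k (sym_e i p)) * sl [Red k] (Dot (Down i)) [] ^ (red_mult D k i - p))"
| down_red_down: "red_rel D [Down i, Red k, Down j] [Down j, Red k, Down i]
     (sl [Down j] (Cross (Down i) (Red k)) [] * sl [] (Cross (Down i) (Down j)) [Red k] * sl [Down i] (Cross (Red k) (Down j)) [])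
     (sl [] (Cross (Red k) (Down j)) [Down i] * sl [Red k] (Cross (Down i) (Down j)) [] * sl [] (Cross (Down i) (Red k)) [Down j]
      + (if i = j then \<Sum>(r, p, q)\<in>{(r, p, q). r + p + q + 1 = red_mult D k i}.
           scal ((-1) ^ r * eval_red D k (sym_e i r)) * sl [] (Dot (Down i)) [Red k, Down j] ^ p * sl [Down i, Red k] (Dot (Down j)) [] ^ q
         else 0))"

(* The A-submodule of hom D S T spanned by all u - v, for local relations u = v, inserted into
   arbitrary diagrams.  P R' S' T' u v: the relation u = v between combinations of diagrams from
   S' to T' may be applied when R' is what lies to its right. *)
inductive_set rel_span ::
  "('i, 'r, 'k::field) stendhal_data \<Rightarrow>
   ('i word \<Rightarrow> 'i word \<Rightarrow> 'i word \<Rightarrow> ('i, 'k) lin \<Rightarrow> ('i, 'k) lin \<Rightarrow> bool) \<Rightarrow> 'i word \<Rightarrow> 'i word \<Rightarrow> ('i, 'k) lin set"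
  for D P S T where
  zero: "0 \<in> rel_span D P S T"
| add: "u \<in> rel_span D P S T \<Longrightarrow> v \<in> rel_span D P S T \<Longrightarrow> u + v \<in> rel_span D P S T"
| rel: "a \<in> Alam D \<Longrightarrow> P R' S' T' u v \<Longrightarrow> diag S d (L' @ S' @ R') \<Longrightarrow> diag (L' @ T' @ R') d' T \<Longrightarrow>
    scal a * dgm d' * whisker L' (u - v) R' * dgm d \<in> rel_span D P S T"

(* purely black diagrams whose rightmost region has weight mu *)
definition U_span :: "('i, 'r, 'k::field) stendhal_data \<Rightarrow> 'r weight \<Rightarrow> 'i word \<Rightarrow> 'i word \<Rightarrow> ('i, 'k) lin set" where
  "U_span D \<mu> = rel_span D (\<lambda>R'. black_rel D (wtw D R' + \<mu>))"

(* Stendhal diagrams: the rightmost region has weight 0, and a black string at the far right of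
   a horizontal line kills the diagram. *)
definition X_span :: "('i, 'r, 'k::field) stendhal_data \<Rightarrow> 'i word \<Rightarrow> 'i word \<Rightarrow> ('i, 'k) lin set" where
  "X_span D = rel_span D (\<lambda>R' S' T' u v. black_rel D (wtw D R') S' T' u v \<or> red_rel D S' T' u v \<or>
     (R' = [] \<and> (\<exists>x. is_black x \<and> S' = [x] \<and> T' = [x]) \<and> u = 1 \<and> v = 0))"

(* Equality of morphisms from S to T in the category with morphism spaces the direct sums over s of
   the spaces of degree s combinations of Stendhal diagrams modulo the relations *)
definition X_eq :: "('i, 'r, 'k::field) stendhal_data \<Rightarrow> 'i word \<Rightarrow> 'i word \<Rightarrow> ('i, 'k) lin \<Rightarrow> ('i, 'k) lin \<Rightarrow> bool" where
  "X_eq D S T u v \<longleftrightarrow> u \<in> hom D S T \<and> v \<in> hom D S T \<and> (\<forall>s. hpart D s u - hpart D s v \<in> X_span D S T)"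

definition U_eq :: "('i, 'r, 'k::field) stendhal_data \<Rightarrow> 'r weight \<Rightarrow> ('i, 'k) lin \<Rightarrow> ('i, 'k) lin \<Rightarrow> bool" where
  "U_eq D \<mu> u v \<longleftrightarrow> u - v \<in> U_span D \<mu> [] []"

(* The defining property of the algebra homomorphism b_mu.  Its values are endomorphisms of the empty
   word in the region mu, modulo black relations, represented by combinations of closed black diagrams
   (diagrams with empty bottom contain no red strings). *)
definition is_bubble_hom ::
  "('i, 'r, 'k::field) stendhal_data \<Rightarrow> 'r weight \<Rightarrow> (('i, 'k) ser \<Rightarrow> ('i, 'k) lin) \<Rightarrow> bool" where
  "is_bubble_hom D \<mu> b \<longleftrightarrow>
     (\<forall>f\<in>SymI. b f \<in> hom D [] []) \<and>
     (\<forall>f\<in>SymI. \<forall>g\<in>SymI. U_eq D \<mu> (b (\<lambda>m. f m + g m)) (b f + b g)) \<and>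
     (\<forall>a. \<forall>f\<in>SymI. U_eq D \<mu> (b (\<lambda>m. a * f m)) (kscal a * b f)) \<and>
     U_eq D \<mu> (b ser_one) 1 \<and>
     (\<forall>f\<in>SymI. \<forall>g\<in>SymI. U_eq D \<mu> (b (ser_mult f g)) (b f * b g)) \<and>
     (\<forall>i r. U_eq D \<mu> (b (\<lambda>m. (-1) ^ r * sym_e i r m)) (kscal (bub_param D i \<mu>) * ccw D \<mu> i (int r))) \<and>
     (\<forall>i r. U_eq D \<mu> (b (sym_h i r)) (kscal (inverse (bub_param D i \<mu>)) * cw D \<mu> i (int r)))"

end

theory Submission
  imports Defs "HOL-Computational_Algebra.Formal_Power_Series"
begin

text \<open>
  All calculations are made with one red string, modulo the relations that are valid in a region of
  any weight.  Write \<open>\<mu>\<close> and \<open>\<nu> = \<mu> + \<lambda>\<close> for the weights to the right and to the left of the red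
  string.  The substance is the case of the elementary symmetric functions: the generating series of
  counterclockwise bubbles on the left, normalised to have constant term one, is the product of the one
  on the right and the polynomial \<open>\<Sum> (-1)^p e_p x^p\<close> of the red string (\<open>red_poly_ccw_right\<close>).

  A bubble with a nonnegative number of dots can be pulled through the red string.  One leg moves across
  it at no cost, the other one crosses it twice, and the double crossing is that polynomial
  evaluated at the dot (\<open>ccw_bubble_through_red\<close>, \<open>cw_bubble_through_red\<close>).  Fake bubbles cannot be
  moved.  Instead a figure eight is moved through the red string (\<open>fig8_through_red\<close>): the relation
  for a red string and a crossing of two downward strings produces correction terms which are products
  of a clockwise bubble on the left and a counterclockwise one on the right, and these bubbles are not
  fake in the degrees that matter.  On either side a figure eight is a curl, and it is computed from the
  inverse relations and the nilHecke relations (\<open>fig8_eval_nonneg\<close>, \<open>fig8_eval_nonpos\<close>).  The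
  resulting identity (\<open>fig8_identity\<close>) determines the fake bubbles.  It also
  takes care of the fact that the normalising parameters of the bubbles on the two sides are unrelated:
  their quotient turns out to act as the identity on the bubbles that can be pulled through.

  The passage to all symmetric functions is algebra.  Newton's identities turn the product formula for
  the elementary functions into the additive formula for power sums (\<open>power_sum_left\<close>), which is
  the shape of the coproduct on them.  Power sums generate the symmetric functions (\<open>SymI_induct\<close>), and
  both sides of the formula are multiplicative; a decomposition of \<open>\<delta> f\<close> into pure tensors may be
  chosen freely, since the right hand side depends on the tensor only (\<open>right_value_unique\<close>).

  Equality in the category is asked for in each degree separately.  It follows from the congruence of the
  full sums because all relations are homogeneous (\<open>X_span_hpart\<close>).
\<close>

section \<open>Finitely supported functions\<close>

lemma push_eq_sum:
  assumes "finite A" "keys u \<subseteq> A"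
  shows "push \<phi> u = (\<Sum>a\<in>A. single (\<phi> a) (lookup u a))"
  unfolding push_def using assms
  by (intro sum.mono_neutral_left) (auto simp: in_keys_iff)

lemma push_zero [simp]: "push \<phi> 0 = 0"
  by (simp add: push_def)

lemma push_single [simp]: "push \<phi> (single a c) = single (\<phi> a) c"
  by (simp add: push_eq_sum[of "{a}"])

lemma push_add: "push \<phi> (u + v) = push \<phi> u + push \<phi> v"
proof -
  let ?A = "keys u \<union> keys v"
  have "push \<phi> (u + v) = (\<Sum>a\<in>?A. single (\<phi> a) (lookup (u + v) a))"
    by (rule push_eq_sum) (use keys_add[of u v] in auto)
  also have "\<dots> = push \<phi> u + push \<phi> v"
    by (simp add: push_eq_sum[of ?A] lookup_add single_add sum.distrib)
  finally show ?thesis .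
qed

lemma push_sum: "push \<phi> (\<Sum>x\<in>X. f x) = (\<Sum>x\<in>X. push \<phi> (f x))"
  by (induction X rule: infinite_finite_induct) (auto simp: push_add)

lemma push_uminus: "push \<phi> (- u) = - push \<phi> (u :: _ \<Rightarrow>\<^sub>0 'c::ab_group_add)"
  using push_add[of \<phi> "- u" u] by (simp add: eq_neg_iff_add_eq_0)

lemma push_diff: "push \<phi> (u - v) = push \<phi> u - push \<phi> (v :: _ \<Rightarrow>\<^sub>0 'c::ab_group_add)"
  using push_add[of \<phi> u "- v"] by (simp add: push_uminus)

lemma sum_single_keys: "u = (\<Sum>a\<in>keys u. single a (lookup u a))"
proof (rule poly_mapping_eqI)
  fix b
  show "lookup u b = lookup (\<Sum>a\<in>keys u. single a (lookup u a)) b"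
    by (auto simp: lookup_sum lookup_single when_def in_keys_iff)
qed

lemma push_id: "push (\<lambda>x. x) u = u"
  unfolding push_def by (rule sum_single_keys[symmetric])

lemma push_comp: "push \<phi> (push \<psi> u) = push (\<lambda>x. \<phi> (\<psi> x)) u"
  by (subst (2) push_def) (simp add: push_sum, simp add: push_def)

lemma push_mult:
  fixes u v :: "'a::monoid_add \<Rightarrow>\<^sub>0 'c::semiring_0"
  assumes "\<And>a b. \<phi> (a + b) = \<phi> a + \<phi> b"
  shows "push \<phi> (u * v) = push \<phi> u * push \<phi> v"
proof -
  have "push \<phi> (u * v) =
        push \<phi> ((\<Sum>a\<in>keys u. single a (lookup u a)) * (\<Sum>b\<in>keys v. single b (lookup v b)))"
    by (rule arg_cong2[where f="\<lambda>x y. push \<phi> (x * y)", OF sum_single_keys sum_single_keys])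
  also have "\<dots> = push \<phi> u * push \<phi> v"
    by (simp add: sum_product push_sum mult_single assms) (simp add: push_def sum_product mult_single)
  finally show ?thesis .
qed

lemma lookup_push_inj:
  assumes "inj \<phi>"
  shows "lookup (push \<phi> u) (\<phi> a) = lookup u a"
  by (auto simp: push_def lookup_sum lookup_single when_def inj_eq[OF assms] in_keys_iff)

lemma lookup_push_outside:
  assumes "b \<notin> \<phi> ` keys u"
  shows "lookup (push \<phi> u) b = 0"
  using assms by (auto simp: push_def lookup_sum lookup_single when_def intro!: sum.neutral)

lemma keys_push_subset: "keys (push \<phi> u) \<subseteq> \<phi> ` keys u"
proof
  fix b assume "b \<in> keys (push \<phi> u)"
  then show "b \<in> \<phi> ` keys u"
    using lookup_push_outside[of b \<phi> u] by (meson in_keys_iff)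
qed

lemma keys_push_inj:
  assumes "inj \<phi>"
  shows "keys (push \<phi> u) = \<phi> ` keys u"
proof
  show "\<phi> ` keys u \<subseteq> keys (push \<phi> u)"
  proof
    fix b assume "b \<in> \<phi> ` keys u"
    then obtain a where "a \<in> keys u" "b = \<phi> a"
      by blast
    then show "b \<in> keys (push \<phi> u)"
      using lookup_push_inj[OF assms, of u a] by (simp add: in_keys_iff)
  qed
qed (rule keys_push_subset)

lemma inj_push:
  assumes "inj \<phi>"
  shows "inj (push \<phi> :: _ \<Rightarrow> _ \<Rightarrow>\<^sub>0 'c::comm_monoid_add)"
proof (rule injI)
  fix u v :: "_ \<Rightarrow>\<^sub>0 'c" assume "push \<phi> u = push \<phi> v"
  then show "u = v"
    by (metis lookup_push_inj[OF assms] poly_mapping_eqI)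
qed

lemma push_cong: "(\<And>a. a \<in> keys u \<Longrightarrow> \<phi> a = \<psi> a) \<Longrightarrow> push \<phi> u = push \<psi> u"
  by (simp add: push_def)

lemma mdeg_eq_sum:
  assumes "finite A" "keys m \<subseteq> A"
  shows "mdeg m = (\<Sum>v\<in>A. lookup m v)"
  unfolding mdeg_def using assms by (intro sum.mono_neutral_left) (auto simp: in_keys_iff)

lemma mdeg_zero [simp]: "mdeg 0 = 0"
  by (simp add: mdeg_def)

lemma mdeg_single [simp]: "mdeg (single v n) = n"
  by (simp add: mdeg_eq_sum[of "{v}"])

lemma mdeg_add: "mdeg (m + m') = mdeg m + mdeg m'"
proof -
  let ?A = "keys m \<union> keys m'"
  have "mdeg (m + m') = (\<Sum>v\<in>?A. lookup (m + m') v)"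
    by (rule mdeg_eq_sum) (use keys_add[of m m'] in auto)
  then show ?thesis
    by (simp add: mdeg_eq_sum[of ?A] lookup_add sum.distrib)
qed

lemma mdeg_sum: "mdeg (\<Sum>x\<in>X. f x) = (\<Sum>x\<in>X. mdeg (f x))"
  by (induction X rule: infinite_finite_induct) (auto simp: mdeg_add)

lemma mdeg_push: "mdeg (push \<phi> m) = mdeg m"
  unfolding push_def mdeg_sum by (simp add: mdeg_def[of m])


section \<open>Scalars\<close>

definition zsym :: "('i, 'r, 'k::comm_ring_1) stendhal_data \<Rightarrow> ('i zvar \<Rightarrow> 'i zvar) \<Rightarrow> bool" where
  "zsym D \<sigma> \<longleftrightarrow> \<sigma> permutes zvars D \<and> (\<forall>z. fst (\<sigma> z) = fst z \<and> fst (snd (\<sigma> z)) = fst (snd z))"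

lemma zsym_inj: "zsym D \<sigma> \<Longrightarrow> inj \<sigma>"
  by (auto simp: zsym_def permutes_inj)

lemma push_zsym_inverse: "zsym D \<sigma> \<Longrightarrow> push \<sigma> (push (inv \<sigma>) M) = M"
  by (auto simp: push_comp zsym_def permutes_inverses(1)[of \<sigma> "zvars D"] push_id)

text \<open>Invariance of the coefficient function is the same as being fixed by the ring homomorphisms that
  permute the variables; in this form closure under multiplication is immediate.\<close>

lemma Alam_iff:
  "P \<in> Alam D \<longleftrightarrow> (\<forall>M\<in>keys P. keys M \<subseteq> zvars D) \<and> (\<forall>\<sigma>. zsym D \<sigma> \<longrightarrow> push (push \<sigma>) P = P)"
proof -
  have "(\<forall>M. lookup P (push \<sigma> M) = lookup P M) \<longleftrightarrow> push (push \<sigma>) P = P" if z: "zsym D \<sigma>" for \<sigma>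
  proof
    assume *: "\<forall>M. lookup P (push \<sigma> M) = lookup P M"
    show "push (push \<sigma>) P = P"
    proof (rule poly_mapping_eqI)
      fix M
      have "lookup (push (push \<sigma>) P) (push \<sigma> (push (inv \<sigma>) M)) = lookup P (push (inv \<sigma>) M)"
        by (rule lookup_push_inj) (rule inj_push[OF zsym_inj[OF z]])
      also have "\<dots> = lookup P M"
        using * push_zsym_inverse[OF z] by metis
      finally show "lookup (push (push \<sigma>) P) M = lookup P M"
        by (simp add: push_zsym_inverse[OF z])
    qed
  next
    assume *: "push (push \<sigma>) P = P"
    show "\<forall>M. lookup P (push \<sigma> M) = lookup P M"
      using lookup_push_inj[OF inj_push[OF zsym_inj[OF z]], of P] * by simp
  qed
  then show ?thesis
    unfolding Alam_def by (auto simp: zsym_def)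
qed

lemma Alam_zero [simp]: "0 \<in> Alam D"
  by (simp add: Alam_iff)

lemma Alam_const [simp]: "single 0 c \<in> Alam D"
  by (auto simp: Alam_iff)

lemma Alam_one [simp]: "1 \<in> Alam D"
  using Alam_const[of 1 D] by simp

lemma Alam_add [simp]: "P \<in> Alam D \<Longrightarrow> Q \<in> Alam D \<Longrightarrow> P + Q \<in> Alam D"
  using keys_add[of P Q] by (fastforce simp: Alam_iff push_add)

lemma Alam_uminus [simp]: "P \<in> Alam D \<Longrightarrow> - P \<in> Alam D"
  by (auto simp: Alam_iff push_uminus in_keys_iff)

lemma Alam_mult [simp]: "P \<in> Alam D \<Longrightarrow> Q \<in> Alam D \<Longrightarrow> P * Q \<in> Alam D"
proof -
  assume P: "P \<in> Alam D" and Q: "Q \<in> Alam D"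
  have "keys M \<subseteq> zvars D" if "M \<in> keys (P * Q)" for M
  proof -
    obtain a b where "a \<in> keys P" "b \<in> keys Q" "M = a + b"
      using \<open>M \<in> keys (P * Q)\<close> keys_mult[of P Q] by auto
    then show ?thesis
      using P Q keys_add[of a b] by (fastforce simp: Alam_iff)
  qed
  then show ?thesis
    using P Q by (auto simp: Alam_iff push_mult push_add)
qed

lemma Alam_power [simp]: "P \<in> Alam D \<Longrightarrow> P ^ n \<in> Alam D"
  by (induction n) auto

lemma scal_zero [simp]: "scal 0 = 0"
  and scal_one [simp]: "scal 1 = 1"
  and scal_add: "scal (a + b) = scal a + scal b"
  and scal_uminus: "scal (- a) = - scal a"
  and scal_diff: "scal (a - b) = scal a - scal b"
  and scal_mult: "scal (a * b) = scal a * scal b"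
  by (simp_all add: scal_def single_add single_uminus single_diff mult_single)

lemma scal_sum: "scal (sum f X) = (\<Sum>x\<in>X. scal (f x))"
  by (induction X rule: infinite_finite_induct) (auto simp: scal_add)

lemma scal_dgm: "scal a * dgm d = single d a"
  by (simp add: scal_def dgm_def mult_single)

lemma scal_commute: "u * scal a = scal a * (u :: ('i, 'k::comm_ring_1) lin)"
proof -
  have "(\<Sum>d\<in>keys u. single d (lookup u d)) * scal a = scal a * (\<Sum>d\<in>keys u. single d (lookup u d))"
    by (simp add: scal_def sum_distrib_left sum_distrib_right mult_single mult.commute)
  then show ?thesis
    by (simp flip: sum_single_keys)
qed

lemma kscal_zero [simp]: "kscal 0 = 0"
  and kscal_one [simp]: "kscal 1 = 1"
  and kscal_add: "kscal (a + b) = kscal a + kscal b"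
  and kscal_diff: "kscal (a - b) = kscal a - kscal b"
  and kscal_uminus: "kscal (- a) = - kscal a"
  and kscal_mult: "kscal (a * b) = kscal a * kscal b"
  by (simp_all add: kscal_def single_add single_diff single_uminus scal_add scal_diff scal_uminus
      flip: scal_mult) (simp_all add: mult_single)

lemma kscal_commute: "u * kscal a = kscal a * (u :: ('i, 'k::comm_ring_1) lin)"
  by (simp add: kscal_def scal_commute)


section \<open>Diagrams and their linear combinations\<close>

lemma diag_zero [simp]: "diag S 0 T \<longleftrightarrow> S = T"
  by (simp add: diag_def zero_diagram_def)

lemma slices_from_to_append:
  "slices_from_to S (xs @ ys) T \<longleftrightarrow> (\<exists>W. slices_from_to S ys W \<and> slices_from_to W xs T)"
proof (induction xs arbitrary: T)
  case Nil
  then show ?case by (auto)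
next
  case (Cons x xs)
  then show ?case by (cases x) auto
qed

lemma diag_add: "diag S d W \<Longrightarrow> diag W e T \<Longrightarrow> diag S (e + d) T"
  by (auto simp: diag_def plus_diagram_def slices_from_to_append)

lemma whisker_diag_add: "whisker_diag L R (d + e) = whisker_diag L R d + whisker_diag L R e"
  by (simp add: whisker_diag_def plus_diagram_def)

lemma slices_from_to_whisker:
  "slices_from_to S xs T \<Longrightarrow> slices_from_to (L @ S @ R) (map (whisker_slice L R) xs) (L @ T @ R)"
  by (induction S xs T rule: slices_from_to.induct) auto

lemma diag_whisker: "diag S d T \<Longrightarrow> diag (L @ S @ R) (whisker_diag L R d) (L @ T @ R)"
  by (simp add: diag_def whisker_diag_def slices_from_to_whisker)

lemma whisker_zero [simp]: "whisker L 0 R = 0"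
  by (simp add: whisker_def)

lemma whisker_add: "whisker L (u + v) R = whisker L u R + whisker L v R"
  by (simp add: whisker_def push_add)

lemma whisker_uminus: "whisker L (- u) R = - whisker L u R"
  by (simp add: whisker_def push_uminus)

lemma whisker_diff: "whisker L (u - v) R = whisker L u R - whisker L v R"
  by (simp add: whisker_def push_diff)

lemma whisker_sum: "whisker L (sum f X) R = (\<Sum>x\<in>X. whisker L (f x) R)"
  by (simp add: whisker_def push_sum)

lemma whisker_mult: "whisker L (u * v) R = whisker L u R * whisker L v R"
  by (simp add: whisker_def push_mult whisker_diag_add)

lemma whisker_scal [simp]: "whisker L (scal a) R = scal a"
  by (simp add: whisker_def scal_def whisker_diag_def zero_diagram_def)

lemma whisker_kscal [simp]: "whisker L (kscal a) R = kscal a"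
  by (simp add: kscal_def)

lemma whisker_one [simp]: "whisker L 1 R = 1"
  using whisker_scal[of L 1 R] by simp

lemma whisker_dgm: "whisker L (dgm d) R = dgm (whisker_diag L R d)"
  by (simp add: whisker_def dgm_def)

lemma whisker_whisker: "whisker L (whisker L' u R') R = whisker (L @ L') u (R' @ R)"
proof -
  have "whisker_slice L R (whisker_slice L' R' s) = whisker_slice (L @ L') (R' @ R) s" for s :: "'a slice"
    by (cases s) auto
  then show ?thesis
    by (simp add: whisker_def push_comp whisker_diag_def[abs_def] comp_def)
qed

lemma whisker_Nil [simp]: "whisker [] u [] = u"
proof -
  have "whisker_slice [] [] s = s" for s :: "'a slice"
    by (cases s) auto
  then have "map (whisker_slice [] []) xs = xs" for xs :: "'a slice list"
    by (simp add: map_idI)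
  then show ?thesis
    by (simp add: whisker_def whisker_diag_def[abs_def] push_id)
qed

text \<open>Concrete diagrams are written as lists of slices, so that stacking is concatenation and the
  condition of being a diagram between two given words is decided by simplification.\<close>

definition dl :: "'i slice list \<Rightarrow> ('i, 'k::comm_ring_1) lin" where
  "dl xs = dgm (Diagram xs)"

lemma dl_Nil [simp]: "dl [] = 1"
  by (simp add: dl_def dgm_def flip: zero_diagram_def)

lemma dgm_mult: "dgm d * dgm e = dgm (d + e)"
  by (simp add: dgm_def mult_single)

lemma dl_mult: "dl xs * dl ys = dl (xs @ ys)"
  by (simp add: dl_def dgm_mult plus_diagram_def)

lemma dl_power: "dl xs ^ n = dl (concat (replicate n xs))"
  by (induction n) (auto simp: dl_mult)

lemma dl_power_single: "dl [s] ^ n = dl (replicate n s)"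
proof -
  have "concat (replicate n [s]) = replicate n s"
    by (induction n) auto
  then show ?thesis by (simp add: dl_power)
qed

lemma sl_dl: "sl L g R = dl [(L, g, R)]"
  by (simp add: sl_def dl_def)

lemma whisker_dl: "whisker L (dl xs) R = dl (map (whisker_slice L R) xs)"
  by (simp add: dl_def whisker_dgm whisker_diag_def)

lemma hom_zero [simp]: "0 \<in> hom D S T"
  by (simp add: hom_def)

lemma hom_add [simp]: "u \<in> hom D S T \<Longrightarrow> v \<in> hom D S T \<Longrightarrow> u + v \<in> hom D S T"
proof -
  assume u: "u \<in> hom D S T" and v: "v \<in> hom D S T"
  have "lookup w d \<in> Alam D" if "w \<in> hom D S T" for w d
    using that by (cases "d \<in> keys w") (auto simp: hom_def in_keys_iff)
  then show ?thesis
    using u v keys_add[of u v] by (fastforce simp: hom_def lookup_add)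
qed

lemma hom_scal_dgm: "a \<in> Alam D \<Longrightarrow> diag S d T \<Longrightarrow> scal a * dgm d \<in> hom D S T"
  by (auto simp: scal_dgm hom_def)

lemma hom_induct [consumes 1, case_names zero add base]:
  assumes "u \<in> hom D S T"
    and "P 0" and "\<And>u v. P u \<Longrightarrow> P v \<Longrightarrow> P (u + v)"
    and "\<And>a d. a \<in> Alam D \<Longrightarrow> diag S d T \<Longrightarrow> P (scal a * dgm d)"
  shows "P u"
proof -
  have "P (\<Sum>d\<in>X. single d (lookup u d))" if "X \<subseteq> keys u" for X
  proof -
    have "finite X"
      using that by (rule finite_subset) simp
    then show ?thesis
      using that
    proof (induction X)
      case empty
      then show ?case by (simp add: assms(2))
    next
      case (insert d X)
      then have "P (scal (lookup u d) * dgm d)"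
        using assms(1) by (intro assms(4)) (auto simp: hom_def)
      then show ?case
        using insert by (auto simp: scal_dgm intro: assms(3))
    qed
  qed
  from this[OF order_refl] show ?thesis
    by (simp flip: sum_single_keys)
qed

lemma hom_mult: "u \<in> hom D W T \<Longrightarrow> v \<in> hom D S W \<Longrightarrow> u * v \<in> hom D S T"
proof (induction rule: hom_induct)
  case (base a d)
  show ?case
    using base(3)
  proof (induction rule: hom_induct)
    case (base b e)
    have "scal a * dgm d * (scal b * dgm e) = scal (a * b) * dgm (d + e)"
      by (simp add: scal_dgm mult_single)
    then show ?case
      using base \<open>a \<in> Alam D\<close> \<open>diag W d T\<close> by (auto intro!: hom_scal_dgm intro: diag_add)
  qed (auto simp: algebra_simps)
qed (auto simp: algebra_simps)

lemma hom_scal [simp]: "a \<in> Alam D \<Longrightarrow> scal a \<in> hom D S S"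
  using hom_scal_dgm[of a D S 0 S] by (simp add: dgm_def)

lemma hom_kscal [simp]: "kscal a \<in> hom D S S"
  by (simp add: kscal_def)

lemma hom_one [simp]: "1 \<in> hom D S S"
  using hom_scal[of 1 D S] by simp

lemma hom_kscal_mult: "u \<in> hom D S T \<Longrightarrow> kscal a * u \<in> hom D S T"
  by (rule hom_mult[of _ _ T]) auto

lemma hom_uminus [simp]: "u \<in> hom D S T \<Longrightarrow> - u \<in> hom D S T"
  using hom_kscal_mult[of u D S T "-1"] by (simp add: kscal_uminus)

lemma hom_diff [simp]: "u \<in> hom D S T \<Longrightarrow> v \<in> hom D S T \<Longrightarrow> u - v \<in> hom D S T"
  using hom_add[of u D S T "- v"] by simp

lemma hom_sum: "(\<And>x. x \<in> X \<Longrightarrow> f x \<in> hom D S T) \<Longrightarrow> sum f X \<in> hom D S T"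
  by (induction X rule: infinite_finite_induct) auto

lemma hom_power: "u \<in> hom D S S \<Longrightarrow> u ^ n \<in> hom D S S"
  by (induction n) (auto intro: hom_mult)

lemma hom_dgm: "diag S d T \<Longrightarrow> dgm d \<in> hom D S T"
  using hom_scal_dgm[of 1 D S d T] by simp

lemma hom_dl: "slices_from_to S xs T \<Longrightarrow> dl xs \<in> hom D S T"
  by (simp add: dl_def hom_dgm diag_def)

lemma hom_whisker: "u \<in> hom D S T \<Longrightarrow> whisker L u R \<in> hom D (L @ S @ R) (L @ T @ R)"
proof (induction rule: hom_induct)
  case (base a d)
  then show ?case
    by (auto simp: whisker_mult whisker_dgm intro!: hom_scal_dgm diag_whisker)
qed (auto simp: whisker_add)

lemma hom_whisker': "u \<in> hom D S T \<Longrightarrow> S' = L @ S @ R \<Longrightarrow> T' = L @ T @ R \<Longrightarrow> whisker L u R \<in> hom D S' T'"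
  using hom_whisker by blast


section \<open>Submodules spanned by relations\<close>

lemma scal_left_commute: "u * (scal a * v) = scal a * (u * (v :: ('i, 'k::comm_ring_1) lin))"
  by (simp add: scal_commute[of u] flip: mult.assoc)

lemma scal_mult_scal:
  "scal a * u * (scal b * v) = scal (a * b) * (u * (v :: ('i, 'k::comm_ring_1) lin))"
  by (simp add: scal_mult mult.assoc scal_left_commute[of u])

lemma rel_span_scal:
  assumes a: "a \<in> Alam D" and "x \<in> rel_span D P S T"
  shows "scal a * x \<in> rel_span D P S T"
  using assms(2)
proof induction
  case (rel b R' S' T' u v d L' d')
  then have "scal (a * b) * dgm d' * whisker L' (u - v) R' * dgm d \<in> rel_span D P S T"
    using a by (intro rel_span.rel) auto
  then show ?case by (simp add: scal_mult mult.assoc)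
qed (auto simp: distrib_left intro: rel_span.intros)

lemma rel_span_uminus: "x \<in> rel_span D P S T \<Longrightarrow> - x \<in> rel_span D P S T"
  using rel_span_scal[of "-1" D x P S T] by (simp add: scal_uminus)

lemma rel_span_mult_left:
  assumes "u \<in> hom D T W" "x \<in> rel_span D P S T"
  shows "u * x \<in> rel_span D P S W"
  using assms(1)
proof (induction rule: hom_induct)
  case (base a d'')
  have "dgm d'' * x \<in> rel_span D P S W"
    using assms(2)
  proof induction
    case (rel b R' S' T' u v d L' d')
    then have "scal b * dgm (d'' + d') * whisker L' (u - v) R' * dgm d \<in> rel_span D P S W"
      using base by (intro rel_span.rel) (auto intro: diag_add)
    moreover have "scal b * dgm (d'' + d') = dgm d'' * (scal b * dgm d')"
      by (simp add: scal_left_commute dgm_mult)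
    ultimately show ?case by (simp add: mult.assoc)
  qed (auto simp: distrib_left intro: rel_span.intros)
  then show ?case
    using base by (simp add: mult.assoc rel_span_scal)
qed (auto simp: distrib_right intro: rel_span.intros)

lemma rel_span_mult_right:
  assumes "u \<in> hom D W S" "x \<in> rel_span D P S T"
  shows "x * u \<in> rel_span D P W T"
  using assms(1)
proof (induction rule: hom_induct)
  case (base a d'')
  have "x * dgm d'' \<in> rel_span D P W T"
    using assms(2)
  proof induction
    case (rel b R' S' T' u v d L' d')
    then have "scal b * dgm d' * whisker L' (u - v) R' * dgm (d + d'') \<in> rel_span D P W T"
      using base by (intro rel_span.rel) (auto intro: diag_add)
    then show ?case by (simp add: mult.assoc dgm_mult)
  qed (auto simp: distrib_right intro: rel_span.intros)
  then have "scal a * (x * dgm d'') \<in> rel_span D P W T"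
    using base by (simp add: rel_span_scal)
  then show ?case
    by (simp add: scal_left_commute)
qed (auto simp: distrib_left intro: rel_span.intros)

lemma rel_span_mono:
  assumes "\<And>R' S' T' u v. P R' S' T' u v \<Longrightarrow> Q R' S' T' u v"
  shows "x \<in> rel_span D P S T \<Longrightarrow> x \<in> rel_span D Q S T"
  by (induction rule: rel_span.induct) (auto intro: rel_span.intros assms)

lemma rel_span_whisker:
  assumes "\<And>R' S' T' u v. P R' S' T' u v \<Longrightarrow> Q (R' @ R) S' T' u v"
  shows "x \<in> rel_span D P S T \<Longrightarrow> whisker L x R \<in> rel_span D Q (L @ S @ R) (L @ T @ R)"
proof (induction rule: rel_span.induct)
  case (rel a R' S' T' u v d L' d')
  have "scal a * dgm (whisker_diag L R d') * whisker (L @ L') (u - v) (R' @ R) * dgm (whisker_diag L R d)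
        \<in> rel_span D Q (L @ S @ R) (L @ T @ R)"
    using rel assms diag_whisker[OF rel(3), of L R] diag_whisker[OF rel(4), of L R]
    by (intro rel_span.rel) auto
  then show ?case
    by (simp add: whisker_mult whisker_dgm whisker_whisker)
qed (auto simp: whisker_add intro: rel_span.intros)

lemma rel_span_base:
  assumes "P R S T u v"
  shows "whisker L u R - whisker L v R \<in> rel_span D P (L @ S @ R) (L @ T @ R)"
proof -
  have "scal 1 * dgm 0 * whisker L (u - v) R * dgm 0 \<in> rel_span D P (L @ S @ R) (L @ T @ R)"
    using assms by (intro rel_span.rel) auto
  then show ?thesis
    by (simp add: dgm_def whisker_diff)
qed


section \<open>Congruence modulo the local relations\<close>

text \<open>The weight of the rightmost region is a parameter, and a black string at the far right is not
  killed.  Because of this the congruence below is stable under adding strings on both sides: strings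
  on the right only change the parameter.  All calculations next to a single red string take place in
  it, and are then placed into larger diagrams.\<close>

definition local_rel ::
  "('i, 'r, 'k::field) stendhal_data \<Rightarrow> 'r weight \<Rightarrow> 'i word \<Rightarrow> 'i word \<Rightarrow> 'i word \<Rightarrow>
    ('i, 'k) lin \<Rightarrow> ('i, 'k) lin \<Rightarrow> bool" where
  "local_rel D \<nu> R S T u v \<longleftrightarrow> black_rel D (wtw D R + \<nu>) S T u v \<or> red_rel D S T u v"

definition cg ::
  "('i, 'r, 'k::field) stendhal_data \<Rightarrow> 'r weight \<Rightarrow> 'i word \<Rightarrow> 'i word \<Rightarrow> ('i, 'k) lin \<Rightarrow> ('i, 'k) lin \<Rightarrow> bool" where
  "cg D \<nu> S T u v \<longleftrightarrow> u - v \<in> rel_span D (local_rel D \<nu>) S T"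

lemma wtw_append: "wtw D (u @ v) = wtw D u + wtw D v"
  and wtw_Nil [simp]: "wtw D [] = 0"
  and wtw_Cons: "wtw D (x # v) = wt D x + wtw D v"
  by (simp_all add: wtw_def)

lemma cg_refl [simp, intro]: "cg D \<nu> S T u u"
  by (simp add: cg_def rel_span.zero)

lemma cg_sym: "cg D \<nu> S T u v \<Longrightarrow> cg D \<nu> S T v u"
  unfolding cg_def by (drule rel_span_uminus) simp

lemma cg_trans [trans]: "cg D \<nu> S T u v \<Longrightarrow> cg D \<nu> S T v w \<Longrightarrow> cg D \<nu> S T u w"
  unfolding cg_def by (drule (1) rel_span.add) simp

lemma cg_eq_trans [trans]: "cg D \<nu> S T u v \<Longrightarrow> v = w \<Longrightarrow> cg D \<nu> S T u w"
  and eq_cg_trans [trans]: "u = v \<Longrightarrow> cg D \<nu> S T v w \<Longrightarrow> cg D \<nu> S T u w"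
  by simp_all

lemma cg_add: "cg D \<nu> S T u v \<Longrightarrow> cg D \<nu> S T u' v' \<Longrightarrow> cg D \<nu> S T (u + u') (v + v')"
  unfolding cg_def by (drule (1) rel_span.add) (simp add: algebra_simps)

lemma cg_uminus: "cg D \<nu> S T u v \<Longrightarrow> cg D \<nu> S T (- u) (- v)"
  unfolding cg_def by (drule rel_span_uminus) (simp add: algebra_simps)

lemma cg_diff: "cg D \<nu> S T u v \<Longrightarrow> cg D \<nu> S T u' v' \<Longrightarrow> cg D \<nu> S T (u - u') (v - v')"
  using cg_add[OF _ cg_uminus, of D \<nu> S T u v u' v'] by simp

lemma cg_sum: "(\<And>x. x \<in> X \<Longrightarrow> cg D \<nu> S T (f x) (g x)) \<Longrightarrow> cg D \<nu> S T (sum f X) (sum g X)"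
  by (induction X rule: infinite_finite_induct) (auto intro: cg_add)

lemma cg_left: "w \<in> hom D T W \<Longrightarrow> cg D \<nu> S T u v \<Longrightarrow> cg D \<nu> S W (w * u) (w * v)"
  unfolding cg_def right_diff_distrib[symmetric] by (rule rel_span_mult_left)

lemma cg_right: "w \<in> hom D W S \<Longrightarrow> cg D \<nu> S T u v \<Longrightarrow> cg D \<nu> W T (u * w) (v * w)"
  unfolding cg_def left_diff_distrib[symmetric] by (rule rel_span_mult_right)

lemma cg_mult:
  assumes "cg D \<nu> W T u u'" "cg D \<nu> S W v v'" "u' \<in> hom D W T" "v \<in> hom D S W"
  shows "cg D \<nu> S T (u * v) (u' * v')"
  by (rule cg_trans[OF cg_right[OF assms(4,1)] cg_left[OF assms(3,2)]])

lemma cg_scal: "a \<in> Alam D \<Longrightarrow> cg D \<nu> S T u v \<Longrightarrow> cg D \<nu> S T (scal a * u) (scal a * v)"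
  by (rule cg_left[of _ _ T]) auto

lemma cg_kscal: "cg D \<nu> S T u v \<Longrightarrow> cg D \<nu> S T (kscal a * u) (kscal a * v)"
  by (rule cg_left[of _ _ T]) auto

lemma cg_whisker:
  assumes "cg D (wtw D R + \<nu>) S T u v"
  shows "cg D \<nu> (L @ S @ R) (L @ T @ R) (whisker L u R) (whisker L v R)"
  using assms unfolding cg_def whisker_diff[symmetric]
  by (rule rel_span_whisker[rotated]) (auto simp: local_rel_def wtw_append add.assoc)

lemma cg_whisker':
  assumes "cg D \<nu>' S T u v" "\<nu>' = wtw D R + \<nu>" "S' = L @ S @ R" "T' = L @ T @ R"
  shows "cg D \<nu> S' T' (whisker L u R) (whisker L v R)"
  using cg_whisker assms by blast

lemma cg_black:
  "black_rel D (wtw D R + \<nu>) S T u v \<Longrightarrow> cg D \<nu> (L @ S @ R) (L @ T @ R) (whisker L u R) (whisker L v R)"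
  unfolding cg_def by (rule rel_span_base) (simp add: local_rel_def)

lemma cg_red:
  "red_rel D S T u v \<Longrightarrow> cg D \<nu> (L @ S @ R) (L @ T @ R) (whisker L u R) (whisker L v R)"
  unfolding cg_def by (rule rel_span_base) (simp add: local_rel_def)

lemma cg_power_slide:
  assumes "cg D \<nu> S T (c * x) (y * c)" "c \<in> hom D S T" "x \<in> hom D S S" "y \<in> hom D T T"
  shows "cg D \<nu> S T (c * x ^ n) (y ^ n * c)"
proof (induction n)
  case (Suc n)
  have "cg D \<nu> S T (c * x * x ^ n) (y * c * x ^ n)"
    using assms by (auto intro: cg_right hom_power)
  also have "y * c * x ^ n = y * (c * x ^ n)"
    by (simp add: mult.assoc)
  also have "cg D \<nu> S T \<dots> (y * (y ^ n * c))"
    using assms Suc.IH by (intro cg_left)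
  finally show ?case
    by (simp add: mult.assoc)
qed auto


subsection \<open>Isotopies as rewriting of lists of slices\<close>

lemma cg_context:
  assumes "cg D \<nu> S' T' (dl xs) (dl ys)" "slices_from_to S Q S'" "slices_from_to T' P T"
  shows "cg D \<nu> S T (dl (P @ xs @ Q)) (dl (P @ ys @ Q))"
  unfolding dl_mult[symmetric]
  by (intro cg_left[of _ _ T'] cg_right[of _ _ _ S'] hom_dl assms)

lemma cg_context_lin:
  assumes "cg D \<nu> S' T' u v" "slices_from_to S Q S'" "slices_from_to T' P T"
  shows "cg D \<nu> S T (dl P * u * dl Q) (dl P * v * dl Q)"
  by (intro cg_left[of _ _ T'] cg_right[of _ _ _ S'] hom_dl assms)

text \<open>A relation between two lists of slices is applied inside a list: \<open>P\<close> is what lies above,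
  \<open>Q\<close> what lies below, \<open>L\<close> and \<open>R\<close> are the strands on the left and on the right.  The rules
  whose names start with \<open>iso\<close> are instances of this.\<close>

lemma black_context:
  assumes "black_rel D (wtw D R + \<nu>) S' T' (dl xs) (dl ys)"
    and "slices_from_to S Q (L @ S' @ R)" "slices_from_to (L @ T' @ R) P T"
  shows "cg D \<nu> S T (dl (P @ map (whisker_slice L R) xs @ Q)) (dl (P @ map (whisker_slice L R) ys @ Q))"
  using cg_context[OF cg_black[OF assms(1), of L, unfolded whisker_dl] assms(2,3)] .

lemma red_context:
  assumes "red_rel D S' T' (dl xs) (dl ys)"
    and "slices_from_to S Q (L @ S' @ R)" "slices_from_to (L @ T' @ R) P T"
  shows "cg D \<nu> S T (dl (P @ map (whisker_slice L R) xs @ Q)) (dl (P @ map (whisker_slice L R) ys @ Q))"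
  using cg_context[OF cg_red[OF assms(1), of _ L, unfolded whisker_dl] assms(2,3)] .

lemma iso_zigzag_left:
  assumes "is_black x" "slices_from_to S Q (L @ x # R)" "slices_from_to (L @ x # R) P T"
  shows "cg D \<nu> S T (dl (P @ [(L, Cap x, x # R), (L @ [x], Cup (dual x), R)] @ Q)) (dl (P @ Q))"
  using black_context[OF black_rel.zigzag_left[OF assms(1), unfolded sl_dl dl_mult dl_Nil[symmetric]],
      where L=L and R=R and S=S and Q=Q and P=P and T=T and \<nu>=\<nu> and D=D] assms
  by simp

lemma iso_zigzag_right:
  assumes "is_black x" "slices_from_to S Q (L @ x # R)" "slices_from_to (L @ x # R) P T"
  shows "cg D \<nu> S T (dl (P @ [(L @ [x], Cap (dual x), R), (L, Cup x, x # R)] @ Q)) (dl (P @ Q))"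
  using black_context[OF black_rel.zigzag_right[OF assms(1), unfolded sl_dl dl_mult dl_Nil[symmetric]],
      where L=L and R=R and S=S and Q=Q and P=P and T=T and \<nu>=\<nu> and D=D] assms
  by simp

lemma iso_dot_cup:
  assumes "is_black x" "slices_from_to S Q (L @ R)" "slices_from_to (L @ x # dual x # R) P T"
  shows "cg D \<nu> S T (dl (P @ [(L, Dot x, dual x # R), (L, Cup x, R)] @ Q))
                     (dl (P @ [(L @ [x], Dot (dual x), R), (L, Cup x, R)] @ Q))"
  using black_context[OF black_rel.dot_cup[OF assms(1), unfolded sl_dl dl_mult dl_Nil[symmetric]],
      where L=L and R=R and S=S and Q=Q and P=P and T=T and \<nu>=\<nu> and D=D] assms
  by simp

lemma iso_pitchfork_cap:
  assumes "is_black x" "is_black y" "slices_from_to S Q (L @ x # y # dual x # R)" "slices_from_to (L @ y # R) P T"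
  shows "cg D \<nu> S T (dl (P @ [(L @ [y], Cap x, R), (L, Cross x y, dual x # R)] @ Q))
                     (dl (P @ [(L, Cap x, y # R), (L @ [x], Cross y (dual x), R)] @ Q))"
  using black_context[OF black_rel.pitchfork_cap[OF assms(1,2), unfolded sl_dl dl_mult dl_Nil[symmetric]],
      where L=L and R=R and S=S and Q=Q and P=P and T=T and \<nu>=\<nu> and D=D] assms
  by simp

lemma iso_pitchfork_cup:
  assumes "is_black x" "is_black y" "slices_from_to S Q (L @ y # R)" "slices_from_to (L @ x # y # dual x # R) P T"
  shows "cg D \<nu> S T (dl (P @ [(L, Cross y x, dual x # R), (L @ [y], Cup x, R)] @ Q))
                     (dl (P @ [(L @ [x], Cross (dual x) y, R), (L, Cup x, y # R)] @ Q))"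
  using black_context[OF black_rel.pitchfork_cup[OF assms(1,2), unfolded sl_dl dl_mult dl_Nil[symmetric]],
      where L=L and R=R and S=S and Q=Q and P=P and T=T and \<nu>=\<nu> and D=D] assms
  by simp

lemma iso_red_cap:
  assumes "is_black x" "slices_from_to S Q (L @ x # Red k # dual x # R)" "slices_from_to (L @ Red k # R) P T"
  shows "cg D \<nu> S T (dl (P @ [(L @ [Red k], Cap x, R), (L, Cross x (Red k), dual x # R)] @ Q))
                     (dl (P @ [(L, Cap x, Red k # R), (L @ [x], Cross (Red k) (dual x), R)] @ Q))"
  using red_context[OF red_rel.red_cap[OF assms(1), where k=k, unfolded sl_dl dl_mult dl_Nil[symmetric]],
      where L=L and R=R and S=S and Q=Q and P=P and T=T and \<nu>=\<nu> and D=D] assms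
  by simp

lemma iso_red_cup:
  assumes "is_black x" "slices_from_to S Q (L @ Red k # R)" "slices_from_to (L @ x # Red k # dual x # R) P T"
  shows "cg D \<nu> S T (dl (P @ [(L, Cross (Red k) x, dual x # R), (L @ [Red k], Cup x, R)] @ Q))
                     (dl (P @ [(L @ [x], Cross (dual x) (Red k), R), (L, Cup x, Red k # R)] @ Q))"
  using red_context[OF red_rel.red_cup[OF assms(1), where k=k, unfolded sl_dl dl_mult dl_Nil[symmetric]],
      where L=L and R=R and S=S and Q=Q and P=P and T=T and \<nu>=\<nu> and D=D] assms
  by simp

lemma iso_up_red:
  assumes "slices_from_to S Q (L @ Up i # Red k # R)" "slices_from_to (L @ Up i # Red k # R) P T"
  shows "cg D \<nu> S T (dl (P @ [(L, Cross (Red k) (Up i), R), (L, Cross (Up i) (Red k), R)] @ Q)) (dl (P @ Q))"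
  using red_context[OF red_rel.up_red[where i=i and k=k, unfolded sl_dl dl_mult dl_Nil[symmetric]],
      where L=L and R=R and S=S and Q=Q and P=P and T=T and \<nu>=\<nu> and D=D] assms
  by simp

lemma iso_red_up:
  assumes "slices_from_to S Q (L @ Red k # Up i # R)" "slices_from_to (L @ Red k # Up i # R) P T"
  shows "cg D \<nu> S T (dl (P @ [(L, Cross (Up i) (Red k), R), (L, Cross (Red k) (Up i), R)] @ Q)) (dl (P @ Q))"
  using red_context[OF red_rel.red_up[where i=i and k=k, unfolded sl_dl dl_mult dl_Nil[symmetric]],
      where L=L and R=R and S=S and Q=Q and P=P and T=T and \<nu>=\<nu> and D=D] assms
  by simp

lemma iso_dots_red_right:
  assumes "is_black x" "slices_from_to S Q (L @ x # Red k # R)" "slices_from_to (L @ Red k # x # R) P T"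
  shows "cg D \<nu> S T (dl (P @ (L, Cross x (Red k), R) # replicate n (L, Dot x, Red k # R) @ Q))
                     (dl (P @ replicate n (L @ [Red k], Dot x, R) @ (L, Cross x (Red k), R) # Q))"
proof -
  have "cg D \<nu> (L @ x # Red k # R) (L @ Red k # x # R)
     (dl [(L, Cross x (Red k), R)] * dl [(L, Dot x, Red k # R)])
     (dl [(L @ [Red k], Dot x, R)] * dl [(L, Cross x (Red k), R)])"
    using cg_red[OF red_rel.dot_right[OF assms(1), of D k], of \<nu> L R]
    by (simp add: sl_dl dl_mult whisker_dl)
  then have "cg D \<nu> (L @ x # Red k # R) (L @ Red k # x # R)
     (dl ((L, Cross x (Red k), R) # replicate n (L, Dot x, Red k # R)))
     (dl (replicate n (L @ [Red k], Dot x, R) @ [(L, Cross x (Red k), R)]))"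
    using cg_power_slide[of D \<nu> "L @ x # Red k # R" "L @ Red k # x # R" "dl [(L, Cross x (Red k), R)]"
        "dl [(L, Dot x, Red k # R)]" "dl [(L @ [Red k], Dot x, R)]" n] assms(1)
    by (simp add: hom_dl dl_power_single dl_mult)
  from cg_context[OF this assms(2,3)] show ?thesis by simp
qed

lemma iso_dots_red_left:
  assumes "is_black x" "slices_from_to S Q (L @ Red k # x # R)" "slices_from_to (L @ x # Red k # R) P T"
  shows "cg D \<nu> S T (dl (P @ (L, Cross (Red k) x, R) # replicate n (L @ [Red k], Dot x, R) @ Q))
                     (dl (P @ replicate n (L, Dot x, Red k # R) @ (L, Cross (Red k) x, R) # Q))"
proof -
  have "cg D \<nu> (L @ Red k # x # R) (L @ x # Red k # R)
     (dl [(L, Cross (Red k) x, R)] * dl [(L @ [Red k], Dot x, R)])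
     (dl [(L, Dot x, Red k # R)] * dl [(L, Cross (Red k) x, R)])"
    using cg_red[OF red_rel.dot_left[OF assms(1), of D k], of \<nu> L R]
    by (simp add: sl_dl dl_mult whisker_dl)
  then have "cg D \<nu> (L @ Red k # x # R) (L @ x # Red k # R)
     (dl ((L, Cross (Red k) x, R) # replicate n (L @ [Red k], Dot x, R)))
     (dl (replicate n (L, Dot x, Red k # R) @ [(L, Cross (Red k) x, R)]))"
    using cg_power_slide[of D \<nu> "L @ Red k # x # R" "L @ x # Red k # R" "dl [(L, Cross (Red k) x, R)]"
        "dl [(L @ [Red k], Dot x, R)]" "dl [(L, Dot x, Red k # R)]" n] assms(1)
    by (simp add: hom_dl dl_power_single dl_mult)
  from cg_context[OF this assms(2,3)] show ?thesis by simp
qed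

text \<open>The interchange relation moves single slices past each other; by iteration whole diagrams that
  lie side by side can be moved past each other.\<close>

lemma iso_commute:
  assumes "slices_from_to S1 xs T1" "slices_from_to S2 ys T2"
    and "slices_from_to S Q (L @ S1 @ M @ S2 @ R)" "slices_from_to (L @ T1 @ M @ T2 @ R) P T"
  shows "cg D \<nu> S T
     (dl (P @ map (whisker_slice L (M @ T2 @ R)) xs @ map (whisker_slice (L @ S1 @ M) R) ys @ Q))
     (dl (P @ map (whisker_slice (L @ T1 @ M) R) ys @ map (whisker_slice L (M @ S2 @ R)) xs @ Q))"
proof -
  have one: "cg D \<nu> (L @ (L1 @ gbot g @ R1) @ M @ S2 @ R) (L @ (L1 @ gtop g @ R1) @ M @ T2 @ R)
       (dl ((L @ L1, g, R1 @ M @ T2 @ R) # map (whisker_slice (L @ (L1 @ gbot g @ R1) @ M) R) ys))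
       (dl (map (whisker_slice (L @ (L1 @ gtop g @ R1) @ M) R) ys @ [(L @ L1, g, R1 @ M @ S2 @ R)]))"
    if g: "valid_gen g" and "slices_from_to S2 ys T2" for L1 g R1 ys T2
    using that(2)
  proof (induction ys arbitrary: T2)
    case (Cons s ys)
    obtain L2 h R2 where s: "s = (L2, h, R2)" by (cases s)
    let ?m = "\<lambda>w. map (whisker_slice (L @ (L1 @ w @ R1) @ M) R) ys"
    have h: "valid_gen h" and ys: "slices_from_to S2 ys (L2 @ gbot h @ R2)" and T2: "T2 = L2 @ gtop h @ R2"
      using Cons.prems by (auto simp: s)
    have ysb: "slices_from_to (L @ (L1 @ gbot g @ R1) @ M @ S2 @ R) (?m (gbot g))
               (L @ (L1 @ gbot g @ R1) @ M @ (L2 @ gbot h @ R2) @ R)"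
      using slices_from_to_whisker[OF ys, of "L @ (L1 @ gbot g @ R1) @ M" R] by simp
    have "cg D \<nu> (L @ (L1 @ gbot g @ R1) @ M @ S2 @ R) (L @ (L1 @ gtop g @ R1) @ M @ T2 @ R)
       (dl ((L @ L1, g, R1 @ M @ T2 @ R) # (L @ (L1 @ gbot g @ R1) @ M @ L2, h, R2 @ R) # ?m (gbot g)))
       (dl ((L @ (L1 @ gtop g @ R1) @ M @ L2, h, R2 @ R) # (L @ L1, g, R1 @ M @ (L2 @ gbot h @ R2) @ R) # ?m (gbot g)))"
      using black_context[OF black_rel.interchange[OF g h, where M="R1 @ M @ L2", unfolded sl_dl dl_mult],
          where L="L @ L1" and R="R2 @ R" and Q="?m (gbot g)" and P="[]" and D=D and \<nu>=\<nu> and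
            S="L @ (L1 @ gbot g @ R1) @ M @ S2 @ R" and T="L @ (L1 @ gtop g @ R1) @ M @ T2 @ R"] ysb
      by (simp add: T2)
    also have "cg D \<nu> (L @ (L1 @ gbot g @ R1) @ M @ S2 @ R) (L @ (L1 @ gtop g @ R1) @ M @ T2 @ R)
       (dl ((L @ (L1 @ gtop g @ R1) @ M @ L2, h, R2 @ R) # (L @ L1, g, R1 @ M @ (L2 @ gbot h @ R2) @ R) # ?m (gbot g)))
       (dl ((L @ (L1 @ gtop g @ R1) @ M @ L2, h, R2 @ R) # ?m (gtop g) @ [(L @ L1, g, R1 @ M @ S2 @ R)]))"
      using cg_context[OF Cons.IH[OF ys], of "L @ (L1 @ gbot g @ R1) @ M @ S2 @ R" "[]"
          "[(L @ (L1 @ gtop g @ R1) @ M @ L2, h, R2 @ R)]" "L @ (L1 @ gtop g @ R1) @ M @ T2 @ R"] h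
      by (simp add: T2)
    finally show ?case by (simp add: s)
  qed simp
  have "cg D \<nu> (L @ S1 @ M @ S2 @ R) (L @ T1 @ M @ T2 @ R)
     (dl (map (whisker_slice L (M @ T2 @ R)) xs @ map (whisker_slice (L @ S1 @ M) R) ys))
     (dl (map (whisker_slice (L @ T1 @ M) R) ys @ map (whisker_slice L (M @ S2 @ R)) xs))"
    using assms(1)
  proof (induction xs arbitrary: T1)
    case (Cons s xs)
    obtain L1 g R1 where s: "s = (L1, g, R1)" by (cases s)
    have g: "valid_gen g" and xs: "slices_from_to S1 xs (L1 @ gbot g @ R1)" and T1: "T1 = L1 @ gtop g @ R1"
      using Cons.prems by (auto simp: s)
    let ?xs = "\<lambda>W. map (whisker_slice L (M @ W @ R)) xs"
    let ?ys = "\<lambda>W. map (whisker_slice (L @ W @ M) R) ys"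
    have xs': "slices_from_to (L @ S1 @ M @ S2 @ R) (?xs S2) (L @ (L1 @ gbot g @ R1) @ M @ S2 @ R)"
      using slices_from_to_whisker[OF xs, of L "M @ S2 @ R"] by simp
    have "cg D \<nu> (L @ S1 @ M @ S2 @ R) (L @ T1 @ M @ T2 @ R)
       (dl ((L @ L1, g, R1 @ M @ T2 @ R) # ?xs T2 @ ?ys S1))
       (dl ((L @ L1, g, R1 @ M @ T2 @ R) # ?ys (L1 @ gbot g @ R1) @ ?xs S2))"
      using cg_context[OF Cons.IH[OF xs], of "L @ S1 @ M @ S2 @ R" "[]"
          "[(L @ L1, g, R1 @ M @ T2 @ R)]" "L @ T1 @ M @ T2 @ R"] g
      by (simp add: T1)
    also have "cg D \<nu> (L @ S1 @ M @ S2 @ R) (L @ T1 @ M @ T2 @ R)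
       (dl ((L @ L1, g, R1 @ M @ T2 @ R) # ?ys (L1 @ gbot g @ R1) @ ?xs S2))
       (dl (?ys T1 @ (L @ L1, g, R1 @ M @ S2 @ R) # ?xs S2))"
      using cg_context[OF one[OF g assms(2), of L1 R1] xs', of "[]" "L @ T1 @ M @ T2 @ R"]
      by (simp add: T1)
    finally show ?case by (simp add: s T1)
  qed simp
  from cg_context[OF this assms(3,4)] show ?thesis by simp
qed

lemma cg_commute:
  assumes "u \<in> hom D S1 T1" "v \<in> hom D S2 T2"
  shows "cg D \<nu> (S1 @ M @ S2) (T1 @ M @ T2)
     (whisker [] u (M @ T2) * whisker (S1 @ M) v []) (whisker (T1 @ M) v [] * whisker [] u (M @ S2))"
  using assms(1)
proof (induction rule: hom_induct)
  case (base a d)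
  note ad = base
  show ?case
    using assms(2)
  proof (induction rule: hom_induct)
    case (base b e)
    have "cg D \<nu> (S1 @ M @ S2) (T1 @ M @ T2)
       (whisker [] (dgm d) (M @ T2) * whisker (S1 @ M) (dgm e) [])
       (whisker (T1 @ M) (dgm e) [] * whisker [] (dgm d) (M @ S2))"
      using iso_commute[of S1 "slices d" T1 S2 "slices e" T2 "S1 @ M @ S2" "[]" "[]" M "[]" "[]" "T1 @ M @ T2" D \<nu>]
        ad base by (simp add: diag_def dl_mult[symmetric] whisker_dl[symmetric]) (simp add: dl_def)
    then have "cg D \<nu> (S1 @ M @ S2) (T1 @ M @ T2)
       (scal (a * b) * (whisker [] (dgm d) (M @ T2) * whisker (S1 @ M) (dgm e) []))
       (scal (a * b) * (whisker (T1 @ M) (dgm e) [] * whisker [] (dgm d) (M @ S2)))"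
      using ad base by (intro cg_scal) auto
    then show ?case
      by (simp add: whisker_mult scal_mult_scal mult.commute[of b a])
  qed (auto simp: whisker_add distrib_left distrib_right intro: cg_add)
qed (auto simp: whisker_add distrib_left distrib_right intro: cg_add)

lemma cg_commute_closed:
  assumes "u \<in> hom D [] []" "v \<in> hom D [] []"
  shows "cg D \<nu> [] [] (u * v) (v * u)"
  using cg_commute[OF assms, of \<nu> "[]"] by simp


lemma slices_from_to_dots [simp]:
  assumes "is_black x"
  shows "slices_from_to S (replicate n (L, Dot x, R)) (L @ x # R) \<longleftrightarrow> S = L @ x # R"
    and "T = L @ x # R \<Longrightarrow> slices_from_to S (replicate n (L, Dot x, R)) T \<longleftrightarrow> S = T"
    and "T = L @ x # R \<Longrightarrow> slices_from_to S (replicate n (L, Dot x, R) @ ys) T \<longleftrightarrow> slices_from_to S ys T"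
  using assms by (induction n) auto

lemma cg_step: "cg D \<nu> S T u v \<Longrightarrow> u = u' \<Longrightarrow> v = v' \<Longrightarrow> cg D \<nu> S T u' v'"
  and cg_step_sym: "cg D \<nu> S T u v \<Longrightarrow> u = u' \<Longrightarrow> v = v' \<Longrightarrow> cg D \<nu> S T v' u'"
  by (auto intro: cg_sym)

lemma dl_sandwich:
  "dl P * (\<Sum>x\<in>X. scal (a x) * dl (f x)) * dl Q = (\<Sum>x\<in>X. scal (a x) * dl (P @ f x @ Q))"
  by (simp add: sum_distrib_left sum_distrib_right scal_left_commute mult.assoc dl_mult)

text \<open>Dots move one at a time from the left to the right leg of a cup, those already moved being out
  of the way of the next one.\<close>

lemma iso_dots_cup:
  assumes "is_black x" "slices_from_to S Q (L @ R)" "slices_from_to (L @ x # dual x # R) P T"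
  shows "cg D \<nu> S T (dl (P @ replicate n (L, Dot x, dual x # R) @ (L, Cup x, R) # Q))
                     (dl (P @ replicate n (L @ [x], Dot (dual x), R) @ (L, Cup x, R) # Q))"
proof -
  have dx: "is_black (dual x)"
    using assms(1) by (cases x) auto
  have "cg D \<nu> (L @ R) (L @ x # dual x # R) (dl (replicate n (L, Dot x, dual x # R) @ [(L, Cup x, R)]))
     (dl (replicate n (L @ [x], Dot (dual x), R) @ [(L, Cup x, R)]))" (is "cg _ _ ?S ?T _ _")
  proof (induction n)
    case (Suc n)
    have "cg D \<nu> ?S ?T (dl (replicate (Suc n) (L, Dot x, dual x # R) @ [(L, Cup x, R)]))
        (dl ((L, Dot x, dual x # R) # replicate n (L @ [x], Dot (dual x), R) @ [(L, Cup x, R)]))"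
      by (rule cg_step[OF cg_context[OF Suc, where P="[(L, Dot x, dual x # R)]" and Q="[]"]])
        (use assms(1) in simp_all)
    also have "cg D \<nu> ?S ?T \<dots>
        (dl (replicate n (L @ [x], Dot (dual x), R) @ (L, Dot x, dual x # R) # [(L, Cup x, R)]))"
      by (rule cg_step[OF iso_commute[where L=L and M="[]" and R=R and xs="[([], Dot x, [])]" and
              ys="replicate n ([], Dot (dual x), [])" and ?S1.0="[x]" and ?T1.0="[x]" and ?S2.0="[dual x]" and ?T2.0="[dual x]"
              and P="[]" and Q="[(L, Cup x, R)]"]])
        (use assms(1) dx in simp_all)
    also have "cg D \<nu> ?S ?T \<dots>
        (dl (replicate n (L @ [x], Dot (dual x), R) @ (L @ [x], Dot (dual x), R) # [(L, Cup x, R)]))"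
      by (rule cg_step[OF iso_dot_cup[where L=L and R=R and x=x and P="replicate n (L @ [x], Dot (dual x), R)" and Q="[]"]])
        (use assms(1) dx in simp_all)
    finally show ?case
      by (simp flip: replicate_append_same)
  qed simp
  from cg_context[OF this, of S Q P T] show ?thesis
    using assms by simp
qed


section \<open>Bubbles next to a red string\<close>

definition bubble_dl :: "'i strand \<Rightarrow> nat \<Rightarrow> 'i slice list" where
  "bubble_dl x m = ([], Cap x, []) # replicate m ([], Dot x, [dual x]) @ [([], Cup x, [])]"

lemma bubble_nat: "bubble x (int m) = dl (bubble_dl x m)"
  by (simp add: bubble_def bubble_dl_def sl_dl dl_power_single dl_mult)

lemma whisker_bubble:
  "whisker L (bubble x (int m)) R = dl ((L, Cap x, R) # replicate m (L, Dot x, dual x # R) @ [(L, Cup x, R)])"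
  by (simp add: bubble_nat bubble_dl_def whisker_dl)

text \<open>The right leg of the bubble points upwards, so it can be pulled across the red string for free.
  Then the red string passes through the interior of the bubble, and moving its ends over the cap and
  the cup turns the picture into a bubble on the right whose left leg, which points downwards, crosses
  the red string twice.  That double crossing is the polynomial in the dots with the elementary
  symmetric functions of the red string as coefficients.\<close>

lemma ccw_bubble_through_red:
  "cg D \<nu> [Red k] [Red k] (whisker [] (bubble (Down i) (int m)) [Red k])
     (\<Sum>p\<le>red_mult D k i. scal ((-1) ^ p * eval_red D k (sym_e i p)) *
        whisker [Red k] (bubble (Down i) (int (m + (red_mult D k i - p)))) [])"
proof -
  let ?U = "Up i" and ?N = "Down i" and ?r = "Red k :: 'a strand" and ?l = "red_mult D k i"
  let ?a = "\<lambda>p. (-1) ^ p * eval_red D k (sym_e i p)"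
  have "cg D \<nu> [?r] [?r] (whisker [] (bubble ?N (int m)) [?r])
    (dl (([], Cap ?N, [?r]) # ([?N], Cross ?r ?U, []) # ([?N], Cross ?U ?r, []) #
       replicate m ([], Dot ?N, [?U, ?r]) @ [([], Cup ?N, [?r])]))"
    by (rule cg_step_sym[OF iso_up_red[where L="[?N]" and R="[]" and P="[([], Cap ?N, [?r])]" and
            Q="replicate m ([], Dot ?N, [?U, ?r]) @ [([], Cup ?N, [?r])]" and i=i and k=k]])
      (simp_all add: bubble_nat bubble_dl_def whisker_dl)
  also have "cg D \<nu> [?r] [?r] \<dots>
    (dl (([?r], Cap ?N, []) # ([], Cross ?N ?r, [?U]) # ([?N], Cross ?U ?r, []) #
       replicate m ([], Dot ?N, [?U, ?r]) @ [([], Cup ?N, [?r])]))"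
    by (rule cg_step_sym[OF iso_red_cap[where L="[]" and R="[]" and P="[]" and x="?N" and k=k and
            Q="([?N], Cross ?U ?r, []) # replicate m ([], Dot ?N, [?U, ?r]) @ [([], Cup ?N, [?r])]"]]) simp_all
  also have "cg D \<nu> [?r] [?r] \<dots>
    (dl (([?r], Cap ?N, []) # ([], Cross ?N ?r, [?U]) #
       replicate m ([], Dot ?N, [?r, ?U]) @ [([?N], Cross ?U ?r, []), ([], Cup ?N, [?r])]))"
    by (rule cg_step_sym[OF iso_commute[where L="[]" and M="[]" and R="[]" and xs="replicate m ([], Dot ?N, [])"
            and ys="[([], Cross ?U ?r, [])]" and ?S1.0="[?N]" and ?T1.0="[?N]" and ?S2.0="[?U, ?r]" and ?T2.0="[?r, ?U]"
            and P="[([?r], Cap ?N, []), ([], Cross ?N ?r, [?U])]" and Q="[([], Cup ?N, [?r])]"]]) simp_all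
  also have "cg D \<nu> [?r] [?r] \<dots>
    (dl (([?r], Cap ?N, []) # ([], Cross ?N ?r, [?U]) #
       replicate m ([], Dot ?N, [?r, ?U]) @ [([], Cross ?r ?N, [?U]), ([?r], Cup ?N, [])]))"
    by (rule cg_step_sym[OF iso_red_cup[where L="[]" and R="[]" and x="?N" and k=k and Q="[]" and
            P="([?r], Cap ?N, []) # ([], Cross ?N ?r, [?U]) # replicate m ([], Dot ?N, [?r, ?U])"]]) simp_all
  also have "cg D \<nu> [?r] [?r] \<dots>
    (dl (([?r], Cap ?N, []) # replicate m ([?r], Dot ?N, [?U]) @
       [([], Cross ?N ?r, [?U]), ([], Cross ?r ?N, [?U]), ([?r], Cup ?N, [])]))"
    by (rule cg_step[OF iso_dots_red_right[where L="[]" and R="[?U]" and x="?N" and k=k and n=m and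
            Q="[([], Cross ?r ?N, [?U]), ([?r], Cup ?N, [])]" and P="[([?r], Cap ?N, [])]"]]) simp_all
  also have "cg D \<nu> [?r] [?r] \<dots>
    (dl (([?r], Cap ?N, []) # replicate m ([?r], Dot ?N, [?U])) *
      (\<Sum>p\<le>?l. scal (?a p) * dl (replicate (?l - p) ([?r], Dot ?N, [?U]))) * dl [([?r], Cup ?N, [])])"
  proof (rule cg_step[OF cg_context_lin])
    show "cg D \<nu> [?r, ?N, ?U] [?r, ?N, ?U]
      (dl [([], Cross ?N ?r, [?U]), ([], Cross ?r ?N, [?U])])
      (\<Sum>p\<le>?l. scal (?a p) * dl (replicate (?l - p) ([?r], Dot ?N, [?U])))"
      using cg_red[OF red_rel.red_down[of D k i], of \<nu> "[]" "[?U]"]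
      by (simp add: sl_dl dl_mult dl_power_single whisker_sum whisker_mult whisker_dl map_replicate)
  qed (simp_all add: dl_mult)
  also have "\<dots> = (\<Sum>p\<le>?l. scal (?a p) * whisker [?r] (bubble ?N (int (m + (?l - p)))) [])"
    by (simp only: dl_sandwich bubble_nat)
      (simp add: bubble_dl_def whisker_dl map_replicate replicate_add del: Nat.add_diff_assoc)
  finally show ?thesis .
qed

text \<open>The mirror image: now the leg that faces the red string from the right points upwards, and the
  polynomial arises on the left.\<close>

lemma cw_bubble_through_red:
  assumes "\<And>p. eval_red D k (sym_e i p) \<in> Alam D"
  shows "cg D \<nu> [Red k] [Red k] (whisker [Red k] (bubble (Up i) (int m)) [])
     (\<Sum>p\<le>red_mult D k i. scal ((-1) ^ p * eval_red D k (sym_e i p)) *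
        whisker [] (bubble (Up i) (int (m + (red_mult D k i - p)))) [Red k])"
proof -
  let ?U = "Up i" and ?N = "Down i" and ?r = "Red k :: 'a strand" and ?l = "red_mult D k i"
  let ?a = "\<lambda>p. (-1) ^ p * eval_red D k (sym_e i p)"
  have "cg D \<nu> [?r] [?r] (whisker [?r] (bubble ?U (int m)) [])
    (dl (([?r], Cap ?U, []) # replicate m ([?r], Dot ?U, [?N]) @
       [([], Cross ?U ?r, [?N]), ([], Cross ?r ?U, [?N]), ([?r], Cup ?U, [])]))"
    by (rule cg_step_sym[OF iso_red_up[where L="[]" and R="[?N]" and Q="[([?r], Cup ?U, [])]" and
            P="([?r], Cap ?U, []) # replicate m ([?r], Dot ?U, [?N])" and i=i and k=k]])
      (simp_all add: bubble_nat bubble_dl_def whisker_dl)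
  also have "cg D \<nu> [?r] [?r] \<dots>
    (dl (([?r], Cap ?U, []) # replicate m ([?r], Dot ?U, [?N]) @
       [([], Cross ?U ?r, [?N]), ([?U], Cross ?N ?r, []), ([], Cup ?U, [?r])]))"
    by (rule cg_step[OF iso_red_cup[where L="[]" and R="[]" and x="?U" and k=k and Q="[]" and
            P="([?r], Cap ?U, []) # replicate m ([?r], Dot ?U, [?N]) @ [([], Cross ?U ?r, [?N])]"]]) simp_all
  also have "cg D \<nu> [?r] [?r] \<dots>
    (dl (([?r], Cap ?U, []) # ([], Cross ?U ?r, [?N]) # replicate m ([], Dot ?U, [?r, ?N]) @
       [([?U], Cross ?N ?r, []), ([], Cup ?U, [?r])]))"
    by (rule cg_step_sym[OF iso_dots_red_right[where L="[]" and R="[?N]" and x="?U" and k=k and n=m and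
            Q="[([?U], Cross ?N ?r, []), ([], Cup ?U, [?r])]" and P="[([?r], Cap ?U, [])]"]]) simp_all
  also have "cg D \<nu> [?r] [?r] \<dots>
    (dl (([], Cap ?U, [?r]) # ([?U], Cross ?r ?N, []) # replicate m ([], Dot ?U, [?r, ?N]) @
       [([?U], Cross ?N ?r, []), ([], Cup ?U, [?r])]))"
    by (rule cg_step[OF iso_red_cap[where L="[]" and R="[]" and P="[]" and x="?U" and k=k and
            Q="replicate m ([], Dot ?U, [?r, ?N]) @ [([?U], Cross ?N ?r, []), ([], Cup ?U, [?r])]"]]) simp_all
  also have "cg D \<nu> [?r] [?r] \<dots>
    (dl (([], Cap ?U, [?r]) # replicate m ([], Dot ?U, [?N, ?r]) @
       [([?U], Cross ?r ?N, []), ([?U], Cross ?N ?r, []), ([], Cup ?U, [?r])]))"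
    by (rule cg_step_sym[OF iso_commute[where L="[]" and M="[]" and R="[]" and xs="replicate m ([], Dot ?U, [])"
            and ys="[([], Cross ?r ?N, [])]" and ?S1.0="[?U]" and ?T1.0="[?U]" and ?S2.0="[?r, ?N]" and ?T2.0="[?N, ?r]"
            and P="[([], Cap ?U, [?r])]" and Q="[([?U], Cross ?N ?r, []), ([], Cup ?U, [?r])]"]]) simp_all
  also have "cg D \<nu> [?r] [?r] \<dots>
    (dl (([], Cap ?U, [?r]) # replicate m ([], Dot ?U, [?N, ?r])) *
      (\<Sum>p\<le>?l. scal (?a p) * dl (replicate (?l - p) ([?U], Dot ?N, [?r]))) * dl [([], Cup ?U, [?r])])"
  proof (rule cg_step[OF cg_context_lin])
    show "cg D \<nu> [?U, ?N, ?r] [?U, ?N, ?r]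
      (dl [([?U], Cross ?r ?N, []), ([?U], Cross ?N ?r, [])])
      (\<Sum>p\<le>?l. scal (?a p) * dl (replicate (?l - p) ([?U], Dot ?N, [?r])))"
      using cg_red[OF red_rel.down_red[of D i k], of \<nu> "[?U]" "[]"]
      by (simp add: sl_dl dl_mult dl_power_single whisker_sum whisker_mult whisker_dl map_replicate)
  qed (simp_all add: dl_mult)
  also have "\<dots> = (\<Sum>p\<le>?l. scal (?a p) * dl (([], Cap ?U, [?r]) # replicate m ([], Dot ?U, [?N, ?r]) @
      replicate (?l - p) ([?U], Dot ?N, [?r]) @ [([], Cup ?U, [?r])]))"
    by (simp add: dl_sandwich)
  also have "cg D \<nu> [?r] [?r] \<dots> (\<Sum>p\<le>?l. scal (?a p) * whisker [] (bubble ?U (int (m + (?l - p)))) [?r])"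
  proof (intro cg_sum cg_scal)
    fix p
    show "cg D \<nu> [?r] [?r] (dl (([], Cap ?U, [?r]) # replicate m ([], Dot ?U, [?N, ?r]) @
        replicate (?l - p) ([?U], Dot ?N, [?r]) @ [([], Cup ?U, [?r])]))
      (whisker [] (bubble ?U (int (m + (?l - p)))) [?r])"
      unfolding whisker_bubble replicate_add
      by (rule cg_step_sym[OF iso_dots_cup[where L="[]" and R="[?r]" and x="?U" and n="?l - p" and Q="[]" and
              P="([], Cap ?U, [?r]) # replicate m ([], Dot ?U, [?N, ?r])"]]) simp_all
  qed (simp add: assms)
  finally show ?thesis .
qed


section \<open>Figure eights\<close>

text \<open>A clockwise circle on the left and a counterclockwise circle on the right whose inner strands,
  both pointing downwards, cross once; the dots are on the left loop.\<close>

definition fig8 :: "'i \<Rightarrow> nat \<Rightarrow> 'i slice list" where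
  "fig8 i m = [([], Cap (Up i), []), ([Up i, Down i], Cap (Down i), []), ([Up i], Cross (Down i) (Down i), [Up i]),
     ([Up i, Down i], Cup (Down i), [])] @ replicate m ([], Dot (Up i), [Down i]) @ [([], Cup (Up i), [])]"

text \<open>The crossing of the two downward strands is rotated by moving it around the cap of one loop.  Then
  this cap, or the cap of the other loop, cancels with a cup in a zigzag, and a single sideways crossing
  between a cap and a cup remains; its direction depends on which cap was used.\<close>

lemma fig8_as_cross_up_down:
  "cg D \<nu> [] [] (dl (fig8 i m)) (dl ([([], Cap (Down i), []), ([], Cross (Up i) (Down i), [])] @
     replicate m ([], Dot (Up i), [Down i]) @ [([], Cup (Up i), [])]))"
proof -
  let ?U = "Up i" and ?N = "Down i"
  let ?t = "replicate m ([], Dot ?U, [?N]) @ [([], Cup ?U, [])]"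
  have "cg D \<nu> [] [] (dl (fig8 i m)) (dl ([([], Cap ?N, []), ([], Cap ?U, [?N, ?U]), ([?U], Cross ?N ?N, [?U]),
     ([?U, ?N], Cup ?N, [])] @ ?t))"
    by (rule cg_step[OF iso_commute[where L="[]" and M="[]" and R="[]" and xs="[([], Cap ?U, [])]" and
            ys="[([], Cap ?N, [])]" and ?S1.0="[?U, ?N]" and ?T1.0="[]" and ?S2.0="[?N, ?U]" and ?T2.0="[]" and
            P="[]" and Q="[([?U], Cross ?N ?N, [?U]), ([?U, ?N], Cup ?N, [])] @ ?t"]])
      (simp_all add: fig8_def)
  also have "cg D \<nu> [] [] \<dots> (dl ([([], Cap ?N, []), ([?N], Cap ?U, [?U]), ([], Cross ?U ?N, [?N, ?U]),
     ([?U, ?N], Cup ?N, [])] @ ?t))"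
    by (rule cg_step_sym[OF iso_pitchfork_cap[where L="[]" and R="[?U]" and x="?U" and y="?N" and
            P="[([], Cap ?N, [])]" and Q="[([?U, ?N], Cup ?N, [])] @ ?t"]]) simp_all
  also have "cg D \<nu> [] [] \<dots> (dl ([([], Cap ?N, []), ([?N], Cap ?U, [?U]), ([?N, ?U], Cup ?N, []),
     ([], Cross ?U ?N, [])] @ ?t))"
    by (rule cg_step[OF iso_commute[where L="[]" and M="[]" and R="[]" and xs="[([], Cross ?U ?N, [])]" and
            ys="[([], Cup ?N, [])]" and ?S1.0="[?U, ?N]" and ?T1.0="[?N, ?U]" and ?S2.0="[]" and ?T2.0="[?N, ?U]" and
            P="[([], Cap ?N, []), ([?N], Cap ?U, [?U])]" and Q="?t"]]) simp_all
  also have "cg D \<nu> [] [] \<dots> (dl ([([], Cap ?N, []), ([], Cross ?U ?N, [])] @ ?t))"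
    by (rule cg_step[OF iso_zigzag_left[where L="[?N]" and R="[]" and x="?U" and
            P="[([], Cap ?N, [])]" and Q="[([], Cross ?U ?N, [])] @ ?t"]]) simp_all
  finally show ?thesis by simp
qed

lemma fig8_as_cross_down_up:
  "cg D \<nu> [] [] (dl (fig8 i m)) (dl (([], Cap (Up i), []) # replicate m ([], Dot (Up i), [Down i]) @
     [([], Cross (Down i) (Up i), []), ([], Cup (Down i), [])]))"
proof -
  let ?U = "Up i" and ?N = "Down i"
  let ?t = "replicate m ([], Dot ?U, [?N]) @ [([], Cup ?U, [])]"
  have "cg D \<nu> [] [] (dl (fig8 i m)) (dl ([([], Cap ?U, []), ([?U], Cap ?N, [?N]), ([?U, ?N], Cross ?N ?U, []),
     ([?U, ?N], Cup ?N, [])] @ ?t))"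
    by (rule cg_step[OF iso_pitchfork_cap[where L="[?U]" and R="[]" and x="?N" and y="?N" and
            P="[([], Cap ?U, [])]" and Q="[([?U, ?N], Cup ?N, [])] @ ?t"]]) (simp_all add: fig8_def)
  also have "cg D \<nu> [] [] \<dots> (dl ([([], Cap ?U, []), ([?U], Cap ?N, [?N])] @
     replicate m ([], Dot ?U, [?N, ?U, ?N]) @
     [([], Cup ?U, [?U, ?N]), ([], Cross ?N ?U, []), ([], Cup ?N, [])]))"
    by (rule cg_step_sym[OF iso_commute[where L="[]" and M="[]" and R="[]" and xs="?t" and
            ys="[([], Cross ?N ?U, []), ([], Cup ?N, [])]" and ?S1.0="[]" and ?T1.0="[?U, ?N]" and
            ?S2.0="[]" and ?T2.0="[?U, ?N]" and
            P="[([], Cap ?U, []), ([?U], Cap ?N, [?N])]" and Q="[]"]]) simp_all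
  also have "cg D \<nu> [] [] \<dots> (dl ([([], Cap ?U, [])] @ replicate m ([], Dot ?U, [?N]) @
     [([?U], Cap ?N, [?N]), ([], Cup ?U, [?U, ?N]), ([], Cross ?N ?U, []), ([], Cup ?N, [])]))"
    by (rule cg_step_sym[OF iso_commute[where L="[]" and M="[]" and R="[?N]" and xs="replicate m ([], Dot ?U, [])" and
            ys="[([], Cap ?N, [])]" and ?S1.0="[?U]" and ?T1.0="[?U]" and ?S2.0="[?N, ?U]" and ?T2.0="[]" and
            P="[([], Cap ?U, [])]" and Q="[([], Cup ?U, [?U, ?N]), ([], Cross ?N ?U, []), ([], Cup ?N, [])]"]]) simp_all
  also have "cg D \<nu> [] [] \<dots> (dl ([([], Cap ?U, [])] @ replicate m ([], Dot ?U, [?N]) @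
     [([], Cross ?N ?U, []), ([], Cup ?N, [])]))"
    by (rule cg_step[OF iso_zigzag_right[where L="[]" and R="[?N]" and x="?U" and
            P="[([], Cap ?U, [])] @ replicate m ([], Dot ?U, [?N])" and
            Q="[([], Cross ?N ?U, []), ([], Cup ?N, [])]"]]) simp_all
  finally show ?thesis by simp
qed

text \<open>The two sides of the relation that moves a red string past a crossing of two downward strands are
  closed up by a clockwise cap and cup on the left and a counterclockwise cap and cup on the right.
  In one of them the right loop can be pulled off the red string, in the other one the left loop, since
  the outer legs point upwards; this leaves a figure eight on the left, respectively on the right.  The
  correction terms of the relation close up to pairs of circles on the two sides.\<close>

lemma fig8_through_red:
  assumes ev: "\<And>p. eval_red D k (sym_e i p) \<in> Alam D"
  shows "cg D \<nu> [Red k] [Red k] (whisker [] (dl (fig8 i m)) [Red k])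
     (whisker [Red k] (dl (fig8 i m)) [] +
      (\<Sum>(x, p, q)\<in>{(x, p, q). x + p + q + 1 = red_mult D k i}. scal ((-1) ^ x * eval_red D k (sym_e i x)) *
        (whisker [Red k] (bubble (Down i) (int q)) [] * whisker [] (bubble (Up i) (int (m + p))) [Red k])))"
proof -
  let ?U = "Up i" and ?N = "Down i" and ?r = "Red k :: 'a strand" and ?l = "red_mult D k i"
  let ?a = "\<lambda>x. (-1) ^ x * eval_red D k (sym_e i x)"
  let ?I = "{(x, p, q). x + p + q + 1 = ?l}"
  let ?top = "[([], Cap ?U, [?r]), ([?U, ?N, ?r], Cap ?N, [])]"
  let ?t = "replicate m ([], Dot ?U, [?N, ?r]) @ [([], Cup ?U, [?r])]"
  let ?bot = "([?U, ?N, ?r], Cup ?N, []) # ?t"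
  \<comment> \<open>the right loop is pulled off the red string to the left\<close>
  have left: "cg D \<nu> [?r] [?r]
     (dl (?top @ [([?U, ?N], Cross ?N ?r, [?U]), ([?U], Cross ?N ?N, [?r, ?U]), ([?U, ?N], Cross ?r ?N, [?U])] @ ?bot))
     (whisker [] (dl (fig8 i m)) [?r])"
  proof -
    have "cg D \<nu> [?r] [?r]
      (dl (?top @ [([?U, ?N], Cross ?N ?r, [?U]), ([?U], Cross ?N ?N, [?r, ?U]), ([?U, ?N], Cross ?r ?N, [?U])] @ ?bot))
      (dl ([([], Cap ?U, [?r]), ([?U, ?N], Cap ?N, [?r]), ([?U, ?N, ?N], Cross ?r ?U, []),
        ([?U], Cross ?N ?N, [?r, ?U]), ([?U, ?N], Cross ?r ?N, [?U])] @ ?bot))"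
      by (rule cg_step[OF iso_red_cap[where L="[?U, ?N]" and R="[]" and x="?N" and k=k and P="[([], Cap ?U, [?r])]" and
            Q="[([?U], Cross ?N ?N, [?r, ?U]), ([?U, ?N], Cross ?r ?N, [?U])] @ ?bot"]]) simp_all
    also have "cg D \<nu> [?r] [?r] \<dots>
      (dl ([([], Cap ?U, [?r]), ([?U, ?N], Cap ?N, [?r]), ([?U, ?N, ?N], Cross ?r ?U, []),
        ([?U], Cross ?N ?N, [?r, ?U]), ([?U, ?N, ?N], Cross ?U ?r, []), ([?U, ?N], Cup ?N, [?r])] @ ?t))"
      by (rule cg_step[OF iso_red_cup[where L="[?U, ?N]" and R="[]" and x="?N" and k=k and
            P="[([], Cap ?U, [?r]), ([?U, ?N], Cap ?N, [?r]), ([?U, ?N, ?N], Cross ?r ?U, []),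
              ([?U], Cross ?N ?N, [?r, ?U])]" and Q="?t"]]) simp_all
    also have "cg D \<nu> [?r] [?r] \<dots>
      (dl ([([], Cap ?U, [?r]), ([?U, ?N], Cap ?N, [?r]), ([?U, ?N, ?N], Cross ?r ?U, []),
        ([?U, ?N, ?N], Cross ?U ?r, []), ([?U], Cross ?N ?N, [?U, ?r]), ([?U, ?N], Cup ?N, [?r])] @ ?t))"
      by (rule cg_step[OF iso_commute[where L="[?U]" and M="[]" and R="[]" and xs="[([], Cross ?N ?N, [])]" and
            ys="[([], Cross ?U ?r, [])]" and ?S1.0="[?N, ?N]" and ?T1.0="[?N, ?N]" and ?S2.0="[?U, ?r]" and ?T2.0="[?r, ?U]" and
            P="[([], Cap ?U, [?r]), ([?U, ?N], Cap ?N, [?r]), ([?U, ?N, ?N], Cross ?r ?U, [])]" and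
            Q="([?U, ?N], Cup ?N, [?r]) # ?t"]]) simp_all
    also have "cg D \<nu> [?r] [?r] \<dots>
      (dl ([([], Cap ?U, [?r]), ([?U, ?N], Cap ?N, [?r]), ([?U], Cross ?N ?N, [?U, ?r]), ([?U, ?N], Cup ?N, [?r])] @ ?t))"
      by (rule cg_step[OF iso_up_red[where L="[?U, ?N, ?N]" and R="[]" and i=i and k=k and
            P="[([], Cap ?U, [?r]), ([?U, ?N], Cap ?N, [?r])]" and
            Q="([?U], Cross ?N ?N, [?U, ?r]) # ([?U, ?N], Cup ?N, [?r]) # ?t"]]) simp_all
    finally show ?thesis
      by (simp add: fig8_def whisker_dl)
  qed
  have top: "cg D \<nu> S [?r] (dl (?top @ Q)) (dl ([([?r], Cap ?N, []), ([], Cap ?U, [?r, ?N, ?U])] @ Q))"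
    if "slices_from_to S Q [?U, ?N, ?r, ?N, ?U]" for S Q
    by (rule cg_step[OF iso_commute[where L="[]" and M="[?r]" and R="[]" and xs="[([], Cap ?U, [])]" and
            ys="[([], Cap ?N, [])]" and ?S1.0="[?U, ?N]" and ?T1.0="[]" and ?S2.0="[?N, ?U]" and ?T2.0="[]" and
            P="[]" and Q=Q]]) (use that in simp_all)
  \<comment> \<open>the left loop is pulled off the red string to the right\<close>
  have right: "cg D \<nu> [?r] [?r]
     (dl (?top @ [([?U], Cross ?r ?N, [?N, ?U]), ([?U, ?r], Cross ?N ?N, [?U]), ([?U], Cross ?N ?r, [?N, ?U])] @ ?bot))
     (whisker [?r] (dl (fig8 i m)) [])"
  proof -
    let ?t' = "replicate m ([?r], Dot ?U, [?N]) @ [([?r], Cup ?U, [])]"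
    have "cg D \<nu> [?r] [?r]
      (dl (?top @ [([?U], Cross ?r ?N, [?N, ?U]), ([?U, ?r], Cross ?N ?N, [?U]), ([?U], Cross ?N ?r, [?N, ?U])] @ ?bot))
      (dl ([([?r], Cap ?N, []), ([], Cap ?U, [?r, ?N, ?U]), ([?U], Cross ?r ?N, [?N, ?U]), ([?U, ?r], Cross ?N ?N, [?U]),
        ([?U], Cross ?N ?r, [?N, ?U])] @ ?bot))"
      by (rule cg_step[OF top]) simp_all
    also have "cg D \<nu> [?r] [?r] \<dots>
      (dl ([([?r], Cap ?N, []), ([?r], Cap ?U, [?N, ?U]), ([], Cross ?U ?r, [?N, ?N, ?U]), ([?U, ?r], Cross ?N ?N, [?U]),
        ([?U], Cross ?N ?r, [?N, ?U])] @ ?bot))"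
      by (rule cg_step_sym[OF iso_red_cap[where L="[]" and R="[?N, ?U]" and x="?U" and k=k and P="[([?r], Cap ?N, [])]" and
            Q="[([?U, ?r], Cross ?N ?N, [?U]), ([?U], Cross ?N ?r, [?N, ?U])] @ ?bot"]]) simp_all
    also have "cg D \<nu> [?r] [?r] \<dots>
      (dl ([([?r], Cap ?N, []), ([?r], Cap ?U, [?N, ?U]), ([], Cross ?U ?r, [?N, ?N, ?U]), ([?U, ?r], Cross ?N ?N, [?U]),
        ([?U, ?r, ?N], Cup ?N, []), ([?U], Cross ?N ?r, [])] @ ?t))"
      by (rule cg_step[OF iso_commute[where L="[?U]" and M="[]" and R="[]" and xs="[([], Cross ?N ?r, [])]" and
            ys="[([], Cup ?N, [])]" and ?S1.0="[?N, ?r]" and ?T1.0="[?r, ?N]" and ?S2.0="[]" and ?T2.0="[?N, ?U]" and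
            P="[([?r], Cap ?N, []), ([?r], Cap ?U, [?N, ?U]), ([], Cross ?U ?r, [?N, ?N, ?U]), ([?U, ?r], Cross ?N ?N, [?U])]" and
            Q="?t"]]) simp_all
    also have "cg D \<nu> [?r] [?r] \<dots>
      (dl ([([?r], Cap ?N, []), ([?r], Cap ?U, [?N, ?U]), ([], Cross ?U ?r, [?N, ?N, ?U]), ([?U, ?r], Cross ?N ?N, [?U]),
        ([?U, ?r, ?N], Cup ?N, [])] @ replicate m ([], Dot ?U, [?r, ?N]) @ [([?U], Cross ?N ?r, []), ([], Cup ?U, [?r])]))"
      by (rule cg_step_sym[OF iso_commute[where L="[]" and M="[]" and R="[]" and xs="replicate m ([], Dot ?U, [])" and
            ys="[([], Cross ?N ?r, [])]" and ?S1.0="[?U]" and ?T1.0="[?U]" and ?S2.0="[?N, ?r]" and ?T2.0="[?r, ?N]" and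
            P="[([?r], Cap ?N, []), ([?r], Cap ?U, [?N, ?U]), ([], Cross ?U ?r, [?N, ?N, ?U]), ([?U, ?r], Cross ?N ?N, [?U]),
              ([?U, ?r, ?N], Cup ?N, [])]" and
            Q="[([], Cup ?U, [?r])]"]]) simp_all
    also have "cg D \<nu> [?r] [?r] \<dots>
      (dl ([([?r], Cap ?N, []), ([?r], Cap ?U, [?N, ?U]), ([], Cross ?U ?r, [?N, ?N, ?U]), ([?U, ?r], Cross ?N ?N, [?U]),
        ([?U, ?r, ?N], Cup ?N, [])] @ replicate m ([], Dot ?U, [?r, ?N]) @ [([], Cross ?r ?U, [?N]), ([?r], Cup ?U, [])]))"
      by (rule cg_step_sym[OF iso_red_cup[where L="[]" and R="[]" and x="?U" and k=k and
            P="[([?r], Cap ?N, []), ([?r], Cap ?U, [?N, ?U]), ([], Cross ?U ?r, [?N, ?N, ?U]), ([?U, ?r], Cross ?N ?N, [?U]),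
              ([?U, ?r, ?N], Cup ?N, [])] @ replicate m ([], Dot ?U, [?r, ?N])" and Q="[]"]]) simp_all
    also have "cg D \<nu> [?r] [?r] \<dots>
      (dl ([([?r], Cap ?N, []), ([?r], Cap ?U, [?N, ?U]), ([], Cross ?U ?r, [?N, ?N, ?U]), ([?U, ?r], Cross ?N ?N, [?U]),
        ([?U, ?r, ?N], Cup ?N, []), ([], Cross ?r ?U, [?N])] @ ?t'))"
      by (rule cg_step_sym[OF iso_dots_red_left[where L="[]" and R="[?N]" and x="?U" and k=k and n=m and
            P="[([?r], Cap ?N, []), ([?r], Cap ?U, [?N, ?U]), ([], Cross ?U ?r, [?N, ?N, ?U]), ([?U, ?r], Cross ?N ?N, [?U]),
              ([?U, ?r, ?N], Cup ?N, [])]" and Q="[([?r], Cup ?U, [])]"]]) simp_all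
    also have "cg D \<nu> [?r] [?r] \<dots>
      (dl ([([?r], Cap ?N, []), ([?r], Cap ?U, [?N, ?U]), ([], Cross ?U ?r, [?N, ?N, ?U]), ([], Cross ?r ?U, [?N, ?N, ?U]),
        ([?r, ?U], Cross ?N ?N, [?U]), ([?r, ?U, ?N], Cup ?N, [])] @ ?t'))"
      by (rule cg_step_sym[OF iso_commute[where L="[]" and M="[]" and R="[]" and xs="[([], Cross ?r ?U, [])]" and
            ys="[([], Cross ?N ?N, [?U]), ([?N], Cup ?N, [])]" and ?S1.0="[?r, ?U]" and ?T1.0="[?U, ?r]" and
            ?S2.0="[?N]" and ?T2.0="[?N, ?N, ?U]" and
            P="[([?r], Cap ?N, []), ([?r], Cap ?U, [?N, ?U]), ([], Cross ?U ?r, [?N, ?N, ?U])]" and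
            Q="?t'"]]) simp_all
    also have "cg D \<nu> [?r] [?r] \<dots>
      (dl ([([?r], Cap ?N, []), ([?r], Cap ?U, [?N, ?U]),
        ([?r, ?U], Cross ?N ?N, [?U]), ([?r, ?U, ?N], Cup ?N, [])] @ ?t'))"
      by (rule cg_step[OF iso_red_up[where L="[]" and R="[?N, ?N, ?U]" and i=i and k=k and
            P="[([?r], Cap ?N, []), ([?r], Cap ?U, [?N, ?U])]" and
            Q="([?r, ?U], Cross ?N ?N, [?U]) # ([?r, ?U, ?N], Cup ?N, []) # ?t'"]]) simp_all
    also have "cg D \<nu> [?r] [?r] \<dots>
      (dl ([([?r], Cap ?U, []), ([?r, ?U, ?N], Cap ?N, []),
        ([?r, ?U], Cross ?N ?N, [?U]), ([?r, ?U, ?N], Cup ?N, [])] @ ?t'))"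
      by (rule cg_step_sym[OF iso_commute[where L="[?r]" and M="[]" and R="[]" and xs="[([], Cap ?U, [])]" and
            ys="[([], Cap ?N, [])]" and ?S1.0="[?U, ?N]" and ?T1.0="[]" and ?S2.0="[?N, ?U]" and ?T2.0="[]" and
            P="[]" and Q="([?r, ?U], Cross ?N ?N, [?U]) # ([?r, ?U, ?N], Cup ?N, []) # ?t'"]]) simp_all
    finally show ?thesis
      by (simp add: fig8_def whisker_dl)
  qed
  have corr: "cg D \<nu> [?r] [?r]
     (dl (?top @ (replicate p ([?U], Dot ?N, [?r, ?N, ?U]) @ replicate q ([?U, ?N, ?r], Dot ?N, [?U])) @ ?bot))
     (whisker [?r] (bubble ?N (int q)) [] * whisker [] (bubble ?U (int (m + p))) [?r])" for p q
  proof -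
    have "cg D \<nu> [?r] [?r]
      (dl (?top @ (replicate p ([?U], Dot ?N, [?r, ?N, ?U]) @ replicate q ([?U, ?N, ?r], Dot ?N, [?U])) @ ?bot))
      (dl ([([?r], Cap ?N, []), ([], Cap ?U, [?r, ?N, ?U])] @
        (replicate p ([?U], Dot ?N, [?r, ?N, ?U]) @ replicate q ([?U, ?N, ?r], Dot ?N, [?U])) @ ?bot))"
      by (rule cg_step[OF top]) simp_all
    also have "cg D \<nu> [?r] [?r] \<dots>
      (dl (([?r], Cap ?N, []) # replicate q ([?r], Dot ?N, [?U]) @ ([?r], Cup ?N, []) # ([], Cap ?U, [?r]) #
        replicate p ([?U], Dot ?N, [?r]) @ ?t))"
      by (rule cg_step[OF iso_commute[where L="[]" and M="[?r]" and R="[]" and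
            xs="([], Cap ?U, []) # replicate p ([?U], Dot ?N, [])" and
            ys="replicate q ([], Dot ?N, [?U]) @ [([], Cup ?N, [])]" and ?S1.0="[?U, ?N]" and ?T1.0="[]" and
            ?S2.0="[]" and ?T2.0="[?N, ?U]" and
            P="[([?r], Cap ?N, [])]" and Q="?t"]]) simp_all
    also have "cg D \<nu> [?r] [?r] \<dots>
      (dl (([?r], Cap ?N, []) # replicate q ([?r], Dot ?N, [?U]) @ ([?r], Cup ?N, []) # ([], Cap ?U, [?r]) #
        replicate m ([], Dot ?U, [?N, ?r]) @ replicate p ([?U], Dot ?N, [?r]) @ [([], Cup ?U, [?r])]))"
      by (rule cg_step_sym[OF iso_commute[where L="[]" and M="[]" and R="[?r]" and
            xs="replicate m ([], Dot ?U, [])" and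
            ys="replicate p ([], Dot ?N, [])" and ?S1.0="[?U]" and ?T1.0="[?U]" and
            ?S2.0="[?N]" and ?T2.0="[?N]" and
            P="([?r], Cap ?N, []) # replicate q ([?r], Dot ?N, [?U]) @ [([?r], Cup ?N, []), ([], Cap ?U, [?r])]" and
            Q="[([], Cup ?U, [?r])]"]]) simp_all
    also have "cg D \<nu> [?r] [?r] \<dots>
      (dl (([?r], Cap ?N, []) # replicate q ([?r], Dot ?N, [?U]) @ ([?r], Cup ?N, []) # ([], Cap ?U, [?r]) #
        replicate m ([], Dot ?U, [?N, ?r]) @ replicate p ([], Dot ?U, [?N, ?r]) @ [([], Cup ?U, [?r])]))"
      by (rule cg_step_sym[OF iso_dots_cup[where L="[]" and R="[?r]" and x="?U" and n=p and
            P="([?r], Cap ?N, []) # replicate q ([?r], Dot ?N, [?U]) @ [([?r], Cup ?N, []), ([], Cap ?U, [?r])]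
              @ replicate m ([], Dot ?U, [?N, ?r])" and Q="[]"]]) simp_all
    also have "\<dots> = whisker [?r] (bubble ?N (int q)) [] * whisker [] (bubble ?U (int (m + p))) [?r]"
      unfolding whisker_bubble replicate_add by (simp add: dl_mult)
    finally show ?thesis .
  qed
  have rel: "cg D \<nu> [?U, ?N, ?r, ?N, ?U] [?U, ?N, ?r, ?N, ?U]
     (dl [([?U, ?N], Cross ?N ?r, [?U]), ([?U], Cross ?N ?N, [?r, ?U]), ([?U, ?N], Cross ?r ?N, [?U])])
     (dl [([?U], Cross ?r ?N, [?N, ?U]), ([?U, ?r], Cross ?N ?N, [?U]), ([?U], Cross ?N ?r, [?N, ?U])] +
       (\<Sum>(x, p, q)\<in>?I. scal (?a x) *
         dl (replicate p ([?U], Dot ?N, [?r, ?N, ?U]) @ replicate q ([?U, ?N, ?r], Dot ?N, [?U]))))"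
    using cg_red[OF red_rel.down_red_down[of D i k i], of \<nu> "[?U]" "[?U]"]
    by (simp add: sl_dl dl_mult dl_power_single whisker_add whisker_sum whisker_mult whisker_dl map_replicate
        mult.assoc case_prod_unfold)
  have "cg D \<nu> [?r] [?r] (whisker [] (dl (fig8 i m)) [?r])
     (dl ?top * (dl [([?U], Cross ?r ?N, [?N, ?U]), ([?U, ?r], Cross ?N ?N, [?U]), ([?U], Cross ?N ?r, [?N, ?U])] +
       (\<Sum>(x, p, q)\<in>?I. scal (?a x) *
         dl (replicate p ([?U], Dot ?N, [?r, ?N, ?U]) @ replicate q ([?U, ?N, ?r], Dot ?N, [?U])))) * dl ?bot)"
    by (rule cg_trans[OF cg_sym[OF left]], rule cg_step[OF cg_context_lin[OF rel, where P="?top" and Q="?bot"]])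
      (simp_all add: dl_mult)
  also have "\<dots> = dl (?top @ [([?U], Cross ?r ?N, [?N, ?U]), ([?U, ?r], Cross ?N ?N, [?U]),
        ([?U], Cross ?N ?r, [?N, ?U])] @ ?bot) +
      (\<Sum>(x, p, q)\<in>?I. scal (?a x) *
        dl (?top @ (replicate p ([?U], Dot ?N, [?r, ?N, ?U]) @ replicate q ([?U, ?N, ?r], Dot ?N, [?U])) @ ?bot))"
    unfolding case_prod_unfold distrib_left distrib_right dl_sandwich by (simp add: dl_mult)
  also have "cg D \<nu> [?r] [?r] \<dots> (whisker [?r] (dl (fig8 i m)) [] +
      (\<Sum>(x, p, q)\<in>?I. scal (?a x) *
        (whisker [?r] (bubble ?N (int q)) [] * whisker [] (bubble ?U (int (m + p))) [?r])))"
    unfolding case_prod_unfold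
    by (intro cg_add right cg_sum cg_scal corr) (simp add: ev)
  finally show ?thesis .
qed


section \<open>Curls\<close>

locale stendhal =
  fixes D :: "('i::finite, 'r, 'k::field_char_0) stendhal_data"
  assumes datum: "stendhal_datum D"
begin

lemma coroot_add: "coroot D i (x + y) = coroot D i x + coroot D i y"
  using datum by (simp add: stendhal_datum_def)

lemma coroot_zero [simp]: "coroot D i 0 = 0"
  using coroot_add[of i 0 0] by simp

lemma coroot_uminus: "coroot D i (- x) = - coroot D i x"
  using coroot_add[of i x "- x"] by simp

lemma cartan_self: "cartan D i i = 2"
  using datum by (simp add: stendhal_datum_def)

lemma coroot_simple_root_self [simp]: "coroot D i (simple_root D i) = 2"
  using cartan_self by (simp add: cartan_def)

lemma bub_param_nonzero [simp]: "bub_param D i \<mu> \<noteq> 0"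
  using datum by (simp add: stendhal_datum_def)

lemma bub_param_shift: "bub_param D i (\<mu> + simple_root D i) = bub_param D i \<mu>"
proof -
  have "\<forall>i j. arrow D i j \<longrightarrow> cartan D i j = -1"
    using datum by (simp add: stendhal_datum_def)
  then have "\<not> arrow D i i"
    using cartan_self[of i] by auto
  then show ?thesis
    using datum by (simp add: stendhal_datum_def tsign_def)
qed

lemma cg_black0: "black_rel D \<nu> S T u v \<Longrightarrow> cg D \<nu> S T u v"
  using cg_black[of D "[]" \<nu> S T u v "[]"] by simp

lemma cw_lowest:
  assumes "r \<le> 0"
  shows "cg D \<nu> [] [] (cw D \<nu> i r) (kscal (if r = 0 then bub_param D i \<nu> else 0))"
  using assms cg_black0[OF black_rel.cw_neg[where r=r]] cg_black0[OF black_rel.cw_zero[of D \<nu> i]]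
  by (cases "r = 0") auto

lemma ccw_lowest:
  assumes "r \<le> 0"
  shows "cg D \<nu> [] [] (ccw D \<nu> i r) (kscal (if r = 0 then inverse (bub_param D i \<nu>) else 0))"
  using assms cg_black0[OF black_rel.ccw_neg[where r=r]] cg_black0[OF black_rel.ccw_zero[of D \<nu> i]]
  by (cases "r = 0") auto

text \<open>In regions of nonnegative weight the sum in the relation is over the empty set.\<close>

lemma cross_inverse_down_up:
  assumes "coroot D i (wtw D R + \<nu>) \<ge> 0"
    and "slices_from_to S Q (L @ Down i # Up i # R)" "slices_from_to (L @ Down i # Up i # R) P T"
  shows "cg D \<nu> S T (dl (P @ Q))
    (- dl (P @ [(L, Cross (Up i) (Down i), R), (L, Cross (Down i) (Up i), R)] @ Q))"
proof -
  have empty: "{(a, b, c::nat). int (a + b + c) = - coroot D i (wtw D R + \<nu>) - 1} = {}"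
    using assms(1) by auto
  then have "cg D \<nu> (L @ Down i # Up i # R) (L @ Down i # Up i # R) 1
     (- dl [(L, Cross (Up i) (Down i), R), (L, Cross (Down i) (Up i), R)])"
    using cg_black[OF black_rel.inverse_down_up[of D "wtw D R + \<nu>" i, unfolded empty], of L]
    by (simp add: sl_dl dl_mult whisker_uminus whisker_dl)
  from cg_context_lin[OF this assms(2,3)] show ?thesis
    by (simp add: dl_mult)
qed

lemma cross_inverse_up_down:
  assumes "coroot D i (wtw D R + \<nu>) \<le> 0"
    and "slices_from_to S Q (L @ Up i # Down i # R)" "slices_from_to (L @ Up i # Down i # R) P T"
  shows "cg D \<nu> S T (dl (P @ Q))
    (- dl (P @ [(L, Cross (Down i) (Up i), R), (L, Cross (Up i) (Down i), R)] @ Q))"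
proof -
  have empty: "{(a, b, c::nat). int (a + b + c) = coroot D i (wtw D R + \<nu>) - 1} = {}"
    using assms(1) by auto
  then have "cg D \<nu> (L @ Up i # Down i # R) (L @ Up i # Down i # R) 1
     (- dl [(L, Cross (Down i) (Up i), R), (L, Cross (Up i) (Down i), R)])"
    using cg_black[OF black_rel.inverse_up_down[of D "wtw D R + \<nu>" i, unfolded empty], of L]
    by (simp add: sl_dl dl_mult whisker_uminus whisker_dl)
  from cg_context_lin[OF this assms(2,3)] show ?thesis
    by (simp add: dl_mult)
qed

lemma nilhecke_dot_right:
  assumes "slices_from_to S Q (L @ Up i # Up i # R)" "slices_from_to (L @ Up i # Up i # R) P T"
  shows "cg D \<nu> S T (dl (P @ [(L, Cross (Up i) (Up i), R), (L, Dot (Up i), Up i # R)] @ Q))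
    (dl (P @ [(L @ [Up i], Dot (Up i), R), (L, Cross (Up i) (Up i), R)] @ Q) + dl (P @ Q))"
proof -
  have "cg D \<nu> (L @ Up i # Up i # R) (L @ Up i # Up i # R)
      (dl [(L, Cross (Up i) (Up i), R), (L, Dot (Up i), Up i # R)])
      (dl [(L @ [Up i], Dot (Up i), R), (L, Cross (Up i) (Up i), R)] + 1)"
    using cg_black[OF black_rel.dot_cross_right[of D "wtw D R + \<nu>" i i], of L]
    by (simp add: sl_dl dl_mult whisker_add whisker_dl)
  from cg_context_lin[OF this assms] show ?thesis
    by (simp add: dl_mult distrib_left distrib_right)
qed

lemma nilhecke_dot_left:
  assumes "slices_from_to S Q (L @ Up i # Up i # R)" "slices_from_to (L @ Up i # Up i # R) P T"
  shows "cg D \<nu> S T (dl (P @ [(L, Cross (Up i) (Up i), R), (L @ [Up i], Dot (Up i), R)] @ Q))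
    (dl (P @ [(L, Dot (Up i), Up i # R), (L, Cross (Up i) (Up i), R)] @ Q) - dl (P @ Q))"
proof -
  have "cg D \<nu> (L @ Up i # Up i # R) (L @ Up i # Up i # R)
      (dl [(L, Dot (Up i), Up i # R), (L, Cross (Up i) (Up i), R)])
      (dl [(L, Cross (Up i) (Up i), R), (L @ [Up i], Dot (Up i), R)] + 1)"
    using cg_black[OF black_rel.dot_cross_left[of D "wtw D R + \<nu>" i i], of L]
    by (simp add: sl_dl dl_mult whisker_add whisker_dl)
  from cg_diff[OF cg_context_lin[OF this assms] cg_refl[of D \<nu> S T "dl (P @ Q)"]] show ?thesis
    by (simp add: dl_mult distrib_left distrib_right cg_sym)
qed

lemma nilhecke_square:
  assumes "slices_from_to S Q (L @ Up i # Up i # R)" "slices_from_to (L @ Up i # Up i # R) P T"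
  shows "cg D \<nu> S T (dl (P @ [(L, Cross (Up i) (Up i), R), (L, Cross (Up i) (Up i), R)] @ Q)) 0"
proof -
  have "cg D \<nu> (L @ Up i # Up i # R) (L @ Up i # Up i # R)
      (dl [(L, Cross (Up i) (Up i), R), (L, Cross (Up i) (Up i), R)]) 0"
    using cg_black[OF black_rel.cross_cross[of D "wtw D R + \<nu>" i i], of L]
    by (simp add: sl_dl dl_mult whisker_dl)
  from cg_context_lin[OF this assms] show ?thesis
    by (simp add: dl_mult)
qed

text \<open>A clockwise bubble with one dot to the left of an upward string sits in a region on which the coroot
  of \<open>i\<close> takes the value \<open>2 + coroot D i \<nu>\<close>, so it has degree \<open>- 2 * coroot D i \<nu>\<close> and is a scalar.  On the other hand the inverse
  relation between its right leg and the string turns it into minus a right curl in which the dot sits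
  between two crossings of upward strings; sliding the dot out leaves the square of the crossing, which is zero, and the curl as correction term.\<close>

lemma right_curl:
  assumes "coroot D i \<nu> \<ge> 0"
  shows "cg D \<nu> [Up i] [Up i] (dl [([Up i], Cap (Up i), []), ([], Cross (Up i) (Up i), [Down i]), ([Up i], Cup (Up i), [])])
     (- kscal (if coroot D i \<nu> = 0 then bub_param D i \<nu> else 0))"
proof -
  let ?U = "Up i" and ?N = "Down i" and ?W = "[([Up i], Cap (Up i), []), ([], Cross (Up i) (Up i), [Down i]), ([Up i], Cup (Up i), [])]"
  let ?k = "kscal (if coroot D i \<nu> = 0 then bub_param D i \<nu> else 0) :: ('i, 'k) lin"
  have conv: "cg D \<nu> [?U] [?U] (dl [([], Cap ?U, [?U]), ([?U], Cross ?U ?N, []), ([?U], Cross ?N ?U, []),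
      ([], Dot ?U, [?N, ?U]), ([], Cup ?U, [?U])]) (dl ?W)"
  proof -
    have "cg D \<nu> [?U] [?U] (dl [([], Cap ?U, [?U]), ([?U], Cross ?U ?N, []), ([?U], Cross ?N ?U, []),
        ([], Dot ?U, [?N, ?U]), ([], Cup ?U, [?U])])
      (dl [([], Cap ?U, [?U]), ([?U], Cross ?U ?N, []), ([], Dot ?U, [?U, ?N]), ([?U], Cross ?N ?U, []),
        ([], Cup ?U, [?U])])"
      by (rule cg_step_sym[OF iso_commute[where L="[]" and M="[]" and R="[]" and xs="[([], Dot ?U, [])]" and
              ys="[([], Cross ?N ?U, [])]" and ?S1.0="[?U]" and ?T1.0="[?U]" and ?S2.0="[?N, ?U]" and ?T2.0="[?U, ?N]" and
              P="[([], Cap ?U, [?U]), ([?U], Cross ?U ?N, [])]" and Q="[([], Cup ?U, [?U])]"]]) simp_all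
    also have "cg D \<nu> [?U] [?U] \<dots>
      (dl [([], Cap ?U, [?U]), ([?U], Cross ?U ?N, []), ([], Dot ?U, [?U, ?N]), ([], Cross ?U ?U, [?N]),
        ([?U], Cup ?U, [])])"
      by (rule cg_step_sym[OF iso_pitchfork_cup[where L="[]" and R="[]" and x="?U" and y="?U" and
              P="[([], Cap ?U, [?U]), ([?U], Cross ?U ?N, []), ([], Dot ?U, [?U, ?N])]" and Q="[]"]]) simp_all
    also have "cg D \<nu> [?U] [?U] \<dots>
      (dl [([?U], Cap ?U, []), ([], Cross ?U ?U, [?N]), ([], Dot ?U, [?U, ?N]), ([], Cross ?U ?U, [?N]),
        ([?U], Cup ?U, [])])"
      by (rule cg_step_sym[OF iso_pitchfork_cap[where L="[]" and R="[]" and x="?U" and y="?U" and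
              P="[]" and Q="[([], Dot ?U, [?U, ?N]), ([], Cross ?U ?U, [?N]), ([?U], Cup ?U, [])]"]]) simp_all
    also have "cg D \<nu> [?U] [?U] \<dots>
      (dl [([?U], Cap ?U, []), ([?U], Dot ?U, [?N]), ([], Cross ?U ?U, [?N]), ([], Cross ?U ?U, [?N]), ([?U], Cup ?U, [])] + dl ?W)"
      by (rule cg_step[OF nilhecke_dot_right[where L="[]" and R="[?N]" and i=i and
              P="[([?U], Cap ?U, [])]" and Q="[([], Cross ?U ?U, [?N]), ([?U], Cup ?U, [])]"]]) simp_all
    also have "cg D \<nu> [?U] [?U] \<dots> (0 + dl ?W)"
      by (intro cg_add cg_refl, rule cg_step[OF nilhecke_square[where L="[]" and R="[?N]" and i=i and
              P="[([?U], Cap ?U, []), ([?U], Dot ?U, [?N])]" and Q="[([?U], Cup ?U, [])]"]]) simp_all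
    finally show ?thesis by simp
  qed
  have b: "bub_param D i (simple_root D i + \<nu>) = bub_param D i \<nu>"
    using bub_param_shift[of i \<nu>] by (simp add: add.commute)
  have "cg D \<nu> [?U] [?U] ?k (whisker [] (cw D (simple_root D i + \<nu>) i (- coroot D i \<nu>)) [?U])"
    using cg_sym[OF cg_whisker'[OF cw_lowest[of "- coroot D i \<nu>" "simple_root D i + \<nu>" i, unfolded b], of "[?U]" \<nu> "[?U]" "[]" "[?U]"]] assms
    by (simp add: wtw_Cons split del: if_split)
  also have "\<dots> = dl [([], Cap ?U, [?U]), ([], Dot ?U, [?N, ?U]), ([], Cup ?U, [?U])]"
    using whisker_bubble[of "[]" ?U 1 "[?U]"] by (simp add: cw_def coroot_add)
  also have "cg D \<nu> [?U] [?U] \<dots> (- dl [([], Cap ?U, [?U]), ([?U], Cross ?U ?N, []), ([?U], Cross ?N ?U, []),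
      ([], Dot ?U, [?N, ?U]), ([], Cup ?U, [?U])])"
    by (rule cg_step[OF cross_inverse_down_up[where L="[?U]" and R="[]" and i=i and P="[([], Cap ?U, [?U])]" and
            Q="[([], Dot ?U, [?N, ?U]), ([], Cup ?U, [?U])]"]]) (simp_all add: assms)
  also have "cg D \<nu> [?U] [?U] \<dots> (- dl ?W)"
    by (rule cg_uminus[OF conv])
  finally have "cg D \<nu> [?U] [?U] ?k (- dl ?W)"
    by simp
  from cg_sym[OF cg_uminus[OF this]] show ?thesis
    by simp
qed

text \<open>The mirror image, with a counterclockwise bubble to the right of the string.  The sign differs
  because the dot now sits on the other strand between the two crossings.\<close>

lemma left_curl:
  assumes "coroot D i (simple_root D i + \<nu>) \<le> 0"
  shows "cg D \<nu> [Up i] [Up i] (dl [([], Cap (Down i), [Up i]), ([Down i], Cross (Up i) (Up i), []), ([], Cup (Down i), [Up i])])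
     (kscal (if coroot D i (simple_root D i + \<nu>) = 0 then inverse (bub_param D i \<nu>) else 0))"
proof -
  let ?U = "Up i" and ?N = "Down i" and ?W = "[([], Cap (Down i), [Up i]), ([Down i], Cross (Up i) (Up i), []), ([], Cup (Down i), [Up i])]"
  let ?h = "coroot D i (simple_root D i + \<nu>)"
  let ?k = "kscal (if ?h = 0 then inverse (bub_param D i \<nu>) else 0) :: ('i, 'k) lin"
  have "cg D \<nu> [?U] [?U] ?k (whisker [?U] (ccw D \<nu> i ?h) [])"
    using cg_sym[OF cg_whisker'[OF ccw_lowest[of ?h \<nu> i], of "[]" \<nu> "[?U]" "[?U]" "[?U]"]] assms
    by (simp split del: if_split)
  also have "\<dots> = dl [([?U], Cap ?N, []), ([?U], Dot ?N, [?U]), ([?U], Cup ?N, [])]"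
    using whisker_bubble[of "[?U]" ?N 1 "[]"] by (simp add: ccw_def coroot_add)
  also have "cg D \<nu> [?U] [?U] \<dots> (dl [([?U], Cap ?N, []), ([?U, ?N], Dot ?U, []), ([?U], Cup ?N, [])])"
    by (rule cg_step[OF iso_dot_cup[where L="[?U]" and R="[]" and x="?N" and P="[([?U], Cap ?N, [])]" and Q="[]"]]) simp_all
  also have "cg D \<nu> [?U] [?U] \<dots> (- dl [([?U], Cap ?N, []), ([], Cross ?N ?U, [?U]), ([], Cross ?U ?N, [?U]),
      ([?U, ?N], Dot ?U, []), ([?U], Cup ?N, [])])"
    by (rule cg_step[OF cross_inverse_up_down[where L="[]" and R="[?U]" and i=i and P="[([?U], Cap ?N, [])]" and
            Q="[([?U, ?N], Dot ?U, []), ([?U], Cup ?N, [])]"]]) (use assms in \<open>simp_all add: wtw_Cons\<close>)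
  also have "cg D \<nu> [?U] [?U] \<dots> (- (- dl ?W))"
  proof (rule cg_uminus)
    have "cg D \<nu> [?U] [?U] (dl [([?U], Cap ?N, []), ([], Cross ?N ?U, [?U]), ([], Cross ?U ?N, [?U]),
        ([?U, ?N], Dot ?U, []), ([?U], Cup ?N, [])])
      (dl [([?U], Cap ?N, []), ([], Cross ?N ?U, [?U]), ([?N, ?U], Dot ?U, []), ([], Cross ?U ?N, [?U]), ([?U], Cup ?N, [])])"
      by (rule cg_step[OF iso_commute[where L="[]" and M="[]" and R="[]" and xs="[([], Cross ?U ?N, [])]" and
              ys="[([], Dot ?U, [])]" and ?S1.0="[?U, ?N]" and ?T1.0="[?N, ?U]" and ?S2.0="[?U]" and ?T2.0="[?U]" and
              P="[([?U], Cap ?N, []), ([], Cross ?N ?U, [?U])]" and Q="[([?U], Cup ?N, [])]"]]) simp_all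
    also have "cg D \<nu> [?U] [?U] \<dots>
      (dl [([], Cap ?N, [?U]), ([?N], Cross ?U ?U, []), ([?N, ?U], Dot ?U, []), ([], Cross ?U ?N, [?U]), ([?U], Cup ?N, [])])"
      by (rule cg_step[OF iso_pitchfork_cap[where L="[]" and R="[]" and x="?N" and y="?U" and
              P="[]" and Q="[([?N, ?U], Dot ?U, []), ([], Cross ?U ?N, [?U]), ([?U], Cup ?N, [])]"]]) simp_all
    also have "cg D \<nu> [?U] [?U] \<dots>
      (dl [([], Cap ?N, [?U]), ([?N], Cross ?U ?U, []), ([?N, ?U], Dot ?U, []), ([?N], Cross ?U ?U, []), ([], Cup ?N, [?U])])"
      by (rule cg_step[OF iso_pitchfork_cup[where L="[]" and R="[]" and x="?N" and y="?U" and
              P="[([], Cap ?N, [?U]), ([?N], Cross ?U ?U, []), ([?N, ?U], Dot ?U, [])]" and Q="[]"]]) simp_all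
    also have "cg D \<nu> [?U] [?U] \<dots>
      (dl [([], Cap ?N, [?U]), ([?N], Dot ?U, [?U]), ([?N], Cross ?U ?U, []), ([?N], Cross ?U ?U, []), ([], Cup ?N, [?U])] - dl ?W)"
      by (rule cg_step[OF nilhecke_dot_left[where L="[?N]" and R="[]" and i=i and
              P="[([], Cap ?N, [?U])]" and Q="[([?N], Cross ?U ?U, []), ([], Cup ?N, [?U])]"]]) simp_all
    also have "cg D \<nu> [?U] [?U] \<dots> (0 - dl ?W)"
      by (intro cg_diff cg_refl, rule cg_step[OF nilhecke_square[where L="[?N]" and R="[]" and i=i and
              P="[([], Cap ?N, [?U]), ([?N], Dot ?U, [?U])]" and Q="[([], Cup ?N, [?U])]"]]) simp_all
    finally show "cg D \<nu> [?U] [?U] (dl [([?U], Cap ?N, []), ([], Cross ?N ?U, [?U]), ([], Cross ?U ?N, [?U]),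
        ([?U, ?N], Dot ?U, []), ([?U], Cup ?N, [])]) (- dl ?W)" by simp
  qed
  finally have "cg D \<nu> [?U] [?U] ?k (dl ?W)"
    by (simp split del: if_split)
  then show ?thesis
    by (rule cg_sym)
qed

text \<open>A sideways crossing is a rotation of an upward one.\<close>

lemma cross_up_down_rotated:
  assumes "slices_from_to S Q [Up i, Down i]" "slices_from_to [Down i, Up i] P T"
  shows "cg D \<nu> S T (dl (P @ ([], Cross (Up i) (Down i), []) # Q))
    (dl (P @ [([Down i, Up i], Cap (Up i), []), ([Down i], Cross (Up i) (Up i), [Down i]), ([], Cup (Down i), [Up i, Down i])] @ Q))"
proof -
  let ?U = "Up i" and ?N = "Down i"
  have "cg D \<nu> S T (dl (P @ ([], Cross ?U ?N, []) # Q))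
    (dl (P @ [([?N], Cap ?U, [?U]), ([], Cup ?N, [?N, ?U]), ([], Cross ?U ?N, [])] @ Q))"
    by (rule cg_step_sym[OF iso_zigzag_right[where L="[]" and R="[?U]" and x="?N" and P=P and Q="([], Cross ?U ?N, []) # Q"]])
      (use assms in simp_all)
  also have "cg D \<nu> S T \<dots>
    (dl (P @ [([?N], Cap ?U, [?U]), ([?N, ?U], Cross ?U ?N, []), ([], Cup ?N, [?U, ?N])] @ Q))"
    by (rule cg_step[OF iso_commute[where L="[]" and M="[]" and R="[]" and xs="[([], Cup ?N, [])]" and
            ys="[([], Cross ?U ?N, [])]" and ?S1.0="[]" and ?T1.0="[?N, ?U]" and ?S2.0="[?U, ?N]" and ?T2.0="[?N, ?U]" and
            P="P @ [([?N], Cap ?U, [?U])]" and Q=Q]])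
      (use assms in \<open>simp_all add: slices_from_to_append\<close>)
  also have "cg D \<nu> S T \<dots>
    (dl (P @ [([?N, ?U], Cap ?U, []), ([?N], Cross ?U ?U, [?N]), ([], Cup ?N, [?U, ?N])] @ Q))"
    by (rule cg_step_sym[OF iso_pitchfork_cap[where L="[?N]" and R="[]" and x="?U" and y="?U" and
            P=P and Q="([], Cup ?N, [?U, ?N]) # Q"]]) (use assms in simp_all)
  finally show ?thesis .
qed

lemma cross_down_up_rotated:
  assumes "slices_from_to S Q [Down i, Up i]" "slices_from_to [Up i, Down i] P T"
  shows "cg D \<nu> S T (dl (P @ ([], Cross (Down i) (Up i), []) # Q))
    (dl (P @ [([], Cap (Down i), [Up i, Down i]), ([Down i], Cross (Up i) (Up i), [Down i]), ([Down i, Up i], Cup (Up i), [])] @ Q))"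
proof -
  let ?U = "Up i" and ?N = "Down i"
  have "cg D \<nu> S T (dl (P @ ([], Cross ?N ?U, []) # Q))
    (dl (P @ [([?U], Cap ?N, [?N]), ([?U, ?N], Cup ?U, []), ([], Cross ?N ?U, [])] @ Q))"
    by (rule cg_step_sym[OF iso_zigzag_left[where L="[?U]" and R="[]" and x="?N" and P=P and Q="([], Cross ?N ?U, []) # Q"]])
      (use assms in simp_all)
  also have "cg D \<nu> S T \<dots>
    (dl (P @ [([?U], Cap ?N, [?N]), ([], Cross ?N ?U, [?U, ?N]), ([?N, ?U], Cup ?U, [])] @ Q))"
    by (rule cg_step_sym[OF iso_commute[where L="[]" and M="[]" and R="[]" and xs="[([], Cross ?N ?U, [])]" and
            ys="[([], Cup ?U, [])]" and ?S1.0="[?N, ?U]" and ?T1.0="[?U, ?N]" and ?S2.0="[]" and ?T2.0="[?U, ?N]" and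
            P="P @ [([?U], Cap ?N, [?N])]" and Q=Q]])
      (use assms in \<open>simp_all add: slices_from_to_append\<close>)
  also have "cg D \<nu> S T \<dots>
    (dl (P @ [([], Cap ?N, [?U, ?N]), ([?N], Cross ?U ?U, [?N]), ([?N, ?U], Cup ?U, [])] @ Q))"
    by (rule cg_step[OF iso_pitchfork_cap[where L="[]" and R="[?N]" and x="?N" and y="?U" and
            P=P and Q="([?N, ?U], Cup ?U, []) # Q"]]) (use assms in simp_all)
  finally show ?thesis .
qed

text \<open>After rotating the crossing, the cup carries a right curl.\<close>

lemma curled_cup_up:
  assumes "coroot D i \<nu> \<ge> 0"
  shows "cg D \<nu> [] [Down i, Up i] (dl [([], Cross (Up i) (Down i), []), ([], Cup (Up i), [])])
     (- kscal (if coroot D i \<nu> = 0 then bub_param D i \<nu> else 0) * dl [([], Cup (Down i), [])])"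
proof -
  let ?U = "Up i" and ?N = "Down i"
  have "cg D \<nu> [] [?N, ?U] (dl [([], Cross ?U ?N, []), ([], Cup ?U, [])])
    (dl [([?N, ?U], Cap ?U, []), ([?N], Cross ?U ?U, [?N]), ([], Cup ?N, [?U, ?N]), ([], Cup ?U, [])])"
    by (rule cg_step[OF cross_up_down_rotated[where P="[]" and Q="[([], Cup ?U, [])]"]]) simp_all
  also have "cg D \<nu> [] [?N, ?U] \<dots>
    (dl [([?N, ?U], Cap ?U, []), ([?N], Cross ?U ?U, [?N]), ([?N, ?U], Cup ?U, []), ([], Cup ?N, [])])"
    by (rule cg_step[OF iso_commute[where L="[]" and M="[]" and R="[]" and xs="[([], Cup ?N, [])]" and
            ys="[([], Cup ?U, [])]" and ?S1.0="[]" and ?T1.0="[?N, ?U]" and ?S2.0="[]" and ?T2.0="[?U, ?N]" and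
            P="[([?N, ?U], Cap ?U, []), ([?N], Cross ?U ?U, [?N])]" and Q="[]"]]) simp_all
  also have "cg D \<nu> [] [?N, ?U] \<dots>
    (dl [] * (- kscal (if coroot D i \<nu> = 0 then bub_param D i \<nu> else 0)) * dl [([], Cup ?N, [])])"
  proof (rule cg_step[OF cg_context_lin[where P="[]" and Q="[([], Cup ?N, [])]"]])
    show "cg D \<nu> [?N, ?U] [?N, ?U] (dl [([?N, ?U], Cap ?U, []), ([?N], Cross ?U ?U, [?N]), ([?N, ?U], Cup ?U, [])])
        (- kscal (if coroot D i \<nu> = 0 then bub_param D i \<nu> else 0))"
      by (rule cg_step[OF cg_whisker'[OF right_curl[OF assms], where L="[?N]" and R="[]"]])
        (simp_all only: whisker_dl whisker_uminus whisker_kscal wtw_Nil add_0_left append_Nil append_Cons append_Nil2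
          list.map whisker_slice.simps)
  qed (simp_all add: dl_mult)
  finally show ?thesis
    by simp
qed

lemma curled_cup_down:
  assumes "coroot D i \<nu> \<le> 0"
  shows "cg D \<nu> [] [Up i, Down i] (dl [([], Cross (Down i) (Up i), []), ([], Cup (Down i), [])])
     (kscal (if coroot D i \<nu> = 0 then inverse (bub_param D i \<nu>) else 0) * dl [([], Cup (Up i), [])])"
proof -
  let ?U = "Up i" and ?N = "Down i"
  let ?k = "kscal (if coroot D i \<nu> = 0 then inverse (bub_param D i \<nu>) else 0) :: ('i, 'k) lin"
  have "cg D \<nu> [] [?U, ?N] (dl [([], Cross ?N ?U, []), ([], Cup ?N, [])])
    (dl [([], Cap ?N, [?U, ?N]), ([?N], Cross ?U ?U, [?N]), ([?N, ?U], Cup ?U, []), ([], Cup ?N, [])])"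
    by (rule cg_step[OF cross_down_up_rotated[where P="[]" and Q="[([], Cup ?N, [])]"]]) simp_all
  also have "cg D \<nu> [] [?U, ?N] \<dots>
    (dl [([], Cap ?N, [?U, ?N]), ([?N], Cross ?U ?U, [?N]), ([], Cup ?N, [?U, ?N]), ([], Cup ?U, [])])"
    by (rule cg_step_sym[OF iso_commute[where L="[]" and M="[]" and R="[]" and xs="[([], Cup ?N, [])]" and
            ys="[([], Cup ?U, [])]" and ?S1.0="[]" and ?T1.0="[?N, ?U]" and ?S2.0="[]" and ?T2.0="[?U, ?N]" and
            P="[([], Cap ?N, [?U, ?N]), ([?N], Cross ?U ?U, [?N])]" and Q="[]"]]) simp_all
  also have "cg D \<nu> [] [?U, ?N] \<dots> (dl [] * ?k * dl [([], Cup ?U, [])])"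
  proof (rule cg_step[OF cg_context_lin[where P="[]" and Q="[([], Cup ?U, [])]"]])
    have b: "bub_param D i (- simple_root D i + \<nu>) = bub_param D i \<nu>"
      using bub_param_shift[of i "- simple_root D i + \<nu>"] by (simp add: algebra_simps)
    have "cg D (- simple_root D i + \<nu>) [?U] [?U] (dl [([], Cap ?N, [?U]), ([?N], Cross ?U ?U, []), ([], Cup ?N, [?U])]) ?k"
      using left_curl[of i "- simple_root D i + \<nu>", unfolded b] assms by (simp split del: if_split)
    then show "cg D \<nu> [?U, ?N] [?U, ?N] (dl [([], Cap ?N, [?U, ?N]), ([?N], Cross ?U ?U, [?N]), ([], Cup ?N, [?U, ?N])]) ?k"
      by (rule cg_step[OF cg_whisker'[where L="[]" and R="[?N]"]])
        (simp_all only: whisker_dl whisker_kscal wtw_Nil wtw_Cons wt.simps add_0_right append_Nil append_Cons append_Nil2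
          list.map whisker_slice.simps)
  qed (simp_all add: dl_mult)
  finally show ?thesis
    by simp
qed

text \<open>The dot slide of the upward crossing, rotated; its correction term, the identity of two upward
  strings, becomes a cap and a cup.\<close>

lemma dot_slide_up_down:
  assumes "slices_from_to S Q [Up i, Down i]" "slices_from_to [Down i, Up i] P T"
  shows "cg D \<nu> S T (dl (P @ [([], Cross (Up i) (Down i), []), ([], Dot (Up i), [Down i])] @ Q))
     (dl (P @ [([Down i], Dot (Up i), []), ([], Cross (Up i) (Down i), [])] @ Q) -
      dl (P @ [([], Cup (Down i), []), ([], Cap (Up i), [])] @ Q))"
proof -
  let ?U = "Up i" and ?N = "Down i"
  have "cg D \<nu> S T (dl (P @ [([], Cross ?U ?N, []), ([], Dot ?U, [?N])] @ Q))
    (dl (P @ [([?N, ?U], Cap ?U, []), ([?N], Cross ?U ?U, [?N]), ([], Cup ?N, [?U, ?N]), ([], Dot ?U, [?N])] @ Q))"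
    by (rule cg_step[OF cross_up_down_rotated[where P=P and Q="([], Dot ?U, [?N]) # Q"]]) (use assms in simp_all)
  also have "cg D \<nu> S T \<dots>
    (dl (P @ [([?N, ?U], Cap ?U, []), ([?N], Cross ?U ?U, [?N]), ([?N, ?U], Dot ?U, [?N]), ([], Cup ?N, [?U, ?N])] @ Q))"
    by (rule cg_step[OF iso_commute[where L="[]" and M="[]" and R="[?N]" and xs="[([], Cup ?N, [])]" and
            ys="[([], Dot ?U, [])]" and ?S1.0="[]" and ?T1.0="[?N, ?U]" and ?S2.0="[?U]" and ?T2.0="[?U]" and
            P="P @ [([?N, ?U], Cap ?U, []), ([?N], Cross ?U ?U, [?N])]" and Q=Q]])
      (use assms in \<open>simp_all add: slices_from_to_append\<close>)
  also have "cg D \<nu> S T \<dots>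
    (dl (P @ [([?N, ?U], Cap ?U, []), ([?N], Dot ?U, [?U, ?N]), ([?N], Cross ?U ?U, [?N]), ([], Cup ?N, [?U, ?N])] @ Q) -
     dl (P @ [([?N, ?U], Cap ?U, []), ([], Cup ?N, [?U, ?N])] @ Q))"
    by (rule cg_step[OF nilhecke_dot_left[where L="[?N]" and R="[?N]" and i=i and
            P="P @ [([?N, ?U], Cap ?U, [])]" and Q="([], Cup ?N, [?U, ?N]) # Q"]])
      (use assms in \<open>simp_all add: slices_from_to_append\<close>)
  also have "cg D \<nu> S T \<dots>
    (dl (P @ [([?N], Dot ?U, []), ([?N, ?U], Cap ?U, []), ([?N], Cross ?U ?U, [?N]), ([], Cup ?N, [?U, ?N])] @ Q) -
     dl (P @ [([], Cup ?N, []), ([], Cap ?U, [])] @ Q))"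
  proof (rule cg_diff)
    show "cg D \<nu> S T
       (dl (P @ [([?N, ?U], Cap ?U, []), ([?N], Dot ?U, [?U, ?N]), ([?N], Cross ?U ?U, [?N]), ([], Cup ?N, [?U, ?N])] @ Q))
       (dl (P @ [([?N], Dot ?U, []), ([?N, ?U], Cap ?U, []), ([?N], Cross ?U ?U, [?N]), ([], Cup ?N, [?U, ?N])] @ Q))"
      by (rule cg_step_sym[OF iso_commute[where L="[?N]" and M="[]" and R="[]" and xs="[([], Dot ?U, [])]" and
            ys="[([], Cap ?U, [])]" and ?S1.0="[?U]" and ?T1.0="[?U]" and ?S2.0="[?U, ?N]" and ?T2.0="[]" and
            P="P" and Q="([?N], Cross ?U ?U, [?N]) # ([], Cup ?N, [?U, ?N]) # Q"]]) (use assms in simp_all)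
    show "cg D \<nu> S T (dl (P @ [([?N, ?U], Cap ?U, []), ([], Cup ?N, [?U, ?N])] @ Q))
       (dl (P @ [([], Cup ?N, []), ([], Cap ?U, [])] @ Q))"
      by (rule cg_step_sym[OF iso_commute[where L="[]" and M="[]" and R="[]" and xs="[([], Cup ?N, [])]" and
            ys="[([], Cap ?U, [])]" and ?S1.0="[]" and ?T1.0="[?N, ?U]" and ?S2.0="[?U, ?N]" and ?T2.0="[]" and
            P=P and Q=Q]]) (use assms in simp_all)
  qed
  also have "cg D \<nu> S T \<dots>
    (dl (P @ [([?N], Dot ?U, []), ([], Cross ?U ?N, [])] @ Q) - dl (P @ [([], Cup ?N, []), ([], Cap ?U, [])] @ Q))"
    by (rule cg_diff[OF _ cg_refl], rule cg_step_sym[OF cross_up_down_rotated[where P="P @ [([?N], Dot ?U, [])]" and Q=Q]])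
      (use assms in \<open>simp_all add: slices_from_to_append\<close>)
  finally show ?thesis .
qed

end


section \<open>Symmetric functions as series\<close>

subsection \<open>Monomials\<close>

lemma finite_monomials:
  assumes "finite A"
  shows "finite {m :: 'v \<Rightarrow>\<^sub>0 nat. keys m \<subseteq> A \<and> mdeg m \<le> N}"
proof -
  have le: "lookup m v \<le> mdeg m" for m :: "'v \<Rightarrow>\<^sub>0 nat" and v
    by (cases "v \<in> keys m") (auto simp: mdeg_def in_keys_iff intro: member_le_sum)
  have "lookup m v \<le> N" if "mdeg m \<le> N" for m :: "'v \<Rightarrow>\<^sub>0 nat" and v
    using le[of m v] that by simp
  then have "lookup ` {m :: 'v \<Rightarrow>\<^sub>0 nat. keys m \<subseteq> A \<and> mdeg m \<le> N} \<subseteq>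
      {f. \<forall>x. (x \<in> A \<longrightarrow> f x \<in> {..N}) \<and> (x \<notin> A \<longrightarrow> f x = 0)}"
    by (auto simp: in_keys_iff)
  then have "finite (lookup ` {m :: 'v \<Rightarrow>\<^sub>0 nat. keys m \<subseteq> A \<and> mdeg m \<le> N})"
    by (rule finite_subset) (intro finite_set_of_finite_funs assms finite_atMost)
  then show ?thesis
    by (rule finite_imageD) (auto intro!: inj_onI poly_mapping_eqI)
qed

lemma keys_add_nat: "keys (a + b) = keys a \<union> keys (b :: 'v \<Rightarrow>\<^sub>0 nat)"
  by (auto simp: in_keys_iff lookup_add)

lemma finite_splittings: "finite {(a, b). a + b = (m :: 'v \<Rightarrow>\<^sub>0 nat)}"
proof -
  let ?M = "{a. keys a \<subseteq> keys m \<and> mdeg a \<le> mdeg m}"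
  have "{(a, b). a + b = m} \<subseteq> ?M \<times> ?M"
    by (auto simp: keys_add_nat mdeg_add)
  then show ?thesis
    by (rule finite_subset) (simp add: finite_monomials)
qed

lemma lookup_le_add: "r \<le> lookup m v \<Longrightarrow> single v r + (m - single v r) = (m :: 'v \<Rightarrow>\<^sub>0 nat)"
  by (rule poly_mapping_eqI) (auto simp: lookup_add lookup_minus lookup_single when_def)

definition colour_perm :: "('i \<times> nat \<Rightarrow> 'i \<times> nat) \<Rightarrow> bool" where
  "colour_perm \<sigma> \<longleftrightarrow> bij \<sigma> \<and> (\<forall>v. fst (\<sigma> v) = fst v)"

lemma colour_perm_inj: "colour_perm \<sigma> \<Longrightarrow> inj \<sigma>"
  by (simp add: colour_perm_def bij_is_inj)

lemma colour_perm_inv: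
  assumes "colour_perm \<sigma>"
  shows "colour_perm (inv \<sigma>)"
  using assms bij_imp_bij_inv surj_f_inv_f[of \<sigma>] bij_is_surj[of \<sigma>]
  unfolding colour_perm_def by metis

lemma push_inv_push: "colour_perm \<sigma> \<Longrightarrow> push (inv \<sigma>) (push \<sigma> m) = m"
  and push_push_inv: "colour_perm \<sigma> \<Longrightarrow> push \<sigma> (push (inv \<sigma>) m) = m"
  by (simp_all add: push_comp colour_perm_def bij_is_inj bij_is_surj surj_f_inv_f push_id)

lemma SymI_iff:
  "f \<in> SymI \<longleftrightarrow> (\<exists>N. \<forall>m. f m \<noteq> 0 \<longrightarrow> mdeg m \<le> N) \<and> (\<forall>\<sigma>. colour_perm \<sigma> \<longrightarrow> (\<forall>m. f (push \<sigma> m) = f m))"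
  unfolding SymI_def colour_perm_def by blast

lemma SymI_push: "f \<in> SymI \<Longrightarrow> colour_perm \<sigma> \<Longrightarrow> f (push \<sigma> m) = f m"
  by (simp add: SymI_iff)


subsection \<open>The algebra of symmetric functions\<close>

lemma ser_mult_add_right: "ser_mult f (\<lambda>m. g m + h m) = (\<lambda>m. ser_mult f g m + ser_mult f h m)"
  by (simp add: ser_mult_def fun_eq_iff case_prod_unfold distrib_left sum.distrib)

lemma ser_mult_one_left: "ser_mult ser_one f = (f :: ('i, 'k::comm_ring_1) ser)"
proof
  fix m
  have "ser_mult ser_one f m = (\<Sum>(a, b)\<in>{(0 :: 'i mono, m)}. ser_one a * f b)"
    unfolding ser_mult_def
    by (rule sum.mono_neutral_right[OF finite_splittings]) (auto simp: ser_one_def split: if_splits)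
  then show "ser_mult ser_one f m = f m"
    by (simp add: ser_one_def)
qed

lemma ser_mult_degree:
  assumes "\<And>m. f m \<noteq> 0 \<Longrightarrow> mdeg m \<le> M" "\<And>m. g m \<noteq> 0 \<Longrightarrow> mdeg m \<le> N" "ser_mult f g m \<noteq> 0"
  shows "mdeg m \<le> M + N"
proof -
  obtain a b where "a + b = m" "f a * g b \<noteq> 0"
    using assms(3) unfolding ser_mult_def by (force elim: sum.not_neutral_contains_not_neutral)
  then show ?thesis
    using assms(1)[of a] assms(2)[of b] by (force simp: mdeg_add)
qed

lemma SymI_zero: "(\<lambda>_. 0) \<in> SymI"
  by (simp add: SymI_iff)

lemma SymI_one: "ser_one \<in> SymI"
proof -
  have "push \<sigma> m = 0 \<longleftrightarrow> m = 0" if "colour_perm \<sigma>" for \<sigma> and m :: "'a mono"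
    using push_inv_push[OF that, of m] by auto
  then show ?thesis
    by (auto simp: SymI_iff ser_one_def intro: exI[of _ 0])
qed

lemma SymI_add: "f \<in> SymI \<Longrightarrow> g \<in> SymI \<Longrightarrow> (\<lambda>m. f m + g m) \<in> SymI"
  unfolding SymI_iff
proof (elim conjE exE, intro conjI)
  fix M N assume "\<forall>m. f m \<noteq> 0 \<longrightarrow> mdeg m \<le> M" "\<forall>m. g m \<noteq> 0 \<longrightarrow> mdeg m \<le> N"
  then have "\<forall>m. f m + g m \<noteq> 0 \<longrightarrow> mdeg m \<le> M + N"
    by (metis add.right_neutral trans_le_add1 trans_le_add2)
  then show "\<exists>N. \<forall>m. f m + g m \<noteq> 0 \<longrightarrow> mdeg m \<le> N" ..
qed simp

lemma SymI_scale: "f \<in> SymI \<Longrightarrow> (\<lambda>m. c * f m) \<in> SymI"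
  unfolding SymI_iff by (metis mult_zero_right)

lemma SymI_sum:
  "(\<And>x. x \<in> X \<Longrightarrow> F x \<in> SymI) \<Longrightarrow> (\<lambda>m. \<Sum>x\<in>X. F x m) \<in> SymI"
  by (induction X rule: infinite_finite_induct) (auto simp: SymI_zero intro: SymI_add)

lemma SymI_mult:
  assumes "f \<in> SymI" "g \<in> SymI"
  shows "ser_mult f g \<in> SymI"
  unfolding SymI_iff
proof (intro conjI allI impI)
  from assms obtain M N where "\<And>m. f m \<noteq> 0 \<Longrightarrow> mdeg m \<le> M" "\<And>m. g m \<noteq> 0 \<Longrightarrow> mdeg m \<le> N"
    unfolding SymI_iff by blast
  then show "\<exists>N. \<forall>m. ser_mult f g m \<noteq> 0 \<longrightarrow> mdeg m \<le> N"
    using ser_mult_degree[of f M g N] by blast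
next
  fix \<sigma> :: "'a \<times> nat \<Rightarrow> 'a \<times> nat" and m
  assume s: "colour_perm \<sigma>"
  note i = colour_perm_inv[OF s]
  show "ser_mult f g (push \<sigma> m) = ser_mult f g m"
    unfolding ser_mult_def
    by (rule sum.reindex_bij_witness[of _ "map_prod (push \<sigma>) (push \<sigma>)" "map_prod (push (inv \<sigma>)) (push (inv \<sigma>))"])
      (auto simp: push_inv_push[OF s] push_push_inv[OF s] SymI_push[OF assms(1) i] SymI_push[OF assms(2) i]
        simp flip: push_add)
qed

lemma SymI_sym_p: "sym_p i r \<in> SymI"
  unfolding SymI_iff
proof (intro conjI allI impI)
  show "\<exists>N. \<forall>m. sym_p i r m \<noteq> 0 \<longrightarrow> mdeg m \<le> N"
    by (rule exI[of _ r]) (auto simp: sym_p_def)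
next
  fix \<sigma> :: "'a \<times> nat \<Rightarrow> 'a \<times> nat" and m
  have *: "\<exists>j. push \<sigma> m = single (i, j) r" if "colour_perm \<sigma>" "m = single (i, j) r" for \<sigma> m j
  proof -
    have "\<sigma> (i, j) = (i, snd (\<sigma> (i, j)))"
      using that(1) by (simp add: colour_perm_def prod_eq_iff)
    then have "push \<sigma> m = single (i, snd (\<sigma> (i, j))) r"
      unfolding that(2) push_single by (rule arg_cong)
    then show ?thesis ..
  qed
  assume s: "colour_perm \<sigma>"
  show "sym_p i r (push \<sigma> m) = sym_p i r m"
  proof -
    have "(\<exists>j. push \<sigma> m = single (i, j) r) \<longleftrightarrow> (\<exists>j. m = single (i, j) r)"
    proof
      assume "\<exists>j. push \<sigma> m = single (i, j) r"
      then have "\<exists>j. push (inv \<sigma>) (push \<sigma> m) = single (i, j) r"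
        using *[OF colour_perm_inv[OF s]] by blast
      then show "\<exists>j. m = single (i, j) r"
        by (simp only: push_inv_push[OF s])
    qed (use *[OF s] in blast)
    then show ?thesis
      by (simp only: sym_p_def)
  qed
qed

lemma SymI_sym_e: "sym_e i r \<in> SymI"
  unfolding SymI_iff
proof (intro conjI allI impI)
  show "\<exists>N. \<forall>m. sym_e i r m \<noteq> 0 \<longrightarrow> mdeg m \<le> N"
    by (rule exI[of _ r]) (auto simp: sym_e_def)
next
  fix \<sigma> :: "'a \<times> nat \<Rightarrow> 'a \<times> nat" and m :: "'a mono"
  assume s: "colour_perm \<sigma>"
  have k: "keys (push \<sigma> m) = \<sigma> ` keys m"
    by (rule keys_push_inj[OF colour_perm_inj[OF s]])
  have f: "fst (\<sigma> v) = fst v" for v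
    using s unfolding colour_perm_def by blast
  have "surj \<sigma>"
    using s by (simp add: colour_perm_def bij_is_surj)
  then have "(\<forall>v. lookup (push \<sigma> m) v \<le> 1) \<longleftrightarrow> (\<forall>w. lookup (push \<sigma> m) (\<sigma> w) \<le> 1)"
    by (metis surj_f_inv_f)
  then have "(\<forall>v. lookup (push \<sigma> m) v \<le> 1) \<longleftrightarrow> (\<forall>v. lookup m v \<le> 1)"
    by (simp add: lookup_push_inj[OF colour_perm_inj[OF s]])
  moreover have "keys (push \<sigma> m) \<subseteq> {i} \<times> UNIV \<longleftrightarrow> keys m \<subseteq> {i} \<times> UNIV"
  proof -
    have "A \<subseteq> {i} \<times> UNIV \<longleftrightarrow> (\<forall>v\<in>A. fst v = i)" for A :: "('a \<times> nat) set"
      by (auto simp: mem_Times_iff)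
    then show ?thesis
      by (simp add: k f)
  qed
  ultimately show "sym_e i r (push \<sigma> m) = sym_e i r m"
    by (simp add: sym_e_def mdeg_push)
qed

lemma sym_e_0: "sym_e i 0 = ser_one"
proof -
  have "mdeg m = 0 \<longleftrightarrow> m = 0" for m :: "'a mono"
    by (auto simp: mdeg_def in_keys_iff intro!: poly_mapping_eqI)
  then show ?thesis
    by (auto simp: sym_e_def ser_one_def fun_eq_iff)
qed


subsection \<open>Multiplication by power sums\<close>

text \<open>In a product with a power sum, the power comes from one of the variables of the monomial.\<close>

lemma sym_p_mult:
  fixes g :: "('i, 'k::comm_ring_1) ser"
  assumes "r \<ge> 1"
  shows "ser_mult (sym_p i r) g (m :: 'i mono) = (\<Sum>v | v \<in> keys m \<and> fst v = i \<and> r \<le> lookup m v. g (m - single v r))"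
proof -
  let ?V = "{v \<in> keys m. fst v = i \<and> r \<le> lookup m v}"
  let ?f = "\<lambda>v. (single v r, m - single v r)"
  have inj: "inj_on ?f ?V"
    using assms by (auto intro!: inj_onI dest: arg_cong[where f=keys])
  have "ser_mult (sym_p i r) g m = (\<Sum>(a, b)\<in>?f ` ?V. sym_p i r a * g b)"
    unfolding ser_mult_def
  proof (rule sum.mono_neutral_right[OF finite_splittings])
    show "?f ` ?V \<subseteq> {(a, b). a + b = m}"
      by (auto simp: lookup_le_add)
    show "\<forall>x\<in>{(a, b). a + b = m} - ?f ` ?V. (case x of (a, b) \<Rightarrow> sym_p i r a * g b) = 0"
    proof
      fix x assume x: "x \<in> {(a, b). a + b = m} - ?f ` ?V"
      obtain a b where ab: "x = (a, b)" by (cases x)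
      have "sym_p i r a = (0 :: 'k)"
      proof (rule ccontr)
        assume "sym_p i r a \<noteq> (0 :: 'k)"
        then obtain j where a: "a = single (i, j) r"
          by (auto simp: sym_p_def split: if_splits)
        then have "r \<le> lookup m (i, j)" "b = m - single (i, j) r"
          using x ab by (auto simp: lookup_add)
        then have "x \<in> ?f ` ?V"
          using assms a ab by (intro image_eqI[of _ _ "(i, j)"]) (auto simp: in_keys_iff)
        then show False using x by simp
      qed
      then show "(case x of (a, b) \<Rightarrow> sym_p i r a * g b) = 0"
        by (simp add: ab)
    qed
  qed
  also have "\<dots> = (\<Sum>v\<in>?V. sym_p i r (single v r) * g (m - single v r))"
    by (simp add: sum.reindex[OF inj])
  also have "\<dots> = (\<Sum>v\<in>?V. g (m - single v r))"
    by (intro sum.cong refl) (auto simp: sym_p_def)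
  finally show ?thesis .
qed

definition signed_e :: "'i \<Rightarrow> nat \<Rightarrow> ('i, 'k::comm_ring_1) ser" where
  "signed_e i r = (\<lambda>m. (-1) ^ r * sym_e i r m)"

lemma SymI_signed_e: "signed_e i r \<in> SymI"
  unfolding signed_e_def by (intro SymI_scale SymI_sym_e)

text \<open>Newton's identity is compared coefficientwise.  Removing a power of a variable \<open>v\<close> from a monomial
  can only leave a squarefree one if all the other exponents are at most one.  If \<open>v\<close> has exponent at
  least two, there are two ways to do this, by removing all of \<open>v\<close> or all but one, and they have
  opposite signs.  So only squarefree monomials survive, each counted once for each of its variables.\<close>

lemma newton_identity:
  "of_nat n * signed_e i n m = - (\<Sum>j=1..n. ser_mult (sym_p i j) (signed_e i (n - j)) m :: 'k::comm_ring_1)"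
proof (cases "keys m \<subseteq> {i} \<times> UNIV \<and> mdeg m = n")
  case False
  have "signed_e i (n - j) (m - single v j) = (0 :: 'k)"
    if "j \<in> {1..n}" "v \<in> keys m" "fst v = i" "j \<le> lookup m v" for j v
  proof -
    have m: "single v j + (m - single v j) = m"
      by (rule lookup_le_add) fact
    have "keys m = {v} \<union> keys (m - single v j)" "mdeg m = j + mdeg (m - single v j)"
      using that by (subst m[symmetric], simp add: keys_add_nat mdeg_add del: lookup_le_add)+
    then show ?thesis
      using False that by (auto simp: signed_e_def sym_e_def mem_Times_iff)
  qed
  moreover have "signed_e i n m = (0 :: 'k)"
    using False by (auto simp: signed_e_def sym_e_def)
  ultimately show ?thesis
    by (simp add: sym_p_mult)
next
  case True
  then have kc: "fst v = i" if "v \<in> keys m" for v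
    using that by auto
  have n: "n = (\<Sum>v\<in>keys m. lookup m v)"
    using True by (simp add: mdeg_def)
  have le: "lookup m v \<le> n" for v
    unfolding n by (cases "v \<in> keys m") (auto simp: in_keys_iff intro: member_le_sum)
  let ?rest = "\<lambda>v. \<forall>w. w \<noteq> v \<longrightarrow> lookup m w \<le> 1"
  let ?sq = "\<forall>w. lookup m w \<le> 1"
  have e: "signed_e i (n - j) (m - single v j) = (if ?rest v \<and> lookup m v \<le> Suc j then (-1) ^ (n - j) else 0 :: 'k)"
    if "j \<in> {1..n}" "v \<in> keys m" "j \<le> lookup m v" for j v
  proof -
    have m: "single v j + (m - single v j) = m"
      by (rule lookup_le_add) fact
    have "keys m = {v} \<union> keys (m - single v j)" "mdeg m = j + mdeg (m - single v j)"
      using that by (subst m[symmetric], simp add: keys_add_nat mdeg_add)+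
    moreover have "(\<forall>w. lookup (m - single v j) w \<le> 1) \<longleftrightarrow> ?rest v \<and> lookup m v \<le> Suc j"
    proof -
      have "lookup (m - single v j) w = (if w = v then lookup m v - j else lookup m w)" for w
        by (simp add: lookup_minus lookup_single when_def)
      moreover have "lookup m v - j \<le> 1 \<longleftrightarrow> lookup m v \<le> Suc j"
        by linarith
      ultimately show ?thesis
        by metis
    qed
    ultimately show ?thesis
      using True by (auto simp: signed_e_def sym_e_def)
  qed
  have inner: "(\<Sum>j\<in>{j \<in> {1..n}. j \<le> lookup m v}. signed_e i (n - j) (m - single v j)) =
      (if ?sq then - ((-1) ^ n) else 0 :: 'k)" if v: "v \<in> keys m" for v
  proof -
    have "(\<Sum>j\<in>{j \<in> {1..n}. j \<le> lookup m v}. signed_e i (n - j) (m - single v j)) =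
        (\<Sum>j\<in>{1..lookup m v}. if ?rest v \<and> lookup m v \<le> Suc j then (-1) ^ (n - j) else 0 :: 'k)"
      using v le[of v] by (intro sum.cong) (auto simp: e)
    also have "\<dots> = (if ?sq then - ((-1) ^ n) else 0)"
    proof (cases "lookup m v = 1")
      case True
      then have r: "?rest v \<longleftrightarrow> ?sq" by (metis order_refl)
      have pw: "(-1 :: 'k) ^ (n - 1) = - ((-1) ^ n)"
        using le[of v] True by (cases n) auto
      have "(\<Sum>j\<in>{1..lookup m v}. if ?rest v \<and> lookup m v \<le> Suc j then (-1) ^ (n - j) else 0 :: 'k) =
          (if ?rest v then (-1) ^ (n - 1) else 0)"
      proof -
        have "(\<Sum>j\<in>{1..1::nat}. if P \<and> 1 \<le> Suc j then f j else 0 :: 'k) = (if P then f 1 else 0)" for P f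
          by simp
        then show ?thesis
          unfolding True .
      qed
      then show ?thesis
        unfolding r pw .
    next
      case False
      then have "lookup m v \<ge> 2"
        using v by (simp add: in_keys_iff)
      then obtain t where t: "lookup m v = Suc (Suc t)"
        by (metis add_2_eq_Suc le_Suc_ex)
      have "(\<Sum>j\<in>{1..lookup m v}. if ?rest v \<and> lookup m v \<le> Suc j then (-1) ^ (n - j) else 0 :: 'k) =
          (\<Sum>j\<in>{Suc t, Suc (Suc t)}. if ?rest v then (-1) ^ (n - j) else 0)"
        unfolding t by (rule sum.mono_neutral_cong_right) auto
      also have "\<dots> = 0"
        using le[of v] t by (simp add: Suc_diff_Suc power_Suc[symmetric] del: power_Suc)
          (metis Suc_diff_Suc Suc_le_lessD mult_minus1 power_Suc add.left_inverse)
      finally have "(\<Sum>j\<in>{1..lookup m v}. if ?rest v \<and> lookup m v \<le> Suc j then (-1) ^ (n - j) else 0 :: 'k) = 0" .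
      moreover have "\<not> ?sq"
      proof
        assume ?sq
        then have "lookup m v \<le> 1" ..
        with t show False by simp
      qed
      ultimately show ?thesis
        by (simp only: if_False)
    qed
    finally show ?thesis .
  qed
  have "(\<Sum>j=1..n. ser_mult (sym_p i j) (signed_e i (n - j)) m) =
      (\<Sum>j=1..n. \<Sum>v\<in>{v \<in> keys m. j \<le> lookup m v}. signed_e i (n - j) (m - single v j) :: 'k)"
    by (intro sum.cong refl) (auto simp: sym_p_mult dest: kc intro!: sum.cong)
  also have "\<dots> = (\<Sum>v\<in>keys m. \<Sum>j\<in>{j \<in> {1..n}. j \<le> lookup m v}. signed_e i (n - j) (m - single v j))"
    by (rule sum.swap_restrict) auto
  also have "\<dots> = of_nat (card (keys m)) * (if ?sq then - ((-1) ^ n) else 0)"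
    by (rule trans[OF sum.cong[OF refl inner]]) (simp_all only: sum_constant)
  also have "\<dots> = - (of_nat n * signed_e i n m)"
  proof (cases ?sq)
    case sq: True
    then have "lookup m v = 1" if "v \<in> keys m" for v
      using that by (metis in_keys_iff le_antisym less_one not_le)
    then have "card (keys m) = n"
      unfolding n by simp
    then show ?thesis
      using sq True by (simp add: signed_e_def sym_e_def)
  qed (auto simp: signed_e_def sym_e_def)
  finally show ?thesis by simp
qed


subsection \<open>Generation by power sums\<close>

definition exponents :: "'i mono \<Rightarrow> ('i \<times> nat) multiset" where
  "exponents m = image_mset (\<lambda>v. (fst v, lookup m v)) (mset_set (keys m))"

lemma size_exponents [simp]: "size (exponents m) = card (keys m)"
  by (simp add: exponents_def)

text \<open>Two monomials with the same exponents differ by a permutation of the variables that respects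
  the colours.\<close>

lemma SymI_eq_if_exponents_eq:
  assumes "f \<in> SymI" "exponents m = exponents m'"
  shows "f m = f m'"
proof -
  let ?A = "keys m \<union> keys m'"
  let ?g = "\<lambda>m v. (fst v, lookup m v)"
  \<comment> \<open>Both monomials are compared on a common set of variables, where exponents can be zero: how
      many variables of each colour have exponent zero is determined by the other ones.\<close>
  have split: "image_mset (?g m) (mset_set ?A) =
      exponents m + image_mset (\<lambda>i. (i, 0)) (image_mset fst (mset_set ?A) - image_mset fst (exponents m))"
    if "keys m \<subseteq> ?A" for m :: "'a mono"
  proof -
    have A: "mset_set ?A = mset_set (keys m) + mset_set (?A - keys m)"
      using that by (subst mset_set_Union[symmetric]) (auto simp: Un_absorb1)
    have "image_mset fst (exponents m) = image_mset fst (mset_set (keys m))"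
      by (simp add: exponents_def multiset.map_comp comp_def)
    then have "image_mset fst (mset_set ?A) - image_mset fst (exponents m) = image_mset fst (mset_set (?A - keys m))"
      by (simp add: A)
    moreover have "image_mset (?g m) (mset_set (?A - keys m)) =
        image_mset (\<lambda>i. (i, 0)) (image_mset fst (mset_set (?A - keys m)))"
      unfolding multiset.map_comp by (intro image_mset_cong) (auto simp: in_keys_iff)
    ultimately show ?thesis
      by (simp add: A exponents_def)
  qed
  have "image_mset (?g m) (mset_set ?A) = image_mset (?g m') (mset_set ?A)"
    by (simp add: split assms(2))
  then obtain p where p: "p permutes ?A" "\<forall>v\<in>?A. ?g m v = ?g m' (p v)"
    by (rule image_mset_eq_implies_permutes[rotated]) auto
  have c: "colour_perm p"
    using p unfolding colour_perm_def by (metis permutes_bij permutes_not_in prod.inject)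
  have "push p m = m'"
  proof (rule poly_mapping_eqI)
    fix w
    obtain v where w: "w = p v"
      using p(1) by (metis permutes_inverses(1))
    have "lookup (push p m) (p v) = lookup m v"
      by (rule lookup_push_inj[OF colour_perm_inj[OF c]])
    also have "\<dots> = lookup m' (p v)"
    proof (cases "v \<in> ?A")
      case False
      then show ?thesis
        using permutes_not_in[OF p(1) False] by (auto simp: in_keys_iff)
    qed (use p(2) in auto)
    finally show "lookup (push p m) w = lookup m' w"
      by (simp add: w)
  qed
  then show ?thesis
    using SymI_push[OF assms(1) c, of m] by simp
qed

fun p_product :: "('i \<times> nat) list \<Rightarrow> ('i, 'k::comm_ring_1) ser" where
  "p_product [] = ser_one"
| "p_product ((i, r) # xs) = ser_mult (sym_p i r) (p_product xs)"

lemma SymI_p_product: "p_product xs \<in> SymI"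
  by (induction xs rule: p_product.induct) (auto intro: SymI_one SymI_mult SymI_sym_p)

lemma keys_subtract:
  assumes "r \<le> lookup m v" "v \<in> keys m"
  shows "keys (m - single v r) = (if lookup m v = r then keys m - {v} else keys (m :: 'v \<Rightarrow>\<^sub>0 nat))"
  using assms by (auto simp: in_keys_iff lookup_minus lookup_single when_def split: if_splits)

lemma exponents_subtract:
  assumes "v \<in> keys m" "lookup m v = r"
  shows "exponents m = add_mset (fst v, r) (exponents (m - single v r))"
proof -
  have "exponents (m - single v r) = image_mset (\<lambda>w. (fst w, lookup m w)) (mset_set (keys m - {v}))"
    unfolding exponents_def keys_subtract[OF eq_imp_le[OF assms(2)[symmetric]] assms(1)] using assms(2)
    by (auto intro!: image_mset_cong simp: lookup_minus lookup_single when_def)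
  moreover have "mset_set (keys m) = add_mset v (mset_set (keys m - {v}))"
    using assms(1) by (simp add: mset_set.remove)
  ultimately show ?thesis
    using assms(2) by (simp add: exponents_def)
qed

text \<open>Multiplying out, each variable of a monomial with at least as many variables as there are
  factors must come from its own factor.\<close>

lemma p_product_leading:
  assumes "\<forall>(i, r)\<in>set xs. r \<ge> 1" "length xs \<le> card (keys m)"
  shows "\<exists>c. p_product xs m = (of_nat c :: 'k::comm_ring_1) \<and> (c > 0 \<longleftrightarrow> exponents m = mset xs)"
  using assms
proof (induction xs arbitrary: m rule: p_product.induct)
  case 1
  have "exponents m = {#} \<longleftrightarrow> m = 0"
    by (auto simp: exponents_def mset_set_empty_iff)
  then show ?case
    by (intro exI[of _ "if m = 0 then 1 else 0"]) (auto simp: ser_one_def)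
next
  case (2 i r xs)
  let ?V = "{v \<in> keys m. fst v = i \<and> r \<le> lookup m v}"
  have len: "length xs < card (keys m)"
    using 2(3) by simp
  have "\<exists>c. p_product xs (m - single v r) = (of_nat c :: 'k) \<and> (c > 0 \<longleftrightarrow> exponents (m - single v r) = mset xs)"
    if "v \<in> ?V" for v
    using that 2(2) len by (intro 2(1)) (auto simp: keys_subtract)
  then have "\<forall>v\<in>?V. \<exists>c. p_product xs (m - single v r) = (of_nat c :: 'k) \<and>
      (c > 0 \<longleftrightarrow> exponents (m - single v r) = mset xs)"
    by blast
  from bchoice[OF this] obtain c where c: "\<forall>v\<in>?V. p_product xs (m - single v r) = (of_nat (c v) :: 'k) \<and>
      (c v > 0 \<longleftrightarrow> exponents (m - single v r) = mset xs)" ..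
  have "p_product ((i, r) # xs) m = (\<Sum>v\<in>?V. p_product xs (m - single v r) :: 'k)"
    using 2(2) by (simp add: sym_p_mult)
  also have "\<dots> = (\<Sum>v\<in>?V. of_nat (c v))"
    using c by (intro sum.cong) auto
  finally have "p_product ((i, r) # xs) m = (of_nat (\<Sum>v\<in>?V. c v) :: 'k)"
    by simp
  moreover have "(\<Sum>v\<in>?V. c v) > 0 \<longleftrightarrow> (\<exists>v\<in>?V. exponents (m - single v r) = mset xs)"
  proof -
    have "sum c ?V = 0 \<longleftrightarrow> (\<forall>v\<in>?V. c v = 0)"
      by (rule sum_eq_0_iff) simp
    then have "sum c ?V > 0 \<longleftrightarrow> \<not> (\<forall>v\<in>?V. c v = 0)"
      by linarith
    also have "\<dots> \<longleftrightarrow> (\<exists>v\<in>?V. c v > 0)"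
      by auto
    also have "\<dots> \<longleftrightarrow> (\<exists>v\<in>?V. exponents (m - single v r) = mset xs)"
      using c by blast
    finally show ?thesis .
  qed
  moreover have "(\<exists>v\<in>?V. exponents (m - single v r) = mset xs) \<longleftrightarrow> exponents m = add_mset (i, r) (mset xs)"
  proof
    assume "\<exists>v\<in>?V. exponents (m - single v r) = mset xs"
    then obtain v where v: "v \<in> ?V" "exponents (m - single v r) = mset xs" by blast
    have "card (keys (m - single v r)) = length xs"
      using arg_cong[OF v(2), of size] by simp
    then have "lookup m v = r"
      using v(1) len by (auto simp: keys_subtract split: if_splits)
    then show "exponents m = add_mset (i, r) (mset xs)"
      using exponents_subtract[of v m r] v by auto
  next
    assume e: "exponents m = add_mset (i, r) (mset xs)"
    then have "(i, r) \<in># exponents m" by simp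
    then obtain v where v: "v \<in> keys m" "fst v = i" "lookup m v = r"
      by (auto simp: exponents_def)
    then show "\<exists>v\<in>?V. exponents (m - single v r) = mset xs"
      using exponents_subtract[of v m r] e by (intro bexI[of _ v]) auto
  qed
  ultimately show ?case
    by (intro exI[of _ "\<Sum>v\<in>?V. c v"]) simp
qed

text \<open>The power sums generate: among the monomials of \<open>f\<close> take those with the largest number of
  variables.  There are finitely many lists of exponents for them, and subtracting suitable multiples
  of the corresponding products of power sums removes them all, because such a product contains no
  monomial with that many variables and other exponents.  The coefficient to divide by is a positive integer.\<close>

lemma SymI_induct [consumes 1, case_names one p add scale]:
  fixes f :: "('i::finite, 'k::field_char_0) ser"
  assumes "f \<in> SymI"
    and one: "P ser_one"
    and p: "\<And>i r g. r \<ge> 1 \<Longrightarrow> g \<in> SymI \<Longrightarrow> P g \<Longrightarrow> P (ser_mult (sym_p i r) g)"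
    and add: "\<And>f g. f \<in> SymI \<Longrightarrow> g \<in> SymI \<Longrightarrow> P f \<Longrightarrow> P g \<Longrightarrow> P (\<lambda>m. f m + g m)"
    and scale: "\<And>c f. f \<in> SymI \<Longrightarrow> P f \<Longrightarrow> P (\<lambda>m. c * f m)"
  shows "P f"
proof -
  have pp: "P (p_product xs)" if "\<forall>(i, r)\<in>set xs. r \<ge> 1" for xs
    using that by (induction xs rule: p_product.induct) (auto intro: one p SymI_p_product)
  have zero: "P (\<lambda>_. 0)"
    using scale[OF SymI_one one, of 0] by simp
  have sum: "P (\<lambda>m. \<Sum>x\<in>X. F x m)" if "\<And>x. x \<in> X \<Longrightarrow> F x \<in> SymI \<and> P (F x)" for X :: "('i \<times> nat) multiset set" and F
    using that by (induction X rule: infinite_finite_induct) (auto simp: zero intro!: add SymI_sum)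
  have "P f" if "f \<in> SymI" "\<forall>m. f m \<noteq> 0 \<longrightarrow> card (keys m) < l" for l f
    using that
  proof (induction l arbitrary: f)
    case 0
    then have "f = (\<lambda>_. 0)" by auto
    then show ?case using zero by simp
  next
    case (Suc l)
    obtain N where N: "\<And>m. f m \<noteq> 0 \<Longrightarrow> mdeg m \<le> N"
      using Suc.prems(1) unfolding SymI_iff by blast
    define T where "T = {exponents m | m. f m \<noteq> 0 \<and> card (keys m) = l}"
    have T_pos: "r \<ge> 1 \<and> r \<le> N" if nz: "f m \<noteq> 0" and mem: "(i, r) \<in># exponents m" for i r m
    proof -
      obtain v where v: "v \<in> keys m" "r = lookup m v"
        using mem by (auto simp: exponents_def)
      have "lookup m v \<le> mdeg m"
        unfolding mdeg_def by (rule member_le_sum) (use v in auto)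
      then show ?thesis
        using v N[OF nz] by (auto simp: in_keys_iff)
    qed
    have "T \<subseteq> mset ` {xs. set xs \<subseteq> UNIV \<times> {..N} \<and> length xs \<le> l}"
    proof
      fix t assume "t \<in> T"
      then obtain m where m: "t = exponents m" "f m \<noteq> 0" "card (keys m) = l"
        by (auto simp: T_def)
      obtain xs where xs: "mset xs = t"
        using ex_mset by blast
      have "length xs = l"
        using arg_cong[OF xs, of size] m by simp
      moreover have "set xs \<subseteq> UNIV \<times> {..N}"
        using T_pos[OF m(2)] by (auto simp: m(1) simp flip: xs set_mset_mset) (metis m(1) xs)
      ultimately show "t \<in> mset ` {xs. set xs \<subseteq> UNIV \<times> {..N} \<and> length xs \<le> l}"
        using xs by blast
    qed
    then have finT: "finite T"
      by (rule finite_subset) (intro finite_imageI finite_lists_length_le finite_cartesian_product finite finite_atMost)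
    have "\<forall>t\<in>T. \<exists>xs m. mset xs = t \<and> exponents m = t \<and> f m \<noteq> 0 \<and> card (keys m) = l"
    proof
      fix t assume "t \<in> T"
      moreover obtain xs where "mset xs = t"
        using ex_mset by blast
      ultimately show "\<exists>xs m. mset xs = t \<and> exponents m = t \<and> f m \<noteq> 0 \<and> card (keys m) = l"
        unfolding T_def by blast
    qed
    then obtain xs mon where xm: "\<And>t. t \<in> T \<Longrightarrow> mset (xs t) = t \<and> exponents (mon t) = t \<and> f (mon t) \<noteq> 0 \<and> card (keys (mon t)) = l"
      by metis
    have len: "length (xs t) = l" and pos: "\<forall>(i, r)\<in>set (xs t). r \<ge> 1" if "t \<in> T" for t
    proof -
      show "length (xs t) = l"
        using xm[OF that] by (metis size_exponents size_mset)
      show "\<forall>(i, r)\<in>set (xs t). r \<ge> 1"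
        using xm[OF that] T_pos[of "mon t"] by (metis (mono_tags, lifting) case_prodI2 set_mset_mset)
    qed
    have lead: "p_product (xs t) m \<noteq> (0 :: 'k) \<longleftrightarrow> exponents m = t" if tT: "t \<in> T" and lm: "l \<le> card (keys m)" for t m
    proof -
      obtain c where "p_product (xs t) m = (of_nat c :: 'k)" "c > 0 \<longleftrightarrow> exponents m = mset (xs t)"
        using p_product_leading[OF pos[OF tT], of m, where 'k='k] len[OF tT] lm by auto
      then show ?thesis
        using xm[OF tT] by auto
    qed
    \<comment> \<open>the multiple of a product of power sums that has the leading coefficient of f\<close>
    define F where "F t = (\<lambda>m. f (mon t) / p_product (xs t) (mon t) * p_product (xs t) m)" for t
    have F: "F t \<in> SymI \<and> P (F t)" if "t \<in> T" for t
      unfolding F_def by (intro conjI SymI_scale SymI_p_product scale pp pos that)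
    define h where "h = (\<lambda>m. f m + (-1) * (\<Sum>t\<in>T. F t m))"
    have h: "h \<in> SymI"
      unfolding h_def using Suc.prems(1) F by (intro SymI_add SymI_scale SymI_sum) auto
    have "h m = 0" if "l \<le> card (keys m)" for m
    proof -
      have F0: "F t m = 0" if "t \<in> T" "exponents m \<noteq> t" for t
        using lead[OF that(1) \<open>l \<le> card (keys m)\<close>] that(2) by (simp add: F_def)
      show ?thesis
      proof (cases "exponents m \<in> T")
        case True
        have "(\<Sum>t\<in>T. F t m) = F (exponents m) m"
          using F0 True finT by (subst sum.mono_neutral_right[of T "{exponents m}"]) auto
        also have "\<dots> = f m"
        proof -
          let ?t = "exponents m"
          have e: "exponents m = exponents (mon ?t)"
            using xm[OF True] by simp
          have "p_product (xs ?t) m = (p_product (xs ?t) (mon ?t) :: 'k)" "f m = f (mon ?t)"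
            by (rule SymI_eq_if_exponents_eq[OF _ e]; intro SymI_p_product Suc.prems(1))+
          then show ?thesis
            using lead[OF True that] by (simp add: F_def)
        qed
        finally show ?thesis
          by (simp add: h_def)
      next
        case False
        then have "f m = 0"
          using that Suc.prems(2) by (force simp: T_def)
        moreover have "(\<Sum>t\<in>T. F t m) = 0"
          using F0 False by (intro sum.neutral) auto
        ultimately show ?thesis
          by (simp add: h_def)
      qed
    qed
    then have "P h"
      using h by (intro Suc.IH) (auto simp: not_less[symmetric])
    then have "P (\<lambda>m. h m + (\<Sum>t\<in>T. F t m))"
      using h F by (intro add SymI_sum sum) auto
    then show ?case
      by (simp add: h_def)
  qed
  moreover obtain N where "\<And>m. f m \<noteq> 0 \<Longrightarrow> mdeg m \<le> N"
    using assms(1) unfolding SymI_iff by blast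
  moreover have "card (keys m) \<le> mdeg m" for m :: "'i mono"
    unfolding mdeg_def by (rule order_trans[OF _ sum_bounded_below[of _ 1]]) (auto simp: in_keys_iff Suc_le_eq)
  ultimately show ?thesis
    using assms(1) by (meson le_imp_less_Suc order_trans)
qed


subsection \<open>Evaluation at the roots of a red string\<close>

definition red_vars :: "('i, 'r, 'k) stendhal_data \<Rightarrow> nat \<Rightarrow> ('i \<times> nat) set" where
  "red_vars D k = {(i, j). j < red_mult D k i}"

lemma finite_red_vars: "finite (red_vars (D :: ('i::finite, 'r, 'k) stendhal_data) k)"
proof -
  have "red_vars D k = (SIGMA i:UNIV. {..<red_mult D k i})"
    by (auto simp: red_vars_def)
  then show ?thesis by simp
qed

definition red_monos :: "('i, 'r, 'k) stendhal_data \<Rightarrow> nat \<Rightarrow> nat \<Rightarrow> 'i mono set" where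
  "red_monos D k N = {m. keys m \<subseteq> red_vars D k \<and> mdeg m \<le> N}"

lemma finite_red_monos: "finite (red_monos (D :: ('i::finite, 'r, 'k) stendhal_data) k N)"
  unfolding red_monos_def by (rule finite_monomials[OF finite_red_vars])

abbreviation zmono :: "nat \<Rightarrow> 'i mono \<Rightarrow> 'i zvar \<Rightarrow>\<^sub>0 nat" where
  "zmono k \<equiv> push (\<lambda>(i, j). (k, i, j))"

lemma eval_red_eq_sum:
  fixes D :: "('i::finite, 'r, 'k::comm_ring_1) stendhal_data"
  assumes "\<And>m. f m \<noteq> 0 \<Longrightarrow> mdeg m \<le> N"
  shows "eval_red D k f = (\<Sum>m\<in>red_monos D k N. single (zmono k m) (f m))"
  unfolding eval_red_def
proof (rule sum.mono_neutral_left[OF finite_red_monos])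
  have "(\<forall>(i, j)\<in>keys m. j < red_mult D k i) \<longleftrightarrow> keys m \<subseteq> red_vars D k" for m :: "'i mono"
    by (auto simp: red_vars_def)
  then show "{m. f m \<noteq> 0 \<and> (\<forall>(i, j)\<in>keys m. j < red_mult D k i)} \<subseteq> red_monos D k N"
    "\<forall>m\<in>red_monos D k N - {m. f m \<noteq> 0 \<and> (\<forall>(i, j)\<in>keys m. j < red_mult D k i)}. single (zmono k m) (f m) = 0"
    using assms by (auto simp: red_monos_def)
qed

lemma SymI_bounds:
  assumes "f \<in> SymI" "g \<in> SymI"
  obtains N where "\<And>m. f m \<noteq> 0 \<Longrightarrow> mdeg m \<le> N" "\<And>m. g m \<noteq> 0 \<Longrightarrow> mdeg m \<le> N"
proof -
  obtain M N where "\<And>m. f m \<noteq> 0 \<Longrightarrow> mdeg m \<le> M" "\<And>m. g m \<noteq> 0 \<Longrightarrow> mdeg m \<le> N"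
    using assms unfolding SymI_iff by blast
  then show ?thesis
    by (intro that[of "max M N"]) (auto simp: le_max_iff_disj)
qed

lemma eval_red_zero [simp]: "eval_red D k (\<lambda>_. 0) = 0"
  by (simp add: eval_red_def)

lemma eval_red_add:
  fixes D :: "('i::finite, 'r, 'k::comm_ring_1) stendhal_data"
  assumes "f \<in> SymI" "g \<in> SymI"
  shows "eval_red D k (\<lambda>m. f m + g m) = eval_red D k f + eval_red D k g"
proof -
  obtain N where N: "\<And>m. f m \<noteq> 0 \<Longrightarrow> mdeg m \<le> N" "\<And>m. g m \<noteq> 0 \<Longrightarrow> mdeg m \<le> N"
    using SymI_bounds[OF assms] by blast
  then have "f m + g m \<noteq> 0 \<Longrightarrow> mdeg m \<le> N" for m
    by (metis add.right_neutral)
  then show ?thesis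
    using N by (simp add: eval_red_eq_sum[of _ N] single_add sum.distrib)
qed

lemma eval_red_scale:
  fixes D :: "('i::finite, 'r, 'k::comm_ring_1) stendhal_data"
  assumes "f \<in> SymI"
  shows "eval_red D k (\<lambda>m. c * f m) = single 0 c * eval_red D k f"
proof -
  obtain N where N: "\<And>m. f m \<noteq> 0 \<Longrightarrow> mdeg m \<le> N"
    using SymI_bounds[OF assms assms] by blast
  then have "c * f m \<noteq> 0 \<Longrightarrow> mdeg m \<le> N" for m
    by (metis mult_zero_right)
  then show ?thesis
    using N by (simp add: eval_red_eq_sum[of _ N] sum_distrib_left mult_single)
qed

lemma eval_red_one:
  fixes D :: "('i::finite, 'r, 'k::comm_ring_1) stendhal_data"
  shows "eval_red D k ser_one = 1"
proof -
  have "red_monos D k 0 = {0}"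
    by (auto simp: red_monos_def mdeg_def in_keys_iff intro!: poly_mapping_eqI)
  then show ?thesis
    by (subst eval_red_eq_sum[of _ 0]) (auto simp: ser_one_def split: if_splits)
qed

lemma single_sum: "single a (\<Sum>x\<in>X. f x) = (\<Sum>x\<in>X. single a (f x))"
  by (induction X rule: infinite_finite_induct) (auto simp: single_add)

lemma eval_red_mult:
  fixes D :: "('i::finite, 'r, 'k::comm_ring_1) stendhal_data"
  assumes "f \<in> SymI" "g \<in> SymI"
  shows "eval_red D k (ser_mult f g) = eval_red D k f * eval_red D k g"
proof -
  obtain N where N: "\<And>m. f m \<noteq> 0 \<Longrightarrow> mdeg m \<le> N" "\<And>m. g m \<noteq> 0 \<Longrightarrow> mdeg m \<le> N"
    using SymI_bounds[OF assms] by blast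
  let ?M = "red_monos D k" and ?S = "\<lambda>m. {(a, b). a + b = (m :: 'i mono)}"
  have "eval_red D k (ser_mult f g) = (\<Sum>m\<in>?M (N + N). \<Sum>(a, b)\<in>?S m. single (zmono k m) (f a * g b))"
    using ser_mult_degree[of f N g N] N
    by (simp add: eval_red_eq_sum[of _ "N + N"] ser_mult_def case_prod_unfold)
      (simp add: single_sum)
  also have "\<dots> = (\<Sum>(m, a, b)\<in>(SIGMA m:?M (N + N). ?S m). single (zmono k m) (f a * g b))"
    by (subst sum.Sigma) (auto simp: finite_red_monos finite_splittings intro!: sum.cong)
  also have "\<dots> = (\<Sum>(m, a, b)\<in>(\<lambda>(a, b). (a + b, a, b)) ` (?M N \<times> ?M N). single (zmono k m) (f a * g b))"
  proof (rule sum.mono_neutral_right)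
    show "finite (SIGMA m:?M (N + N). ?S m)"
      by (intro finite_SigmaI finite_red_monos finite_splittings)
    show "(\<lambda>(a, b). (a + b, a, b)) ` (?M N \<times> ?M N) \<subseteq> (SIGMA m:?M (N + N). ?S m)"
      by (auto simp: red_monos_def keys_add_nat mdeg_add)
    show "\<forall>x\<in>(SIGMA m:?M (N + N). ?S m) - (\<lambda>(a, b). (a + b, a, b)) ` (?M N \<times> ?M N).
        (case x of (m, a, b) \<Rightarrow> single (zmono k m) (f a * g b)) = 0"
    proof (clarify, rule ccontr)
      fix a b assume *: "a + b \<in> ?M (N + N)" "(a + b, a, b) \<notin> (\<lambda>(a, b). (a + b, a, b)) ` (?M N \<times> ?M N)"
        "single (zmono k (a + b)) (f a * g b) \<noteq> 0"
      then have "f a \<noteq> 0" "g b \<noteq> 0" by auto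
      then have "(a, b) \<in> ?M N \<times> ?M N"
        using *(1) N by (auto simp: red_monos_def keys_add_nat)
      then show False using *(2) by force
    qed
  qed
  also have "\<dots> = (\<Sum>(a, b)\<in>?M N \<times> ?M N. single (zmono k (a + b)) (f a * g b))"
    by (subst sum.reindex) (auto intro!: inj_onI sum.cong)
  also have "\<dots> = eval_red D k f * eval_red D k g"
    using N by (simp add: eval_red_eq_sum[of _ N] sum_product sum.cartesian_product mult_single push_add)
  finally show ?thesis .
qed

text \<open>A permutation of the indeterminates of the red string lifts to a permutation of all the variables
  that fixes those which evaluate to zero, and \<open>f\<close> is invariant under it.\<close>

lemma eval_red_in_Alam:
  fixes D :: "('i::finite, 'r, 'k::comm_ring_1) stendhal_data"
  assumes f: "f \<in> SymI" and k: "1 \<le> k" "k \<le> num_red D"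
  shows "eval_red D k f \<in> Alam D"
  unfolding Alam_iff
proof (intro conjI ballI allI impI)
  obtain N where N: "\<And>m. f m \<noteq> 0 \<Longrightarrow> mdeg m \<le> N"
    using SymI_bounds[OF f f] by blast
  let ?i = "\<lambda>(i, j). (k, i, j) :: 'i zvar"
  have eval: "eval_red D k f = (\<Sum>m\<in>red_monos D k N. single (zmono k m) (f m))"
    by (rule eval_red_eq_sum) (rule N)
  have zv: "?i v \<in> zvars D \<longleftrightarrow> v \<in> red_vars D k" for v
    using k by (cases v) (auto simp: zvars_def red_vars_def)
  fix M assume "M \<in> keys (eval_red D k f)"
  then have "M \<in> keys (\<Sum>m\<in>red_monos D k N. single (zmono k m) (f m))"
    by (simp only: eval)
  then obtain m where "m \<in> red_monos D k N" "M \<in> keys (single (zmono k m) (f m))"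
    using keys_sum[of "\<lambda>m. single (zmono k m) (f m)" "red_monos D k N"] by blast
  then have "M = zmono k m" "keys m \<subseteq> red_vars D k"
    by (auto simp: red_monos_def split: if_splits)
  then show "keys M \<subseteq> zvars D"
    using keys_push_subset[of ?i m] zv by blast
next
  obtain N where N: "\<And>m. f m \<noteq> 0 \<Longrightarrow> mdeg m \<le> N"
    using SymI_bounds[OF f f] by blast
  let ?i = "\<lambda>(i, j). (k, i, j) :: 'i zvar"
  have eval: "eval_red D k f = (\<Sum>m\<in>red_monos D k N. single (zmono k m) (f m))"
    by (rule eval_red_eq_sum) (rule N)
  have zv: "?i v \<in> zvars D \<longleftrightarrow> v \<in> red_vars D k" for v
    using k by (cases v) (auto simp: zvars_def red_vars_def)
  fix \<sigma> assume \<sigma>: "zsym D \<sigma>"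
  define \<tau> where "\<tau> v = (if v \<in> red_vars D k then snd (\<sigma> (?i v)) else v)" for v
  have \<sigma>\<tau>: "\<sigma> (?i v) = ?i (\<tau> v)" if "v \<in> red_vars D k" for v
  proof -
    have i: "?i w = (k, w)" for w
      by (cases w) simp
    have "fst (\<sigma> (k, v)) = fst (k, v)"
      using \<sigma> unfolding zsym_def by blast
    then show ?thesis
      using that unfolding i \<tau>_def by (simp add: prod_eq_iff)
  qed
  have in_vars: "\<tau> v \<in> red_vars D k" if "v \<in> red_vars D k" for v
  proof -
    have "\<sigma> (?i v) \<in> zvars D"
      using \<sigma> that unfolding zsym_def by (metis permutes_in_image zv)
    then show ?thesis
      unfolding \<sigma>\<tau>[OF that] zv .
  qed
  have inj: "inj_on \<tau> (red_vars D k)"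
  proof (rule inj_onI)
    fix v w assume "v \<in> red_vars D k" "w \<in> red_vars D k" "\<tau> v = \<tau> w"
    then have "\<sigma> (?i v) = \<sigma> (?i w)"
      using \<sigma>\<tau>[of v] \<sigma>\<tau>[of w] by simp
    then show "v = w"
      using injD[OF zsym_inj[OF \<sigma>]] by (cases v; cases w) auto
  qed
  moreover have "\<tau> ` red_vars D k = red_vars D k"
    by (rule endo_inj_surj[OF finite_red_vars _ inj]) (use in_vars in blast)
  ultimately have "bij_betw \<tau> (red_vars D k) (red_vars D k)"
    by (simp add: bij_betw_def)
  then have "\<tau> permutes red_vars D k"
    by (rule bij_imp_permutes) (simp add: \<tau>_def)
  then have perm: "colour_perm \<tau>"
    unfolding colour_perm_def using \<sigma> by (auto simp: permutes_bij \<tau>_def zsym_def)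
  have keys_\<tau>: "keys (push \<tau> m) \<subseteq> red_vars D k \<longleftrightarrow> keys m \<subseteq> red_vars D k" for m :: "'i mono"
    unfolding keys_push_inj[OF colour_perm_inj[OF perm]]
    using in_vars by (auto simp: \<tau>_def split: if_splits)
  have "push (push \<sigma>) (eval_red D k f) = (\<Sum>m\<in>red_monos D k N. single (push \<sigma> (zmono k m)) (f m))"
    unfolding eval push_sum push_single ..
  also have "\<dots> = (\<Sum>m\<in>red_monos D k N. single (zmono k (push \<tau> m)) (f (push \<tau> m)))"
  proof (intro sum.cong refl)
    fix m assume "m \<in> red_monos D k N"
    then have "push \<sigma> (zmono k m) = zmono k (push \<tau> m)"
      unfolding push_comp by (intro push_cong) (use \<sigma>\<tau> in \<open>auto simp: red_monos_def\<close>)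
    then show "single (push \<sigma> (zmono k m)) (f m) = single (zmono k (push \<tau> m)) (f (push \<tau> m))"
      by (simp add: SymI_push[OF f perm])
  qed
  also have "\<dots> = (\<Sum>m\<in>red_monos D k N. single (zmono k m) (f m))"
  proof (rule sum.reindex_bij_witness[of _ "push (inv \<tau>)" "push \<tau>"])
    fix m assume m: "m \<in> red_monos D k N"
    show "push \<tau> m \<in> red_monos D k N"
      using m by (simp add: red_monos_def keys_\<tau> mdeg_push)
    show "push (inv \<tau>) m \<in> red_monos D k N"
      using m keys_\<tau>[of "push (inv \<tau>) m"] by (simp add: red_monos_def push_push_inv[OF perm] mdeg_push)
  qed (simp_all add: push_inv_push[OF perm] push_push_inv[OF perm])
  finally show "push (push \<sigma>) (eval_red D k f) = eval_red D k f"
    by (simp add: eval)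
qed


section \<open>Evaluation of figure eights\<close>

context stendhal
begin

lemma bubble_hom: "is_black x \<Longrightarrow> bubble x d \<in> hom D [] []"
proof (cases "d \<ge> 0")
  case True
  assume x: "is_black x"
  have "bubble x (int (nat d)) \<in> hom D [] []"
    unfolding bubble_nat bubble_dl_def by (rule hom_dl) (simp add: x)
  then show ?thesis using True by simp
next
  case False
  assume "is_black x"
  then show ?thesis
    using False by (simp add: bubble_def sl_dl hom_dl)
qed

lemma cw_hom: "cw D \<nu> i r \<in> hom D [] []" and ccw_hom: "ccw D \<nu> i r \<in> hom D [] []"
  by (simp_all add: cw_def ccw_def bubble_hom)

text \<open>The dots on the curl are moved one by one through the crossing to the other side.  Each time the
  correction term splits off a clockwise circle, and in the end a curl without dots remains.\<close>

lemma curl_with_dots: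
  assumes "coroot D i \<nu> \<ge> 0"
  shows "cg D \<nu> [] [] (dl (([], Cap (Down i), []) # replicate n ([Down i], Dot (Up i), []) @
      ([], Cross (Up i) (Down i), []) # replicate m ([], Dot (Up i), [Down i]) @ [([], Cup (Up i), [])]))
    (- (bubble (Down i) (int (n + m)) * kscal (if coroot D i \<nu> = 0 then bub_param D i \<nu> else 0)) -
     (\<Sum>j<m. bubble (Down i) (int (n + j)) * bubble (Up i) (int m - 1 - int j)))"
proof (induction m arbitrary: n)
  case 0
  let ?U = "Up i" and ?N = "Down i"
  let ?k = "kscal (if coroot D i \<nu> = 0 then bub_param D i \<nu> else 0) :: ('i, 'k) lin"
  let ?P = "([], Cap ?N, []) # replicate n ([?N], Dot ?U, [])"
  have "cg D \<nu> [] [] (dl (?P @ [([], Cross ?U ?N, []), ([], Cup ?U, [])])) (dl ?P * (- ?k * dl [([], Cup ?N, [])]) * dl [])"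
    by (rule cg_step[OF cg_context_lin[OF curled_cup_up[OF assms], where P="?P" and Q="[]"]]) (simp_all add: dl_mult)
  also have "\<dots> = - ?k * dl (?P @ [([], Cup ?N, [])])"
    unfolding dl_mult[symmetric] dl_Nil mult_1_right mult.assoc[symmetric] mult_minus_left mult_minus_right kscal_commute[of "dl ?P"] ..
  also have "cg D \<nu> [] [] \<dots> (- ?k * bubble ?N (int n))"
  proof (rule cg_left[of _ _ "[]"])
    show "cg D \<nu> [] [] (dl (?P @ [([], Cup ?N, [])])) (bubble ?N (int n))"
      unfolding bubble_nat bubble_dl_def
      by (rule cg_step_sym[OF iso_dots_cup[where L="[]" and R="[]" and x="?N" and n=n and P="[([], Cap ?N, [])]" and Q="[]"]])
        simp_all
  qed simp
  finally show ?case
    by (simp add: kscal_commute[of "bubble ?N (int n)"])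
next
  case (Suc m)
  let ?U = "Up i" and ?N = "Down i"
  let ?k = "kscal (if coroot D i \<nu> = 0 then bub_param D i \<nu> else 0) :: ('i, 'k) lin"
  let ?P = "\<lambda>n. ([], Cap ?N, []) # replicate n ([?N], Dot ?U, [])"
  let ?Q = "replicate m ([], Dot ?U, [?N]) @ [([], Cup ?U, [])]"
  have "cg D \<nu> [] [] (dl (?P n @ ([], Cross ?U ?N, []) # replicate (Suc m) ([], Dot ?U, [?N]) @ [([], Cup ?U, [])]))
    (dl (?P n @ [([?N], Dot ?U, []), ([], Cross ?U ?N, [])] @ ?Q) - dl (?P n @ [([], Cup ?N, []), ([], Cap ?U, [])] @ ?Q))"
    by (rule cg_step[OF dot_slide_up_down[where P="?P n" and Q="?Q" and i=i]]) simp_all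
  also have "dl (?P n @ [([?N], Dot ?U, []), ([], Cross ?U ?N, [])] @ ?Q) =
      dl (?P (Suc n) @ ([], Cross ?U ?N, []) # ?Q)"
    by (simp flip: replicate_append_same)
  also have "dl (?P n @ [([], Cup ?N, []), ([], Cap ?U, [])] @ ?Q) = dl (?P n @ [([], Cup ?N, [])]) * bubble ?U (int m)"
    by (simp add: bubble_nat bubble_dl_def dl_mult)
  also have "cg D \<nu> [] [] (dl (?P (Suc n) @ ([], Cross ?U ?N, []) # ?Q) - dl (?P n @ [([], Cup ?N, [])]) * bubble ?U (int m))
     (- (bubble ?N (int (Suc n + m)) * ?k) - (\<Sum>j<m. bubble ?N (int (Suc n + j)) * bubble ?U (int m - 1 - int j)) -
      bubble ?N (int n) * bubble ?U (int m))"
  proof (rule cg_diff)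
    show "cg D \<nu> [] [] (dl (?P n @ [([], Cup ?N, [])]) * bubble ?U (int m)) (bubble ?N (int n) * bubble ?U (int m))"
    proof (rule cg_right[of _ _ _ "[]"])
      show "cg D \<nu> [] [] (dl (?P n @ [([], Cup ?N, [])])) (bubble ?N (int n))"
        unfolding bubble_nat bubble_dl_def
        by (rule cg_step_sym[OF iso_dots_cup[where L="[]" and R="[]" and x="?N" and n=n and P="[([], Cap ?N, [])]" and Q="[]"]])
          simp_all
    qed (simp add: bubble_hom)
    show "cg D \<nu> [] [] (dl (?P (Suc n) @ ([], Cross ?U ?N, []) # ?Q))
       (- (bubble ?N (int (Suc n + m)) * ?k) - (\<Sum>j<m. bubble ?N (int (Suc n + j)) * bubble ?U (int m - 1 - int j)))"
      by (rule cg_step[OF Suc[of "Suc n"]]) simp_all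
  qed
  also have "\<dots> = - (bubble ?N (int (n + Suc m)) * ?k) -
      (\<Sum>j<Suc m. bubble ?N (int (n + j)) * bubble ?U (int (Suc m) - 1 - int j))"
    unfolding sum.lessThan_Suc_shift by (simp add: algebra_simps split del: if_split)
  finally show ?case
    by (simp split del: if_split)
qed

text \<open>The contribution of the curl without dots is the missing term of the sum, in which the clockwise
  bubble is the fake one with \<open>-1\<close> dots.\<close>

lemma fig8_eval_nonneg:
  assumes "coroot D i \<nu> \<ge> 0"
  shows "cg D \<nu> [] [] (dl (fig8 i m)) (- (\<Sum>j\<le>m. bubble (Down i) (int j) * bubble (Up i) (int m - 1 - int j)))"
proof -
  let ?k = "kscal (if coroot D i \<nu> = 0 then bub_param D i \<nu> else 0) :: ('i, 'k) lin"
  let ?S = "\<Sum>j<m. bubble (Down i) (int j) * bubble (Up i) (int m - 1 - int j) :: ('i, 'k) lin"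
  have fake: "cg D \<nu> [] [] ?k (bubble (Up i) (- 1))"
    using cg_sym[OF cw_lowest[of "- coroot D i \<nu>" \<nu> i]] assms
    by (simp add: cw_def split del: if_split)
  have "cg D \<nu> [] [] (dl (fig8 i m)) (- (bubble (Down i) (int m) * ?k) - ?S)"
    by (rule cg_trans[OF fig8_as_cross_up_down], rule cg_step[OF curl_with_dots[OF assms, of 0 m]]) simp_all
  also have "cg D \<nu> [] [] \<dots> (- (bubble (Down i) (int m) * bubble (Up i) (- 1)) - ?S)"
    by (intro cg_diff cg_uminus cg_refl cg_left[of _ _ "[]"] fake) (simp add: bubble_hom)
  also have "\<dots> = - (\<Sum>j\<le>m. bubble (Down i) (int j) * bubble (Up i) (int m - 1 - int j))"
    by (simp add: lessThan_Suc_atMost[symmetric])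
  finally show ?thesis .
qed

lemma fig8_eval_nonpos:
  assumes "coroot D i \<nu> \<le> 0"
  shows "cg D \<nu> [] [] (dl (fig8 i m)) (bubble (Down i) (- 1) * bubble (Up i) (int m))"
proof -
  let ?k = "kscal (if coroot D i \<nu> = 0 then inverse (bub_param D i \<nu>) else 0) :: ('i, 'k) lin"
  let ?P = "([], Cap (Up i), []) # replicate m ([], Dot (Up i), [Down i])"
  have fake: "cg D \<nu> [] [] ?k (bubble (Down i) (- 1))"
    using cg_sym[OF ccw_lowest[of "coroot D i \<nu>" \<nu> i]] assms
    by (simp add: ccw_def split del: if_split)
  have "cg D \<nu> [] [] (dl (fig8 i m)) (dl (?P @ [([], Cross (Down i) (Up i), []), ([], Cup (Down i), [])]))"
    by (rule cg_step[OF fig8_as_cross_down_up]) simp_all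
  also have "cg D \<nu> [] [] \<dots> (dl ?P * (?k * dl [([], Cup (Up i), [])]) * dl [])"
    by (rule cg_step[OF cg_context_lin[OF curled_cup_down[OF assms], where P="?P" and Q="[]"]]) (simp_all add: dl_mult)
  also have "\<dots> = ?k * bubble (Up i) (int m)"
    unfolding dl_Nil mult_1_right mult.assoc[symmetric] kscal_commute[of "dl ?P"]
    by (simp add: mult.assoc dl_mult bubble_nat bubble_dl_def split del: if_split)
  also have "cg D \<nu> [] [] \<dots> (bubble (Down i) (- 1) * bubble (Up i) (int m))"
    by (intro cg_right[of _ _ _ "[]"] fake) (simp add: bubble_hom)
  finally show ?thesis .
qed

end


unbundle fps_syntax

section \<open>Bubbles on the two sides of a red string\<close>

lemma eval_red_sym_e_zero:
  assumes "p > red_mult D k i"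
  shows "eval_red D k (sym_e i p) = 0"
  unfolding eval_red_def
proof (rule sum.neutral, clarify)
  fix m :: "'a mono"
  assume m: "\<forall>(i, j)\<in>keys m. j < red_mult D k i" "sym_e i p m \<noteq> (0 :: 'c)"
  then have e: "keys m \<subseteq> {i} \<times> UNIV" "\<forall>v. lookup m v \<le> 1" "mdeg m = p"
    by (auto simp: sym_e_def split: if_splits)
  have "keys m \<subseteq> {i} \<times> {..<red_mult D k i}"
    using m(1) e(1) by auto
  then have "card (keys m) \<le> card ({i} \<times> {..<red_mult D k i})"
    by (rule card_mono[rotated]) simp
  moreover have "sum (lookup m) (keys m) \<le> (\<Sum>v\<in>keys m. 1)"
    by (rule sum_mono) (use e(2) in blast)
  then have "p \<le> card (keys m)"
    by (simp add: mdeg_def flip: e(3))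
  ultimately show "single (zmono k m) (sym_e i p m) = 0"
    using assms by (simp add: card_cartesian_product)
qed

context stendhal
begin

lemma coroot_red_weight:
  assumes "1 \<le> k" "k \<le> num_red D"
  shows "coroot D i (red_weight D k) = int (red_mult D k i)"
proof -
  have "red_weight D k \<in> dominant D"
    using datum assms by (simp add: stendhal_datum_def)
  then obtain a :: "'i \<Rightarrow> nat" where a: "red_weight D k = (\<Sum>j\<in>UNIV. frag_cmul (int (a j)) (fund_weight D j))"
    unfolding dominant_def by blast
  have fund: "coroot D i (fund_weight D j) = (if i = j then 1 else 0)" for j
    using datum by (simp add: stendhal_datum_def)
  have sum: "coroot D i (\<Sum>j\<in>X. h j) = (\<Sum>j\<in>X. coroot D i (h j))" for X and h :: "'i \<Rightarrow> 'r weight"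
    by (induction X rule: infinite_finite_induct) (auto simp: coroot_add)
  have "coroot D i (frag_cmul (int n) x) = int n * coroot D i x" for n x
    by (induction n) (auto simp: frag_cmul_distrib coroot_add algebra_simps)
  then have "coroot D i (red_weight D k) = int (a i)"
    unfolding a by (simp add: sum fund if_distrib cong: if_cong)
  then show ?thesis
    by (simp add: red_mult_def)
qed

end

text \<open>The endomorphisms of one red string, with a region of weight \<open>\<mu>\<close> on its right.\<close>

locale red_string = stendhal D for D :: "('i::finite, 'r, 'k::field_char_0) stendhal_data" +
  fixes k :: nat and \<mu> :: "'r weight"
  assumes k: "1 \<le> k" "k \<le> num_red D"
begin

abbreviation rcong :: "('i, 'k) lin \<Rightarrow> ('i, 'k) lin \<Rightarrow> bool" (infix \<open>\<approx>\<close> 50) where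
  "u \<approx> v \<equiv> cg D \<mu> [Red k] [Red k] u v"

abbreviation rend :: "('i, 'k) lin set" where
  "rend \<equiv> hom D [Red k] [Red k]"

abbreviation \<nu> :: "'r weight" where
  "\<nu> \<equiv> red_weight D k + \<mu>"

definition lft :: "('i, 'k) lin \<Rightarrow> ('i, 'k) lin" where
  "lft u = whisker [] u [Red k]"

definition rgt :: "('i, 'k) lin \<Rightarrow> ('i, 'k) lin" where
  "rgt u = whisker [Red k] u []"

lemma lft_cg: "cg D \<nu> [] [] u v \<Longrightarrow> lft u \<approx> lft v"
  unfolding lft_def by (rule cg_whisker') (auto simp: wtw_Cons)

lemma rgt_cg: "cg D \<mu> [] [] u v \<Longrightarrow> rgt u \<approx> rgt v"
  unfolding rgt_def by (rule cg_whisker') auto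

lemma lft_hom: "u \<in> hom D [] [] \<Longrightarrow> lft u \<in> rend"
  unfolding lft_def by (rule hom_whisker') auto

lemma rgt_hom: "u \<in> hom D [] [] \<Longrightarrow> rgt u \<in> rend"
  unfolding rgt_def by (rule hom_whisker') auto

lemma lft_zero [simp]: "lft 0 = 0" and rgt_zero [simp]: "rgt 0 = 0"
  by (simp_all add: lft_def rgt_def)

lemma lft_mult: "lft (u * v) = lft u * lft v"
  and lft_kscal [simp]: "lft (kscal c) = kscal c"
  and lft_uminus: "lft (- u) = - lft u"
  and lft_add: "lft (u + v) = lft u + lft v"
  and lft_sum: "lft (sum f X) = (\<Sum>x\<in>X. lft (f x))"
  by (simp_all add: lft_def whisker_mult whisker_uminus whisker_add whisker_sum)

lemma rgt_mult: "rgt (u * v) = rgt u * rgt v"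
  and rgt_kscal [simp]: "rgt (kscal c) = kscal c"
  and rgt_add: "rgt (u + v) = rgt u + rgt v"
  and rgt_sum: "rgt (sum f X) = (\<Sum>x\<in>X. rgt (f x))"
  by (simp_all add: rgt_def whisker_mult whisker_add whisker_sum)

lemma lft_rgt_commute:
  assumes "u \<in> hom D [] []" "v \<in> hom D [] []"
  shows "lft u * rgt v \<approx> rgt v * lft u"
  using cg_commute[OF assms, of \<mu> "[Red k]"] by (simp add: lft_def rgt_def)

lemma sym_e_Alam: "eval_red D k (sym_e i p) \<in> Alam D"
  by (rule eval_red_in_Alam[OF SymI_sym_e k])


subsection \<open>Power series with coefficients in the endomorphisms of a red string\<close>

definition fhom :: "('i, 'k) lin fps \<Rightarrow> bool" where
  "fhom P \<longleftrightarrow> (\<forall>n. P $ n \<in> rend)"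

definition fcong :: "('i, 'k) lin fps \<Rightarrow> ('i, 'k) lin fps \<Rightarrow> bool" (infix \<open>\<sim>\<close> 50) where
  "P \<sim> Q \<longleftrightarrow> (\<forall>n. P $ n \<approx> Q $ n)"

lemma fhom_mult: "fhom P \<Longrightarrow> fhom Q \<Longrightarrow> fhom (P * Q)"
  by (auto simp: fhom_def fps_mult_nth intro!: hom_sum hom_mult[of _ _ "[Red k]"])

lemma fcong_refl [simp]: "P \<sim> P"
  and fcong_sym: "P \<sim> Q \<Longrightarrow> Q \<sim> P"
  and fcong_trans [trans]: "P \<sim> Q \<Longrightarrow> Q \<sim> S \<Longrightarrow> P \<sim> S"
  and fcong_eq_trans [trans]: "P \<sim> Q \<Longrightarrow> Q = S \<Longrightarrow> P \<sim> S"
  and eq_fcong_trans [trans]: "P = Q \<Longrightarrow> Q \<sim> S \<Longrightarrow> P \<sim> S"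
  by (auto simp: fcong_def intro: cg_sym cg_trans)

lemma fcong_left: "fhom S \<Longrightarrow> P \<sim> Q \<Longrightarrow> S * P \<sim> S * Q"
  by (auto simp: fcong_def fps_mult_nth fhom_def intro!: cg_sum cg_left[of _ _ "[Red k]"])

lemma fcong_right: "fhom S \<Longrightarrow> P \<sim> Q \<Longrightarrow> P * S \<sim> Q * S"
  by (auto simp: fcong_def fps_mult_nth fhom_def intro!: cg_sum cg_right[of _ _ _ "[Red k]"])

lemma fcong_commute:
  assumes "\<And>i j. P $ i * Q $ j \<approx> Q $ j * P $ i"
  shows "P * Q \<sim> Q * P"
  unfolding fcong_def
proof
  fix n
  have "(P * Q) $ n \<approx> (\<Sum>i=0..n. Q $ (n - i) * P $ i)"
    unfolding fps_mult_nth by (intro cg_sum assms)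
  also have "\<dots> = (\<Sum>i=0..n. Q $ i * P $ (n - i))"
    by (rule sum.reindex_bij_witness[of _ "\<lambda>i. n - i" "\<lambda>i. n - i"]) auto
  finally show "(P * Q) $ n \<approx> (Q * P) $ n"
    by (simp add: fps_mult_nth)
qed

end

subsection \<open>The generating series of bubbles\<close>

locale red_string_colour = red_string D k \<mu> for D :: "('i::finite, 'r, 'k::field_char_0) stendhal_data" and k \<mu> +
  fixes i :: 'i
begin

definition ccw_left :: "('i, 'k) lin fps" where "ccw_left = Abs_fps (\<lambda>n. lft (ccw D \<nu> i (int n)))"
definition cw_left :: "('i, 'k) lin fps" where "cw_left = Abs_fps (\<lambda>n. lft (cw D \<nu> i (int n)))"
definition ccw_right :: "('i, 'k) lin fps" where "ccw_right = Abs_fps (\<lambda>n. rgt (ccw D \<mu> i (int n)))"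
definition cw_right :: "('i, 'k) lin fps" where "cw_right = Abs_fps (\<lambda>n. rgt (cw D \<mu> i (int n)))"

abbreviation acoef :: "nat \<Rightarrow> ('i, 'k) zpoly" where
  "acoef p \<equiv> (-1) ^ p * eval_red D k (sym_e i p)"

definition red_poly :: "('i, 'k) lin fps" where "red_poly = Abs_fps (\<lambda>p. scal (acoef p))"

abbreviation lam :: nat where "lam \<equiv> red_mult D k i"
abbreviation \<alpha> :: int where "\<alpha> \<equiv> coroot D i \<nu>"
abbreviation \<beta> :: int where "\<beta> \<equiv> - coroot D i \<mu>"

lemma alpha_plus_beta: "\<alpha> + \<beta> = int lam"
  by (simp add: coroot_add coroot_red_weight[OF k])

lemma acoef_Alam: "acoef p \<in> Alam D"
  by (simp add: sym_e_Alam)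

lemma acoef_zero: "p > lam \<Longrightarrow> acoef p = 0"
  by (simp add: eval_red_sym_e_zero)

lemma fhom_bubbles: "fhom ccw_left" "fhom cw_left" "fhom ccw_right" "fhom cw_right" "fhom red_poly"
  by (simp_all add: fhom_def ccw_left_def cw_left_def ccw_right_def cw_right_def red_poly_def
      lft_hom rgt_hom cw_hom ccw_hom acoef_Alam)

lemma ccw_left_cw_left: "ccw_left * cw_left \<sim> 1"
  unfolding fcong_def
proof
  fix n
  have "(ccw_left * cw_left) $ n = lft (\<Sum>r\<le>n. ccw D \<nu> i (int r) * cw D \<nu> i (int (n - r)))"
    by (simp add: fps_mult_nth ccw_left_def cw_left_def lft_sum lft_mult atLeast0AtMost)
  also have "\<dots> \<approx> lft (if n = 0 then 1 else 0)"
    by (rule lft_cg, rule cg_black0, rule black_rel.grassmannian)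
  also have "\<dots> = 1 $ n"
    by (simp add: lft_def)
  finally show "(ccw_left * cw_left) $ n \<approx> 1 $ n" .
qed

lemma ccw_right_cw_right: "ccw_right * cw_right \<sim> 1"
  unfolding fcong_def
proof
  fix n
  have "(ccw_right * cw_right) $ n = rgt (\<Sum>r\<le>n. ccw D \<mu> i (int r) * cw D \<mu> i (int (n - r)))"
    by (simp add: fps_mult_nth ccw_right_def cw_right_def rgt_sum rgt_mult atLeast0AtMost)
  also have "\<dots> \<approx> rgt (if n = 0 then 1 else 0)"
    by (rule rgt_cg, rule cg_black0, rule black_rel.grassmannian)
  also have "\<dots> = 1 $ n"
    by (simp add: rgt_def)
  finally show "(ccw_right * cw_right) $ n \<approx> 1 $ n" .
qed

lemma cw_left_ccw_left: "cw_left * ccw_left \<sim> 1"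
proof -
  have "cw_left * ccw_left \<sim> ccw_left * cw_left"
    by (rule fcong_commute)
      (auto simp: ccw_left_def cw_left_def lft_mult[symmetric] intro!: lft_cg cg_commute_closed cw_hom ccw_hom)
  then show ?thesis
    using ccw_left_cw_left fcong_trans by blast
qed

lemma cw_right_ccw_right: "cw_right * ccw_right \<sim> 1"
proof -
  have "cw_right * ccw_right \<sim> ccw_right * cw_right"
    by (rule fcong_commute)
      (auto simp: ccw_right_def cw_right_def rgt_mult[symmetric] intro!: rgt_cg cg_commute_closed cw_hom ccw_hom)
  then show ?thesis
    using ccw_right_cw_right fcong_trans by blast
qed


text \<open>The upper summation limit \<open>M\<close> that comes from a relation can be replaced by the one of a product
  of power series: surplus terms contain a bubble of negative degree or a coefficient of \<open>red_poly\<close>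
  beyond its degree.\<close>

lemma convolution_up_to:
  assumes neg: "\<And>z. z < 0 \<Longrightarrow> X z \<approx> 0" and M: "\<And>p. M < p \<Longrightarrow> p \<le> n \<Longrightarrow> acoef p = 0"
  shows "(\<Sum>p\<le>M. scal (acoef p) * X (int n - int p)) \<approx> (\<Sum>p=0..n. scal (acoef p) * X (int (n - p)))"
proof -
  have "(\<Sum>p\<le>M. scal (acoef p) * X (int n - int p)) \<approx>
      (\<Sum>p\<le>M. if p \<le> n then scal (acoef p) * X (int (n - p)) else 0)"
  proof (rule cg_sum)
    fix p
    show "scal (acoef p) * X (int n - int p) \<approx> (if p \<le> n then scal (acoef p) * X (int (n - p)) else 0)"
      using cg_scal[OF acoef_Alam[of p] neg[of "int n - int p"]] by (auto simp: of_nat_diff)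
  qed
  also have "\<dots> = (\<Sum>p\<in>{..M} \<inter> {0..n}. scal (acoef p) * X (int (n - p)))"
    by (subst sum.inter_restrict) (auto intro: sum.cong)
  also have "\<dots> = (\<Sum>p=0..n. scal (acoef p) * X (int (n - p)))"
    by (rule sum.mono_neutral_left) (auto simp: M not_le)
  finally show ?thesis .
qed

lemma ccw_right_neg: "z < 0 \<Longrightarrow> rgt (ccw D \<mu> i z) \<approx> 0"
  and cw_left_neg: "z < 0 \<Longrightarrow> lft (cw D \<nu> i z) \<approx> 0"
  using rgt_cg[OF ccw_lowest, of z i] lft_cg[OF cw_lowest, of z i] by simp_all

text \<open>In these degrees the bubble on the left has a nonnegative number of dots, so it can be pulled
  through the red string; fake bubbles cannot be moved in this way.\<close>

lemma ccw_left_real: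
  assumes "int n > \<alpha>"
  shows "ccw_left $ n \<approx> (red_poly * ccw_right) $ n"
proof -
  define m where "m = nat (int n - \<alpha> - 1)"
  have m: "int m = - \<alpha> - 1 + int n"
    using assms by (simp add: m_def)
  have "ccw_left $ n = whisker [] (bubble (Down i) (int m)) [Red k]"
    unfolding ccw_left_def m by (simp add: lft_def ccw_def)
  also have "\<dots> \<approx> (\<Sum>p\<le>lam. scal (acoef p) * whisker [Red k] (bubble (Down i) (int (m + (lam - p)))) [])"
    by (rule ccw_bubble_through_red)
  also have "\<dots> = (\<Sum>p\<le>lam. scal (acoef p) * rgt (ccw D \<mu> i (int n - int p)))"
  proof (intro sum.cong refl)
    fix p assume "p \<in> {..lam}"
    then have "int (m + (lam - p)) = \<beta> - 1 + (int n - int p)"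
      using m alpha_plus_beta by (simp add: of_nat_diff)
    then show "scal (acoef p) * whisker [Red k] (bubble (Down i) (int (m + (lam - p)))) [] =
        scal (acoef p) * rgt (ccw D \<mu> i (int n - int p))"
      by (simp only: rgt_def ccw_def)
  qed
  also have "\<dots> \<approx> (\<Sum>p=0..n. scal (acoef p) * rgt (ccw D \<mu> i (int (n - p))))"
    by (rule convolution_up_to) (auto intro: ccw_right_neg acoef_zero)
  also have "\<dots> = (red_poly * ccw_right) $ n"
    by (simp add: fps_mult_nth red_poly_def ccw_right_def)
  finally show ?thesis .
qed

lemma cw_right_real:
  assumes "int n > \<beta>"
  shows "cw_right $ n \<approx> (red_poly * cw_left) $ n"
proof -
  define m where "m = nat (int n - \<beta> - 1)"
  have m: "int m = coroot D i \<mu> - 1 + int n"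
    using assms by (simp add: m_def)
  have "cw_right $ n = whisker [Red k] (bubble (Up i) (int m)) []"
    unfolding cw_right_def m by (simp add: rgt_def cw_def)
  also have "\<dots> \<approx> (\<Sum>p\<le>lam. scal (acoef p) * whisker [] (bubble (Up i) (int (m + (lam - p)))) [Red k])"
    by (rule cw_bubble_through_red) (rule sym_e_Alam)
  also have "\<dots> = (\<Sum>p\<le>lam. scal (acoef p) * lft (cw D \<nu> i (int n - int p)))"
  proof (intro sum.cong refl)
    fix p assume "p \<in> {..lam}"
    then have "int (m + (lam - p)) = \<alpha> - 1 + (int n - int p)"
      using m alpha_plus_beta by (simp add: of_nat_diff)
    then show "scal (acoef p) * whisker [] (bubble (Up i) (int (m + (lam - p)))) [Red k] =
        scal (acoef p) * lft (cw D \<nu> i (int n - int p))"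
      by (simp only: lft_def cw_def)
  qed
  also have "\<dots> \<approx> (\<Sum>p=0..n. scal (acoef p) * lft (cw D \<nu> i (int (n - p))))"
    by (rule convolution_up_to) (auto intro: cw_left_neg acoef_zero)
  also have "\<dots> = (red_poly * cw_left) $ n"
    by (simp add: fps_mult_nth red_poly_def cw_left_def)
  finally show ?thesis .
qed

lemma ccw_left_0: "ccw_left $ 0 \<approx> kscal (inverse (bub_param D i \<nu>))"
  using lft_cg[OF ccw_lowest[of 0 \<nu> i]] by (simp add: ccw_left_def)

lemma cw_left_0: "cw_left $ 0 \<approx> kscal (bub_param D i \<nu>)"
  using lft_cg[OF cw_lowest[of 0 \<nu> i]] by (simp add: cw_left_def)

lemma ccw_right_0: "ccw_right $ 0 \<approx> kscal (inverse (bub_param D i \<mu>))"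
  using rgt_cg[OF ccw_lowest[of 0 \<mu> i]] by (simp add: ccw_right_def)

lemma cw_right_0: "cw_right $ 0 \<approx> kscal (bub_param D i \<mu>)"
  using rgt_cg[OF cw_lowest[of 0 \<mu> i]] by (simp add: cw_right_def)

lemma red_poly_0: "red_poly $ 0 = 1"
  by (simp add: red_poly_def sym_e_0 eval_red_one)

end


subsection \<open>Fake bubbles\<close>

context red_string_colour
begin

lemma red_poly_ccw_right_hom: "(red_poly * ccw_right) $ t \<in> rend"
  using fhom_mult[OF fhom_bubbles(5,3)] by (simp add: fhom_def)

text \<open>Both figure eights in the lemma on moving a figure eight through a red string are evaluated as
  products of bubbles.  The one on the right contributes exactly the terms with a fake bubble that are
  missing from the correction terms, and together they form a part of a product of power series.\<close>

lemma fig8_identity: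
  assumes a: "\<alpha> = int A" and b: "\<beta> = int B"
  shows "(\<Sum>t | t \<le> Suc m \<and> t \<le> A. (red_poly * ccw_right) $ t * cw_left $ (Suc m - t)) \<approx>
    - (\<Sum>t | t \<le> Suc m \<and> A < t. ccw_left $ t * cw_left $ (Suc m - t))"
proof -
  let ?n = "Suc m"
  define X where "X z = lft (cw D \<nu> i z)" for z
  define Z where "Z z = rgt (ccw D \<mu> i z)" for z
  have lam: "lam = A + B"
    using alpha_plus_beta a b by simp
  have Xhom: "X z \<in> rend" for z
    by (simp add: X_def lft_hom cw_hom)
  have Zhom: "Z z \<in> rend" for z
    by (simp add: Z_def rgt_hom ccw_hom)
  have X: "X (int t) = cw_left $ t" for t
    by (simp add: X_def cw_left_def)
  have Xneg: "X z \<approx> 0" if "z < 0" for z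
    using cw_left_neg[OF that] by (simp add: X_def)
  have up: "lft (bubble (Up i) d) = X (d + 1 - int A)" for d
    using a by (simp add: X_def cw_def)
  have down: "rgt (bubble (Down i) d) = Z (d + 1 - int B)" for d
    using b by (simp add: Z_def ccw_def)
  have left: "lft (dl (fig8 i m)) \<approx> - (\<Sum>t | t \<le> ?n \<and> A < t. ccw_left $ t * cw_left $ (?n - t))"
  proof -
    have "lft (dl (fig8 i m)) \<approx> lft (- (\<Sum>j\<le>m. bubble (Down i) (int j) * bubble (Up i) (int m - 1 - int j)))"
      by (rule lft_cg[OF fig8_eval_nonneg]) (simp add: a)
    also have "\<dots> = - (\<Sum>j\<le>m. ccw_left $ (j + A + 1) * X (int ?n - int (j + A + 1)))"
    proof -
      have "lft (bubble (Down i) (int j)) = ccw_left $ (j + A + 1)" for j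
        using a by (simp add: ccw_left_def ccw_def)
      moreover have "int m - 1 - int j + 1 - int A = int ?n - int (j + A + 1)" for j
        by simp
      ultimately show ?thesis
        by (simp only: lft_uminus lft_sum lft_mult up)
    qed
    also have "\<dots> \<approx> - (\<Sum>j\<le>m. if j + A + 1 \<le> ?n then ccw_left $ (j + A + 1) * cw_left $ (?n - (j + A + 1)) else 0)"
    proof (intro cg_uminus cg_sum)
      fix j
      show "ccw_left $ (j + A + 1) * X (int ?n - int (j + A + 1)) \<approx>
          (if j + A + 1 \<le> ?n then ccw_left $ (j + A + 1) * cw_left $ (?n - (j + A + 1)) else 0)"
      proof (cases "j + A + 1 \<le> ?n")
        case True
        then show ?thesis
          by (simp only: of_nat_diff[symmetric] X if_True cg_refl)
      next
        case False
        then have "ccw_left $ (j + A + 1) * X (int ?n - int (j + A + 1)) \<approx> ccw_left $ (j + A + 1) * 0"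
          using fhom_bubbles(1) by (intro cg_left[of _ _ "[Red k]"] Xneg) (auto simp: fhom_def)
        then show ?thesis
          using False by simp
      qed
    qed
    also have "(\<Sum>j\<le>m. if j + A + 1 \<le> ?n then ccw_left $ (j + A + 1) * cw_left $ (?n - (j + A + 1)) else 0) =
        (\<Sum>j | j \<le> m \<and> j + A + 1 \<le> ?n. ccw_left $ (j + A + 1) * cw_left $ (?n - (j + A + 1)))"
      by (subst sum.inter_filter[symmetric]) simp_all
    also have "\<dots> = (\<Sum>t | t \<le> ?n \<and> A < t. ccw_left $ t * cw_left $ (?n - t))"
      by (rule sum.reindex_bij_witness[of _ "\<lambda>t. t - A - 1" "\<lambda>j. j + A + 1"]) auto
    finally show ?thesis .
  qed
  let ?f = "\<lambda>(x, p, q). scal (acoef x) * (Z (int q - int B) * X (int ?n + int p - int A))"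
  let ?I = "{(x, p, q). x + p + q + 1 = lam}" and ?J = "{(x, p, q). x + p + q = lam}"
  have right: "rgt (dl (fig8 i m)) \<approx> (\<Sum>x\<le>lam. ?f (x, lam - x, 0))"
  proof -
    have "rgt (dl (fig8 i m)) \<approx> rgt (bubble (Down i) (- 1) * bubble (Up i) (int m))"
      by (rule rgt_cg[OF fig8_eval_nonpos]) (use b in simp)
    also have "\<dots> = Z (- int B) * rgt (bubble (Up i) (int m))"
      by (simp add: rgt_mult down)
    also have "\<dots> \<approx> Z (- int B) * (\<Sum>x\<le>lam. scal (acoef x) * lft (bubble (Up i) (int (m + (lam - x)))))"
      unfolding rgt_def lft_def
      by (intro cg_left[OF Zhom] cw_bubble_through_red sym_e_Alam)
    also have "\<dots> = (\<Sum>x\<le>lam. ?f (x, lam - x, 0))"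
    proof -
      have "int (m + y) + 1 - int A = int ?n + int y - int A" for y
        by simp
      then show ?thesis
        by (simp only: sum_distrib_left up scal_left_commute case_prod_conv of_nat_0 diff_0)
    qed
    finally show ?thesis .
  qed
  have "lft (dl (fig8 i m)) \<approx> rgt (dl (fig8 i m)) +
      (\<Sum>(x, p, q)\<in>?I. scal (acoef x) * (rgt (bubble (Down i) (int q)) * lft (bubble (Up i) (int (m + p)))))"
    unfolding lft_def rgt_def by (rule fig8_through_red) (rule sym_e_Alam)
  also have "(\<Sum>(x, p, q)\<in>?I. scal (acoef x) * (rgt (bubble (Down i) (int q)) * lft (bubble (Up i) (int (m + p))))) =
      (\<Sum>(x, p, q)\<in>?I. ?f (x, p, Suc q))"
    by (intro sum.cong refl) (simp add: up down case_prod_unfold algebra_simps)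
  also have "rgt (dl (fig8 i m)) + \<dots> \<approx> (\<Sum>x\<le>lam. ?f (x, lam - x, 0)) + \<dots>"
    by (intro cg_add right cg_refl)
  \<comment> \<open>the value of the figure eight on the right supplies the terms with q = 0\<close>
  also have "\<dots> = (\<Sum>y\<in>?J. ?f y)"
  proof -
    have fin: "finite ?J"
      by (rule finite_subset[of _ "{..lam} \<times> {..lam} \<times> {..lam}"]) auto
    have "(\<Sum>y\<in>?J. ?f y) = (\<Sum>y\<in>{(x, p, q). (x, p, q) \<in> ?J \<and> q = 0}. ?f y) + (\<Sum>y\<in>{(x, p, q). (x, p, q) \<in> ?J \<and> q \<noteq> 0}. ?f y)"
      by (subst sum.union_disjoint[symmetric]) (auto intro: finite_subset[OF _ fin] sum.cong)
    also have "(\<Sum>y\<in>{(x, p, q). (x, p, q) \<in> ?J \<and> q = 0}. ?f y) = (\<Sum>x\<le>lam. ?f (x, lam - x, 0))"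
    proof -
      have "{(x, p, q). (x, p, q) \<in> ?J \<and> q = 0} = (\<lambda>x. (x, lam - x, 0)) ` {..lam}"
        by (auto simp: image_iff)
      then show ?thesis
        by (simp only:) (subst sum.reindex, auto simp: inj_on_def)
    qed
    also have "(\<Sum>y\<in>{(x, p, q). (x, p, q) \<in> ?J \<and> q \<noteq> 0}. ?f y) = (\<Sum>(x, p, q)\<in>?I. ?f (x, p, Suc q))"
      by (rule sum.reindex_bij_witness[of _ "\<lambda>(x, p, q). (x, p, Suc q)" "\<lambda>(x, p, q). (x, p, q - 1)"]) auto
    finally show ?thesis by simp
  qed
  also have "\<dots> = (\<Sum>p\<le>lam. \<Sum>x\<le>lam - p. ?f (x, p, lam - p - x))"
  proof -
    let ?S = "SIGMA p:{..lam}. {..lam - p}"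
    have "?J = (\<lambda>(p, x). (x, p, lam - p - x)) ` ?S"
      by (auto simp: image_iff)
    moreover have "inj_on (\<lambda>(p, x). (x, p, lam - p - x)) ?S"
      by (auto simp: inj_on_def)
    ultimately have "(\<Sum>y\<in>?J. ?f y) = (\<Sum>(p, x)\<in>?S. ?f (x, p, lam - p - x))"
      by (simp only: sum.reindex comp_def case_prod_unfold fst_conv snd_conv)
    also have "\<dots> = (\<Sum>p\<le>lam. \<Sum>x\<le>lam - p. ?f (x, p, lam - p - x))"
      by (rule sum.Sigma[symmetric]) simp_all
    finally show ?thesis .
  qed
  also have "\<dots> \<approx> (\<Sum>p\<le>lam. if p \<le> A then (red_poly * ccw_right) $ (A - p) * X (int ?n - int (A - p)) else 0)"
  proof (rule cg_sum)
    fix p assume p: "p \<in> {..lam}"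
    have "(\<Sum>x\<le>lam - p. ?f (x, p, lam - p - x)) =
        (\<Sum>x\<le>lam - p. scal (acoef x) * Z (int A - int p - int x)) * X (int ?n + int p - int A)"
      unfolding sum_distrib_right
    proof (intro sum.cong refl)
      fix x assume "x \<in> {..lam - p}"
      then have "int (lam - p - x) - int B = int A - int p - int x"
        using p lam by (simp add: of_nat_diff)
      then show "?f (x, p, lam - p - x) = scal (acoef x) * Z (int A - int p - int x) * X (int ?n + int p - int A)"
        by (simp only: case_prod_conv mult.assoc)
    qed
    also have "\<dots> \<approx> (if p \<le> A then (red_poly * ccw_right) $ (A - p) else 0) * X (int ?n + int p - int A)"
    proof (rule cg_right[OF Xhom])
      show "(\<Sum>x\<le>lam - p. scal (acoef x) * Z (int A - int p - int x)) \<approx>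
          (if p \<le> A then (red_poly * ccw_right) $ (A - p) else 0)"
      proof (cases "p \<le> A")
        case True
        have "(\<Sum>x\<le>lam - p. scal (acoef x) * Z (int (A - p) - int x)) \<approx> (\<Sum>x=0..A - p. scal (acoef x) * Z (int (A - p - x)))"
          by (rule convolution_up_to) (use lam in \<open>auto simp: Z_def intro: ccw_right_neg\<close>)
        then show ?thesis
          using True by (simp add: of_nat_diff fps_mult_nth red_poly_def ccw_right_def Z_def)
      next
        case False
        have "(\<Sum>x\<le>lam - p. scal (acoef x) * Z (int A - int p - int x)) \<approx> (\<Sum>x\<le>lam - p. scal (acoef x) * 0)"
          using False by (intro cg_sum cg_scal acoef_Alam) (auto simp: Z_def intro!: ccw_right_neg)
        then show ?thesis
          using False by simp
      qed
    qed
    also have "\<dots> = (if p \<le> A then (red_poly * ccw_right) $ (A - p) * X (int ?n - int (A - p)) else 0)"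
      by (auto simp: of_nat_diff algebra_simps)
    finally show "(\<Sum>x\<le>lam - p. ?f (x, p, lam - p - x)) \<approx>
        (if p \<le> A then (red_poly * ccw_right) $ (A - p) * X (int ?n - int (A - p)) else 0)" .
  qed
  also have "(\<Sum>p\<le>lam. if p \<le> A then (red_poly * ccw_right) $ (A - p) * X (int ?n - int (A - p)) else 0) =
      (\<Sum>p | p \<le> lam \<and> p \<le> A. (red_poly * ccw_right) $ (A - p) * X (int ?n - int (A - p)))"
    by (subst sum.inter_filter[symmetric]) simp_all
  also have "\<dots> = (\<Sum>t\<le>A. (red_poly * ccw_right) $ t * X (int ?n - int t))"
    by (rule sum.reindex_bij_witness[of _ "\<lambda>t. A - t" "\<lambda>p. A - p"]) (auto simp: lam)
  also have "\<dots> \<approx> (\<Sum>t\<le>A. if t \<le> ?n then (red_poly * ccw_right) $ t * cw_left $ (?n - t) else 0)"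
  proof (rule cg_sum)
    fix t
    show "(red_poly * ccw_right) $ t * X (int ?n - int t) \<approx>
        (if t \<le> ?n then (red_poly * ccw_right) $ t * cw_left $ (?n - t) else 0)"
    proof (cases "t \<le> ?n")
      case True
      then show ?thesis
        by (simp only: of_nat_diff[symmetric] X if_True cg_refl)
    next
      case False
      then have "(red_poly * ccw_right) $ t * X (int ?n - int t) \<approx> (red_poly * ccw_right) $ t * 0"
        by (intro cg_left[OF red_poly_ccw_right_hom] Xneg) auto
      then show ?thesis
        using False by simp
    qed
  qed
  also have "\<dots> = (\<Sum>t | t \<le> A \<and> t \<le> ?n. (red_poly * ccw_right) $ t * cw_left $ (?n - t))"
    by (subst sum.inter_filter[symmetric]) simp_all
  also have "{t. t \<le> A \<and> t \<le> ?n} = {t. t \<le> ?n \<and> t \<le> A}"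
    by auto
  finally have "lft (dl (fig8 i m)) \<approx>
      (\<Sum>t | t \<le> ?n \<and> t \<le> A. (red_poly * ccw_right) $ t * cw_left $ (?n - t))" .
  then show ?thesis
    by (rule cg_trans[OF cg_sym left])
qed

text \<open>The parameters of two regions whose weights differ by the weight of a red string are independent of
  each other, so \<open>\<rho>\<close> is in general not one.\<close>

abbreviation \<rho> :: 'k where "\<rho> \<equiv> bub_param D i \<nu> / bub_param D i \<mu>"

lemma absorb_rho:
  assumes "1 \<approx> kscal \<rho>" "u \<in> rend"
  shows "u \<approx> kscal \<rho> * u"
  using cg_right[OF assms(2,1)] by simp

text \<open>If all counterclockwise bubbles on the left, or all clockwise ones on the right, have a nonnegative
  number of dots, then pulling them through the red string proves the claim, where the bubbles of degree
  zero show that \<open>\<rho>\<close> acts as one.  Otherwise let \<open>K\<close> be the difference of \<open>ccw_left\<close> and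
  \<open>red_poly * ccw_right\<close> truncated to the degrees of the fake bubbles.  The figure eight identity says
  that \<open>K * cw_left\<close> is the constant \<open>1 - \<rho>\<close>, hence \<open>K\<close> is congruent to \<open>(1 - \<rho>) * ccw_left\<close>.  In low
  degrees this is the claim, and in high degrees, where \<open>K\<close> vanishes and the two series agree, it says
  that \<open>\<rho>\<close> fixes \<open>ccw_left\<close>.\<close>

lemma red_poly_ccw_right: "(red_poly * ccw_right) $ n \<approx> kscal \<rho> * ccw_left $ n"
proof -
  have EL: "ccw_left $ n \<in> rend" for n
    using fhom_bubbles(1) by (simp add: fhom_def)
  consider "\<alpha> < 0" | "\<beta> < 0" | "\<alpha> \<ge> 0" "\<beta> \<ge> 0" by linarith
  then show ?thesis
  proof cases
    case 1
    have eq: "(red_poly * ccw_right) $ n \<approx> ccw_left $ n" for n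
      using 1 by (intro cg_sym[OF ccw_left_real]) simp
    have "kscal (inverse (bub_param D i \<mu>)) \<approx> kscal (inverse (bub_param D i \<nu>))"
      using cg_trans[OF cg_trans[OF cg_sym[OF ccw_right_0] _] ccw_left_0] eq[of 0] by (simp add: red_poly_0)
    from cg_kscal[OF cg_sym[OF this], of "bub_param D i \<nu>"] have "1 \<approx> kscal \<rho>"
      unfolding kscal_mult[symmetric] right_inverse[OF bub_param_nonzero] kscal_one divide_inverse .
    then show ?thesis
      by (rule cg_trans[OF eq absorb_rho[OF _ EL]])
  next
    case 2
    have eq: "cw_right \<sim> red_poly * cw_left"
      unfolding fcong_def using 2 by (auto intro: cw_right_real)
    then have "cw_right $ 0 \<approx> (red_poly * cw_left) $ 0"
      unfolding fcong_def by (rule spec)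
    then have "cw_right $ 0 \<approx> cw_left $ 0"
      by (simp only: fps_mult_nth_0 red_poly_0 mult_1)
    then have "kscal (bub_param D i \<mu>) \<approx> kscal (bub_param D i \<nu>)"
      by (rule cg_trans[OF cg_sym[OF cw_right_0] cg_trans[OF _ cw_left_0]])
    from cg_kscal[OF this, of "inverse (bub_param D i \<mu>)"] have one: "1 \<approx> kscal \<rho>"
      unfolding kscal_mult[symmetric] left_inverse[OF bub_param_nonzero] kscal_one divide_inverse
        mult.commute[of "bub_param D i \<nu>"] .
    have "red_poly * ccw_right = red_poly * ccw_right * 1"
      by simp
    also have "\<dots> \<sim> red_poly * ccw_right * (cw_left * ccw_left)"
      by (intro fcong_left fhom_mult fhom_bubbles fcong_sym[OF cw_left_ccw_left])
    also have "\<dots> = red_poly * ((ccw_right * cw_left) * ccw_left)"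
      by (simp add: mult.assoc)
    also have "\<dots> \<sim> red_poly * ((cw_left * ccw_right) * ccw_left)"
    proof (intro fcong_left fcong_right fhom_bubbles fcong_commute)
      fix x y
      show "ccw_right $ x * cw_left $ y \<approx> cw_left $ y * ccw_right $ x"
        by (simp add: ccw_right_def cw_left_def cg_sym[OF lft_rgt_commute] cw_hom ccw_hom)
    qed
    also have "\<dots> = (red_poly * cw_left) * (ccw_right * ccw_left)"
      by (simp add: mult.assoc)
    also have "\<dots> \<sim> cw_right * (ccw_right * ccw_left)"
      by (intro fcong_right fhom_mult fhom_bubbles fcong_sym[OF eq])
    also have "\<dots> = (cw_right * ccw_right) * ccw_left"
      by (simp add: mult.assoc)
    also have "\<dots> \<sim> 1 * ccw_left"
      by (intro fcong_right fhom_bubbles cw_right_ccw_right)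
    finally have "(red_poly * ccw_right) $ n \<approx> ccw_left $ n"
      by (simp add: fcong_def)
    then show ?thesis
      by (rule cg_trans[OF _ absorb_rho[OF one EL]])
  next
    case 3
    then obtain A B where a: "\<alpha> = int A" and b: "\<beta> = int B"
      using nonneg_int_cases by metis
    define K where "K = Abs_fps (\<lambda>t. if t \<le> A then ccw_left $ t - (red_poly * ccw_right) $ t else 0)"
    define C :: "('i, 'k) lin fps" where "C = fps_const (kscal (1 - \<rho>))"
    have K: "fhom K"
      using EL by (auto simp: fhom_def K_def red_poly_ccw_right_hom)
    \<comment> \<open>in degree zero this compares the parameters of the two regions\<close>
    have "K * cw_left \<sim> C"
      unfolding fcong_def
    proof
      fix n
      show "(K * cw_left) $ n \<approx> C $ n"
      proof (cases n)
        case 0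
        have "(K * cw_left) $ 0 = (ccw_left $ 0 - ccw_right $ 0) * cw_left $ 0"
          by (simp add: K_def red_poly_0)
        also have "\<dots> \<approx> (kscal (inverse (bub_param D i \<nu>)) - kscal (inverse (bub_param D i \<mu>))) * kscal (bub_param D i \<nu>)"
          using fhom_bubbles(2)
          by (intro cg_mult[of _ _ "[Red k]"] cg_diff ccw_left_0 ccw_right_0 cw_left_0) (auto simp: fhom_def)
        also have "\<dots> = C $ 0"
        proof -
          have "(inverse (bub_param D i \<nu>) - inverse (bub_param D i \<mu>)) * bub_param D i \<nu> = 1 - \<rho>"
            by (simp add: field_simps)
          then show ?thesis
            unfolding kscal_diff[symmetric] kscal_mult[symmetric] C_def by simp
        qed
        finally show ?thesis
          using 0 by simp
      next
        case (Suc m)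
        let ?E = "\<lambda>t. ccw_left $ t * cw_left $ (Suc m - t)"
        let ?F = "\<lambda>t. (red_poly * ccw_right) $ t * cw_left $ (Suc m - t)"
        have "(K * cw_left) $ Suc m = (\<Sum>t\<in>{0..Suc m}. if t \<le> A then ?E t - ?F t else 0)"
          unfolding fps_mult_nth by (intro sum.cong refl) (simp add: K_def left_diff_distrib fps_mult_nth)
        also have "\<dots> = (\<Sum>t | t \<le> Suc m \<and> t \<le> A. ?E t) - (\<Sum>t | t \<le> Suc m \<and> t \<le> A. ?F t)"
          by (subst sum.inter_filter[symmetric]) (simp_all add: sum_subtractf)
        also have "\<dots> \<approx> (\<Sum>t | t \<le> Suc m \<and> t \<le> A. ?E t) - (- (\<Sum>t | t \<le> Suc m \<and> A < t. ?E t))"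
          by (intro cg_diff cg_refl fig8_identity[OF a b])
        also have "\<dots> = (\<Sum>t\<in>{0..Suc m}. ?E t)"
        proof -
          have "(\<Sum>t\<in>{0..Suc m}. ?E t) = (\<Sum>t\<in>{t. t \<le> Suc m \<and> t \<le> A} \<union> {t. t \<le> Suc m \<and> A < t}. ?E t)"
            by (intro sum.cong) auto
          also have "\<dots> = (\<Sum>t | t \<le> Suc m \<and> t \<le> A. ?E t) + (\<Sum>t | t \<le> Suc m \<and> A < t. ?E t)"
            by (rule sum.union_disjoint) auto
          finally show ?thesis by simp
        qed
        also have "\<dots> = (ccw_left * cw_left) $ Suc m"
          by (simp add: fps_mult_nth)
        also have "\<dots> \<approx> 1 $ Suc m"
          using ccw_left_cw_left by (simp only: fcong_def)
        finally show ?thesis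
          using Suc by (simp add: C_def)
      qed
    qed
    have "K = K * 1"
      by simp
    also have "\<dots> \<sim> K * (cw_left * ccw_left)"
      by (intro fcong_left K fcong_sym[OF cw_left_ccw_left])
    also have "\<dots> = (K * cw_left) * ccw_left"
      by (simp add: mult.assoc)
    also have "\<dots> \<sim> C * ccw_left"
      by (intro fcong_right fhom_bubbles) fact
    finally have K_eq: "K $ n \<approx> ccw_left $ n - kscal \<rho> * ccw_left $ n"
      by (simp add: fcong_def C_def kscal_diff left_diff_distrib)
    show ?thesis
    proof (cases "n \<le> A")
      case True
      then have "K $ n = ccw_left $ n - (red_poly * ccw_right) $ n"
        by (simp add: K_def)
      then show ?thesis
        using cg_diff[OF cg_refl[of D \<mu> "[Red k]" "[Red k]" "ccw_left $ n"] K_eq] by simp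
    next
      case False
      then have "0 \<approx> ccw_left $ n - kscal \<rho> * ccw_left $ n"
        using K_eq by (simp add: K_def)
      from cg_diff[OF cg_refl[of D \<mu> "[Red k]" "[Red k]" "ccw_left $ n"] this]
      have eq: "ccw_left $ n \<approx> kscal \<rho> * ccw_left $ n"
        by simp
      show ?thesis
        by (rule cg_trans[OF cg_sym[OF ccw_left_real] eq]) (use False a in simp)
    qed
  qed
qed

end


section \<open>Symmetric functions on the two sides of a red string\<close>

lemma kscal_of_nat: "of_nat n = (kscal (of_nat n) :: ('i, 'k::comm_ring_1) lin)"
  by (induction n) (auto simp: kscal_add)

lemma (in stendhal) U_eq_cg: "U_eq D \<kappa> u v \<Longrightarrow> cg D \<kappa> [] [] u v"
proof -
  assume "U_eq D \<kappa> u v"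
  then have "u - v \<in> rel_span D (\<lambda>R'. black_rel D (wtw D R' + \<kappa>)) [] []"
    by (simp add: U_eq_def U_span_def)
  then show ?thesis
    unfolding cg_def by (rule rel_span_mono[rotated]) (simp add: local_rel_def)
qed

locale bubble_homs = red_string D k \<mu> for D :: "('i::finite, 'r, 'k::field_char_0) stendhal_data" and k \<mu> +
  fixes b :: "'r weight \<Rightarrow> ('i, 'k) ser \<Rightarrow> ('i, 'k) lin"
  assumes b_is_hom: "\<And>\<kappa>. is_bubble_hom D \<kappa> (b \<kappa>)"
begin

lemma b_hom: "f \<in> SymI \<Longrightarrow> b \<kappa> f \<in> hom D [] []"
  using b_is_hom[of \<kappa>] by (simp add: is_bubble_hom_def)

lemma b_add: "f \<in> SymI \<Longrightarrow> g \<in> SymI \<Longrightarrow> cg D \<kappa> [] [] (b \<kappa> (\<lambda>m. f m + g m)) (b \<kappa> f + b \<kappa> g)"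
  and b_scale: "f \<in> SymI \<Longrightarrow> cg D \<kappa> [] [] (b \<kappa> (\<lambda>m. c * f m)) (kscal c * b \<kappa> f)"
  and b_one: "cg D \<kappa> [] [] (b \<kappa> ser_one) 1"
  and b_mult: "f \<in> SymI \<Longrightarrow> g \<in> SymI \<Longrightarrow> cg D \<kappa> [] [] (b \<kappa> (ser_mult f g)) (b \<kappa> f * b \<kappa> g)"
  and b_signed_e: "cg D \<kappa> [] [] (b \<kappa> (signed_e i n)) (kscal (bub_param D i \<kappa>) * ccw D \<kappa> i (int n))"
  using b_is_hom[of \<kappa>] unfolding is_bubble_hom_def signed_e_def by (blast intro: U_eq_cg)+

definition left_image :: "('i, 'k) ser \<Rightarrow> ('i, 'k) lin" where "left_image f = lft (b \<nu> f)"
definition right_image :: "('i, 'k) ser \<Rightarrow> ('i, 'k) lin" where "right_image f = rgt (b \<mu> f)"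
definition root_value :: "('i, 'k) ser \<Rightarrow> ('i, 'k) lin" where "root_value f = scal (eval_red D k f)"

lemma left_image_hom: "f \<in> SymI \<Longrightarrow> left_image f \<in> rend"
  and right_image_hom: "f \<in> SymI \<Longrightarrow> right_image f \<in> rend"
  and root_value_hom: "f \<in> SymI \<Longrightarrow> root_value f \<in> rend"
  by (simp_all add: left_image_def right_image_def root_value_def lft_hom rgt_hom b_hom eval_red_in_Alam[OF _ k])

lemma left_image_add: "f \<in> SymI \<Longrightarrow> g \<in> SymI \<Longrightarrow> left_image (\<lambda>m. f m + g m) \<approx> left_image f + left_image g"
  and left_image_scale: "f \<in> SymI \<Longrightarrow> left_image (\<lambda>m. c * f m) \<approx> kscal c * left_image f"
  and left_image_one: "left_image ser_one \<approx> 1"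
  and left_image_mult: "f \<in> SymI \<Longrightarrow> g \<in> SymI \<Longrightarrow> left_image (ser_mult f g) \<approx> left_image f * left_image g"
  using lft_cg[OF b_add] lft_cg[OF b_scale] lft_cg[OF b_one] lft_cg[OF b_mult] lft_kscal[of 1]
  by (simp_all add: left_image_def lft_add lft_mult)

lemma right_image_add: "f \<in> SymI \<Longrightarrow> g \<in> SymI \<Longrightarrow> right_image (\<lambda>m. f m + g m) \<approx> right_image f + right_image g"
  and right_image_scale: "f \<in> SymI \<Longrightarrow> right_image (\<lambda>m. c * f m) \<approx> kscal c * right_image f"
  and right_image_one: "right_image ser_one \<approx> 1"
  and right_image_mult: "f \<in> SymI \<Longrightarrow> g \<in> SymI \<Longrightarrow> right_image (ser_mult f g) \<approx> right_image f * right_image g"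
  using rgt_cg[OF b_add] rgt_cg[OF b_scale] rgt_cg[OF b_one] rgt_cg[OF b_mult] rgt_kscal[of 1]
  by (simp_all add: right_image_def rgt_add rgt_mult)

lemma root_value_add: "f \<in> SymI \<Longrightarrow> g \<in> SymI \<Longrightarrow> root_value (\<lambda>m. f m + g m) = root_value f + root_value g"
  and root_value_scale: "f \<in> SymI \<Longrightarrow> root_value (\<lambda>m. c * f m) = kscal c * root_value f"
  and root_value_one: "root_value ser_one = 1"
  and root_value_mult: "f \<in> SymI \<Longrightarrow> g \<in> SymI \<Longrightarrow> root_value (ser_mult f g) = root_value f * root_value g"
  by (simp_all add: root_value_def eval_red_add eval_red_scale eval_red_one eval_red_mult scal_add scal_mult kscal_def)

lemma root_value_commute: "u * root_value f = root_value f * u"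
  by (simp add: root_value_def scal_commute)

lemma root_value_left_commute: "u * (root_value f * v) = root_value f * (u * v)"
  by (simp add: root_value_def scal_left_commute)

lemma signed_e_left: "left_image (signed_e i n) \<approx> (\<Sum>p=0..n. root_value (signed_e i p) * right_image (signed_e i (n - p)))"
proof -
  interpret red_string_colour D k \<mu> i
    by unfold_locales
  let ?c = "bub_param D i \<nu>" and ?d = "bub_param D i \<mu>"
  have EL: "ccw_left $ n \<in> rend"
    using fhom_bubbles(1) by (simp add: fhom_def)
  have root_value: "root_value (signed_e i p) = scal (acoef p)" for p
  proof -
    have "single 0 (x * y) = (single 0 x * single 0 y :: ('i, 'k) zpoly)" for x y
      by (simp add: mult_single)
    then have "single 0 (x ^ p) = (single 0 x ^ p :: ('i, 'k) zpoly)" for x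
      by (induction p) simp_all
    then have "single 0 ((-1) ^ p) = ((-1) ^ p :: ('i, 'k) zpoly)"
      by (simp add: single_uminus)
    then show ?thesis
      by (simp add: root_value_def signed_e_def eval_red_scale SymI_sym_e)
  qed
  have "left_image (signed_e i n) \<approx> kscal ?c * ccw_left $ n"
    using lft_cg[OF b_signed_e[of \<nu> i n]] by (simp add: left_image_def lft_mult ccw_left_def)
  also have "\<dots> = kscal ?d * (kscal \<rho> * ccw_left $ n)"
    by (simp add: mult.assoc[symmetric] kscal_mult[symmetric])
  also have "\<dots> \<approx> kscal ?d * (red_poly * ccw_right) $ n"
    by (intro cg_kscal cg_sym[OF red_poly_ccw_right])
  also have "\<dots> = (\<Sum>p=0..n. root_value (signed_e i p) * (kscal ?d * ccw_right $ (n - p)))"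
    by (simp add: fps_mult_nth red_poly_def sum_distrib_left root_value scal_left_commute)
  also have "\<dots> \<approx> (\<Sum>p=0..n. root_value (signed_e i p) * right_image (signed_e i (n - p)))"
  proof (intro cg_sum cg_left[of _ _ "[Red k]"])
    fix p
    show "kscal ?d * ccw_right $ (n - p) \<approx> right_image (signed_e i (n - p))"
      using cg_sym[OF rgt_cg[OF b_signed_e[of \<mu> i "n - p"]]] by (simp add: right_image_def rgt_mult ccw_right_def)
  qed (simp add: root_value_hom SymI_signed_e)
  finally show ?thesis .
qed

definition xD :: "('i, 'k) lin fps \<Rightarrow> ('i, 'k) lin fps" where
  "xD P = Abs_fps (\<lambda>n. of_nat n * P $ n)"

lemma xD_mult: "xD (P * Q) = xD P * Q + P * xD Q"
proof (rule fps_ext)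
  fix n
  have "xD (P * Q) $ n = (\<Sum>i=0..n. of_nat (i + (n - i)) * (P $ i * Q $ (n - i)))"
    by (simp add: xD_def fps_mult_nth sum_distrib_left)
  also have "\<dots> = (\<Sum>i=0..n. of_nat i * P $ i * Q $ (n - i) + P $ i * (of_nat (n - i) * Q $ (n - i)))"
  proof (intro sum.cong refl)
    fix i
    have c: "of_nat (n - i) * (u * v) = u * (of_nat (n - i) * v)" for u v :: "('i, 'k) lin"
      by (metis mult.assoc mult_of_nat_commute)
    show "of_nat (i + (n - i)) * (P $ i * Q $ (n - i)) =
        of_nat i * P $ i * Q $ (n - i) + P $ i * (of_nat (n - i) * Q $ (n - i))"
      unfolding of_nat_add distrib_right c mult.assoc ..
  qed
  also have "\<dots> = (xD P * Q + P * xD Q) $ n"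
    by (simp add: xD_def fps_mult_nth sum.distrib mult.assoc)
  finally show "xD (P * Q) $ n = (xD P * Q + P * xD Q) $ n" .
qed

lemma xD_fcong: "P \<sim> Q \<Longrightarrow> xD P \<sim> xD Q"
  by (auto simp: fcong_def xD_def kscal_of_nat intro: cg_kscal)

text \<open>Newton's identity, applied to any linear and multiplicative map, as a differential equation for the
  generating series of the signed elementary symmetric functions.\<close>

lemma newton_transport:
  assumes add: "\<And>f g. f \<in> SymI \<Longrightarrow> g \<in> SymI \<Longrightarrow> F (\<lambda>m. f m + g m) \<approx> F f + F g"
    and scale: "\<And>c f. f \<in> SymI \<Longrightarrow> F (\<lambda>m. c * f m) \<approx> kscal c * F f"
    and mult: "\<And>f g. f \<in> SymI \<Longrightarrow> g \<in> SymI \<Longrightarrow> F (ser_mult f g) \<approx> F f * F g"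
  shows "xD (Abs_fps (\<lambda>n. F (signed_e i n))) \<sim>
    - (Abs_fps (\<lambda>n. if n = 0 then 0 else F (sym_p i n)) * Abs_fps (\<lambda>n. F (signed_e i n)))"
  unfolding fcong_def
proof
  fix n
  have sum: "F (\<lambda>m. \<Sum>x\<in>X. h x m) \<approx> (\<Sum>x\<in>X. F (h x))" if "\<And>x. h x \<in> SymI" for X :: "nat set" and h
  proof (induction X rule: infinite_finite_induct)
    case (insert x X)
    have "F (\<lambda>m. h x m + (\<Sum>x\<in>X. h x m)) \<approx> F (h x) + F (\<lambda>m. \<Sum>x\<in>X. h x m)"
      using that by (intro add SymI_sum)
    also have "\<dots> \<approx> F (h x) + (\<Sum>x\<in>X. F (h x))"
      by (intro cg_add cg_refl insert)
    finally show ?case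
      using insert by simp
  qed (use scale[OF SymI_zero, of 0] in simp_all)
  let ?h = "\<lambda>j. ser_mult (sym_p i j) (signed_e i (n - j))"
  have h: "?h j \<in> SymI" for j
    by (intro SymI_mult SymI_sym_p SymI_signed_e)
  have newton: "(\<lambda>m. of_nat n * signed_e i n m) = (\<lambda>m. (-1) * (\<Sum>j=1..n. ?h j m))"
    by (rule ext) (simp add: newton_identity)
  have "kscal (of_nat n) * F (signed_e i n) \<approx> F (\<lambda>m. of_nat n * signed_e i n m)"
    by (rule cg_sym[OF scale[OF SymI_signed_e]])
  also have "\<dots> = F (\<lambda>m. (-1) * (\<Sum>j=1..n. ?h j m))"
    by (simp only: newton)
  also have "\<dots> \<approx> kscal (- 1) * F (\<lambda>m. \<Sum>j=1..n. ?h j m)"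
    using h by (intro scale SymI_sum)
  also have "\<dots> \<approx> kscal (- 1) * (\<Sum>j=1..n. F (?h j))"
    using h by (intro cg_kscal sum)
  also have "\<dots> \<approx> kscal (- 1) * (\<Sum>j=1..n. F (sym_p i j) * F (signed_e i (n - j)))"
    by (intro cg_kscal cg_sum mult SymI_sym_p SymI_signed_e)
  also have "(\<Sum>j=1..n. F (sym_p i j) * F (signed_e i (n - j))) =
      (\<Sum>j=0..n. (if j = 0 then 0 else F (sym_p i j)) * F (signed_e i (n - j)))"
    by (rule sum.mono_neutral_cong_left) auto
  finally show "xD (Abs_fps (\<lambda>n. F (signed_e i n))) $ n \<approx>
    (- (Abs_fps (\<lambda>n. if n = 0 then 0 else F (sym_p i n)) * Abs_fps (\<lambda>n. F (signed_e i n)))) $ n"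
    by (simp add: xD_def kscal_of_nat kscal_uminus fps_mult_nth)
qed

text \<open>The generating series of the signed elementary symmetric functions on the left is the product of
  the one on the right and the one at the roots.  Power sums are their logarithmic derivatives, so they
  add up; dividing by the series on the left is possible because the clockwise bubbles form its
  inverse.\<close>

lemma power_sum_left:
  assumes "r \<ge> 1"
  shows "left_image (sym_p i r) \<approx> root_value (sym_p i r) + right_image (sym_p i r)"
proof -
  interpret red_string_colour D k \<mu> i
    by unfold_locales
  define EL where "EL = Abs_fps (\<lambda>n. left_image (signed_e i n))"
  define ER where "ER = Abs_fps (\<lambda>n. right_image (signed_e i n))"
  define EA where "EA = Abs_fps (\<lambda>n. root_value (signed_e i n))"
  define PL where "PL = Abs_fps (\<lambda>n. if n = 0 then 0 else left_image (sym_p i n))"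
  define PR where "PR = Abs_fps (\<lambda>n. if n = 0 then 0 else right_image (sym_p i n))"
  define PA where "PA = Abs_fps (\<lambda>n. if n = 0 then 0 else root_value (sym_p i n))"
  have homs: "fhom EL" "fhom ER" "fhom EA" "fhom PL" "fhom PR" "fhom PA"
    by (auto simp: fhom_def EL_def ER_def EA_def PL_def PR_def PA_def left_image_hom right_image_hom root_value_hom SymI_signed_e SymI_sym_p)
  have E: "EL \<sim> EA * ER"
    unfolding fcong_def fps_mult_nth EL_def ER_def EA_def using signed_e_left by simp
  have NL: "xD EL \<sim> - (PL * EL)"
    unfolding EL_def PL_def by (rule newton_transport) (intro left_image_add left_image_scale left_image_mult; assumption)+
  have NR: "xD ER \<sim> - (PR * ER)"
    unfolding ER_def PR_def by (rule newton_transport) (intro right_image_add right_image_scale right_image_mult; assumption)+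
  have NA: "xD EA \<sim> - (PA * EA)"
    unfolding EA_def PA_def by (rule newton_transport) (simp_all add: root_value_add root_value_scale root_value_mult)
  have fadd: "P + P' \<sim> Q + Q'" if "P \<sim> Q" "P' \<sim> Q'" for P P' Q Q'
    using that by (auto simp: fcong_def intro: cg_add)
  have fneg: "- P \<sim> - Q" if "P \<sim> Q" for P Q
    using that by (auto simp: fcong_def intro: cg_uminus)
  have "EA * PR = PR * EA"
  proof (rule fps_ext)
    fix n
    show "(EA * PR) $ n = (PR * EA) $ n"
      unfolding fps_mult_nth
      by (rule sum.reindex_bij_witness[of _ "\<lambda>j. n - j" "\<lambda>j. n - j"]) (auto simp: EA_def PR_def root_value_commute)
  qed
  have "- (PL * EL) \<sim> xD EL"
    by (rule fcong_sym[OF NL])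
  also have "\<dots> \<sim> xD (EA * ER)"
    by (rule xD_fcong[OF E])
  also have "\<dots> = xD EA * ER + EA * xD ER"
    by (rule xD_mult)
  also have "\<dots> \<sim> - (PA * EA) * ER + EA * (- (PR * ER))"
    by (intro fadd fcong_left fcong_right homs NA NR)
  also have "\<dots> = - ((PA + PR) * (EA * ER))"
    using \<open>EA * PR = PR * EA\<close> by (simp add: distrib_right mult.assoc[symmetric])
  also have "\<dots> \<sim> - ((PA + PR) * EL)"
    using homs by (intro fneg fcong_left fcong_sym[OF E]) (auto simp: fhom_def)
  finally have "- (- (PL * EL)) \<sim> - (- ((PA + PR) * EL))"
    by (rule fneg)
  then have PE: "PL * EL \<sim> (PA + PR) * EL"
    by simp
  have inv: "EL * (fps_const (kscal (inverse (bub_param D i \<nu>))) * cw_left) \<sim> 1"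
  proof -
    have EL: "EL \<sim> fps_const (kscal (bub_param D i \<nu>)) * ccw_left"
      unfolding fcong_def EL_def using lft_cg[OF b_signed_e[of \<nu> i]] by (simp add: left_image_def lft_mult ccw_left_def)
    have h: "fhom (fps_const (kscal c))" for c
      by (simp add: fhom_def)
    have "EL * (fps_const (kscal (inverse (bub_param D i \<nu>))) * cw_left) \<sim>
       (fps_const (kscal (bub_param D i \<nu>)) * ccw_left) * (fps_const (kscal (inverse (bub_param D i \<nu>))) * cw_left)"
      by (intro fcong_right fhom_mult h fhom_bubbles EL)
    also have "\<dots> = ccw_left * cw_left"
    proof -
      let ?C = "\<lambda>c. fps_const (kscal c) :: ('i, 'k) lin fps"
      have comm: "P * ?C c = ?C c * P" for P c
        by (rule fps_ext) (simp add: kscal_commute)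
      have "?C c * P * (?C d * Q) = ?C c * ?C d * (P * Q)" for P Q c d
      proof -
        have "?C c * P * (?C d * Q) = ?C c * (P * ?C d) * Q"
          by (simp only: mult.assoc)
        then show ?thesis
          unfolding comm[of P d] by (simp only: mult.assoc)
      qed
      moreover have "?C (bub_param D i \<nu>) * ?C (inverse (bub_param D i \<nu>)) = 1"
        by (simp add: fps_const_mult kscal_mult[symmetric])
      ultimately show ?thesis
        by (simp only: mult_1)
    qed
    also have "\<dots> \<sim> 1"
      by (rule ccw_left_cw_left)
    finally show ?thesis .
  qed
  let ?H = "fps_const (kscal (inverse (bub_param D i \<nu>))) * cw_left"
  have H: "fhom ?H"
    by (intro fhom_mult fhom_bubbles) (simp add: fhom_def)
  have "PL = PL * 1"
    by simp
  also have "\<dots> \<sim> PL * (EL * ?H)"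
    by (intro fcong_left homs fcong_sym[OF inv])
  also have "\<dots> = PL * EL * ?H"
    by (simp add: mult.assoc)
  also have "\<dots> \<sim> (PA + PR) * EL * ?H"
    by (intro fcong_right H PE)
  also have "\<dots> = (PA + PR) * (EL * ?H)"
    by (simp add: mult.assoc)
  also have "\<dots> \<sim> (PA + PR) * 1"
    using homs by (intro fcong_left inv) (auto simp: fhom_def)
  finally have "PL \<sim> PA + PR"
    unfolding mult_1_right .
  then have "PL $ r \<approx> (PA + PR) $ r"
    by (simp add: fcong_def)
  then show ?thesis
    using assms by (simp add: PL_def PR_def PA_def)
qed

end


section \<open>The coproduct\<close>

lemma ser_mult_add_left: "ser_mult (\<lambda>m. f m + g m) h = (\<lambda>m. ser_mult f h m + ser_mult g h m)"
  by (simp add: ser_mult_def fun_eq_iff case_prod_unfold distrib_right sum.distrib)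

lemma ser_mult_tensor:
  "ser_mult (f \<otimes> f') (g \<otimes> g') = ser_mult f g \<otimes> (ser_mult f' g' :: ('i, 'k::comm_ring_1) ser)"
proof (rule ext)
  fix x :: "'i mono \<times> 'i mono"
  obtain m m' where x: "x = (m, m')" by (cases x)
  let ?S = "\<lambda>m. {(a, b). a + b = (m :: 'i mono)}"
  have "ser_mult (f \<otimes> f') (g \<otimes> g') x = (\<Sum>(y, z)\<in>?S m \<times> ?S m'. (f (fst y) * g (snd y)) * (f' (fst z) * g' (snd z)))"
    unfolding ser_mult_def x
    by (rule sum.reindex_bij_witness[of _ "\<lambda>((a, b), (a', b')). ((a, a'), (b, b'))" "\<lambda>((a, a'), (b, b')). ((a, b), (a', b'))"])
      (auto simp: tensor_def)
  also have "\<dots> = (\<Sum>y\<in>?S m. f (fst y) * g (snd y)) * (\<Sum>z\<in>?S m'. f' (fst z) * g' (snd z))"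
    by (simp add: sum_product sum.cartesian_product)
  also have "\<dots> = (ser_mult f g \<otimes> ser_mult f' g') x"
    by (simp add: x tensor_def ser_mult_def case_prod_unfold)
  finally show "ser_mult (f \<otimes> f') (g \<otimes> g') x = (ser_mult f g \<otimes> ser_mult f' g') x" .
qed

text \<open>Elements of \<open>SymI2\<close> are handled through lists of pairs of symmetric functions, which keeps track of
  a decomposition into pure tensors.\<close>

type_synonym ('i, 'k) tensor_list = "(('i, 'k) ser \<times> ('i, 'k) ser) list"

definition tensor_sum :: "('i, 'k::comm_ring_1) tensor_list \<Rightarrow> ('i, 'k) ser2" where
  "tensor_sum xs = (\<lambda>x. \<Sum>(g, h)\<leftarrow>xs. (g \<otimes> h) x)"

lemma tensor_sum_simps:
  "tensor_sum [] = (\<lambda>_. 0)"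
  "tensor_sum ((g, h) # xs) = (\<lambda>x. (g \<otimes> h) x + tensor_sum xs x)"
  "tensor_sum (xs @ ys) = (\<lambda>x. tensor_sum xs x + tensor_sum ys x)"
  by (simp_all add: tensor_sum_def)

lemma ser_mult_tensor_sum:
  "ser_mult (f \<otimes> f') (tensor_sum xs) = tensor_sum (map (\<lambda>(g, h). (ser_mult f g, ser_mult f' h)) xs)"
proof (induction xs)
  case Nil
  then show ?case
    by (simp add: tensor_sum_simps ser_mult_def)
next
  case (Cons x xs)
  then show ?case
    by (cases x) (simp add: tensor_sum_simps ser_mult_add_right ser_mult_tensor)
qed

context bubble_homs
begin

definition sym_list :: "('i, 'k) tensor_list \<Rightarrow> bool" where
  "sym_list xs \<longleftrightarrow> (\<forall>(g, h)\<in>set xs. g \<in> SymI \<and> h \<in> SymI)"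

definition right_value :: "('i, 'k) tensor_list \<Rightarrow> ('i, 'k) lin" where
  "right_value xs = (\<Sum>(g, h)\<leftarrow>xs. root_value h * right_image g)"

lemma sym_list_simps [simp]:
  "sym_list []" "sym_list ((g, h) # xs) \<longleftrightarrow> g \<in> SymI \<and> h \<in> SymI \<and> sym_list xs"
  "sym_list (xs @ ys) \<longleftrightarrow> sym_list xs \<and> sym_list ys"
  by (auto simp: sym_list_def)

lemma right_value_simps [simp]:
  "right_value [] = 0" "right_value ((g, h) # xs) = root_value h * right_image g + right_value xs"
  "right_value (xs @ ys) = right_value xs + right_value ys"
  by (simp_all add: right_value_def)

lemma right_value_scale:
  "sym_list xs \<Longrightarrow> right_value (map (\<lambda>(g, h). (\<lambda>m. c * g m, h)) xs) \<approx> kscal c * right_value xs"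
proof (induction xs)
  case (Cons x xs)
  obtain g h where x: "x = (g, h)" by (cases x)
  have "root_value h * right_image (\<lambda>m. c * g m) + right_value (map (\<lambda>(g, h). (\<lambda>m. c * g m, h)) xs) \<approx>
      root_value h * (kscal c * right_image g) + kscal c * right_value xs"
    using Cons by (intro cg_add cg_left[of _ _ "[Red k]"] right_image_scale) (auto simp: x root_value_hom)
  also have "\<dots> = kscal c * right_value (x # xs)"
    by (simp add: x distrib_left kscal_def scal_left_commute)
  finally show ?case
    by (simp add: x)
qed simp

lemma tensor_sum_scale: "tensor_sum (map (\<lambda>(g, h). (\<lambda>m. c * g m, h)) xs) = (\<lambda>x. c * tensor_sum xs x)"
proof (induction xs)
  case (Cons x xs)
  then show ?case
    by (cases x) (simp add: tensor_sum_simps tensor_def fun_eq_iff algebra_simps)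
qed (simp add: tensor_sum_simps)

lemma sym_list_scale: "sym_list xs \<Longrightarrow> sym_list (map (\<lambda>(g, h). (\<lambda>m. c * g m, h)) xs)"
  by (auto simp: sym_list_def intro: SymI_scale)

text \<open>The right hand side of the slide does not depend on how the tensor is written: if a decomposition
  of zero has a second factor \<open>v\<close> with a nonzero coefficient at some monomial \<open>m0\<close>, then evaluating at
  \<open>m0\<close> exhibits its partner \<open>u\<close> as a linear combination of the other first factors, and eliminating
  \<open>u\<close> gives a shorter decomposition of zero with the same value.\<close>

lemma right_value_tensor_zero:
  "sym_list zs \<Longrightarrow> tensor_sum zs = (\<lambda>_. 0) \<Longrightarrow> right_value zs \<approx> 0"
proof (induction "length zs" arbitrary: zs)
  case 0
  then show ?case by simp
next
  case (Suc n)
  then obtain u v ws where zs: "zs = (u, v) # ws"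
    by (cases zs) auto
  have uv: "u \<in> SymI" "v \<in> SymI" "sym_list ws" and n: "n = length ws"
    using Suc by (auto simp: zs)
  have tz: "u a * v c + tensor_sum ws (a, c) = 0" for a c
    using fun_cong[OF Suc.prems(2), of "(a, c)"] by (simp add: zs tensor_sum_simps tensor_def)
  show ?case
  proof (cases "v = (\<lambda>_. 0)")
    case True
    then have "tensor_sum ws = (\<lambda>_. 0)"
      using tz by (auto simp: fun_eq_iff)
    then have "right_value ws \<approx> 0"
      using Suc.hyps(1)[OF n] uv by blast
    moreover have "root_value v = 0"
      by (simp add: True root_value_def)
    ultimately show ?thesis
      by (simp add: zs)
  next
    case False
    then obtain m0 where m0: "v m0 \<noteq> 0" by auto
    \<comment> \<open>the coefficients that express u through the other first factors\<close>
    define c where "c h = - (h m0 / v m0)" for h :: "('i, 'k) ser"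
    let ?ws = "map (\<lambda>(g, h). (g, \<lambda>m. h m + c h * v m)) ws"
    have sums: "tensor_sum (map (\<lambda>(g, h). (g, \<lambda>m. h m + c h * v m)) xs) (a, d) =
        tensor_sum xs (a, d) - tensor_sum xs (a, m0) / v m0 * v d" for xs :: "('i, 'k) tensor_list" and a d
      by (induction xs) (auto simp: tensor_sum_simps tensor_def c_def add_divide_distrib algebra_simps)
    have "tensor_sum ?ws = (\<lambda>_. 0)"
    proof (rule ext)
      fix x :: "'i mono \<times> 'i mono"
      obtain a d where x: "x = (a, d)" by (cases x)
      have "tensor_sum ws (a, m0) = - (u a * v m0)" "tensor_sum ws (a, d) = - (u a * v d)"
        using tz[of a m0] tz[of a d] by (simp_all add: eq_neg_iff_add_eq_0 add.commute)
      then show "tensor_sum ?ws x = 0"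
        using m0 by (simp add: x sums)
    qed
    moreover have "sym_list ?ws"
      using uv by (auto simp: sym_list_def intro!: SymI_add SymI_scale)
    ultimately have "right_value ?ws \<approx> 0"
      using Suc.hyps(1)[of ?ws] n by simp
    moreover have eq: "right_value ?ws \<approx> right_value zs"
    proof -
      have u: "u = (\<lambda>m. \<Sum>(g, h)\<leftarrow>ws. c h * g m)"
      proof (rule ext)
        fix a
        have sum: "(\<Sum>(g, h)\<leftarrow>xs. c h * g a) = - tensor_sum xs (a, m0) / v m0" for xs
          using m0 by (induction xs) (auto simp: tensor_sum_simps tensor_def c_def field_simps)
        have "tensor_sum ws (a, m0) = - (u a * v m0)"
          using tz[of a m0] by (simp add: eq_neg_iff_add_eq_0 add.commute)
        then show "u a = (\<Sum>(g, h)\<leftarrow>ws. c h * g a)"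
          unfolding sum using m0 by simp
      qed
      have "sym_list xs \<Longrightarrow> (\<lambda>m. \<Sum>(g, h)\<leftarrow>xs. c h * g m) \<in> SymI \<and>
          root_value v * right_image (\<lambda>m. \<Sum>(g, h)\<leftarrow>xs. c h * g m) + right_value xs \<approx>
          right_value (map (\<lambda>(g, h). (g, \<lambda>m. h m + c h * v m)) xs)" for xs
      proof (induction xs)
        case Nil
        have "right_image (\<lambda>_. 0) \<approx> 0"
          using right_image_scale[OF SymI_zero, of 0] by simp
        then have "root_value v * right_image (\<lambda>_. 0) \<approx> root_value v * 0"
          by (rule cg_left[OF root_value_hom[OF uv(2)]])
        then show ?case
          by (simp add: SymI_zero)
      next
        case (Cons x xs)
        obtain g h where x: "x = (g, h)" by (cases x)
        have gh: "g \<in> SymI" "h \<in> SymI" "sym_list xs"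
          using Cons.prems by (auto simp: x)
        let ?s = "\<lambda>m. \<Sum>(g, h)\<leftarrow>xs. c h * g m"
        let ?r = "right_value (map (\<lambda>(g, h). (g, \<lambda>m. h m + c h * v m)) xs)"
        note IH = Cons.IH[OF gh(3)]
        have sum: "(\<lambda>m. \<Sum>(g, h)\<leftarrow>x # xs. c h * g m) = (\<lambda>m. c h * g m + ?s m)"
          by (simp add: x)
        have "right_image (\<lambda>m. c h * g m + ?s m) \<approx> right_image (\<lambda>m. c h * g m) + right_image ?s"
          using IH gh by (intro right_image_add SymI_scale) auto
        also have "\<dots> \<approx> kscal (c h) * right_image g + right_image ?s"
          using gh by (intro cg_add cg_refl right_image_scale)
        finally have "root_value v * right_image (\<lambda>m. c h * g m + ?s m) + right_value (x # xs) \<approx>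
            root_value v * (kscal (c h) * right_image g + right_image ?s) + right_value (x # xs)"
          by (intro cg_add cg_refl cg_left[OF root_value_hom[OF uv(2)]])
        also have "\<dots> = (root_value h + kscal (c h) * root_value v) * right_image g + (root_value v * right_image ?s + right_value xs)"
          by (simp add: x algebra_simps kscal_def scal_left_commute)
        also have "\<dots> \<approx> (root_value h + kscal (c h) * root_value v) * right_image g + ?r"
          using IH by (intro cg_add cg_refl) auto
        also have "\<dots> = right_value (map (\<lambda>(g, h). (g, \<lambda>m. h m + c h * v m)) (x # xs))"
          using gh uv by (simp add: x root_value_add root_value_scale SymI_scale)
        finally show ?case
          using IH gh unfolding sum by (auto intro: SymI_add SymI_scale)
      qed
      then show ?thesis
        using uv(3) u by (simp add: zs cg_sym)
    qed
    ultimately show ?thesis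
      by (intro cg_trans[OF cg_sym[OF eq]])
  qed
qed

lemma right_value_unique:
  assumes "sym_list xs" "sym_list ys" "tensor_sum xs = tensor_sum ys"
  shows "right_value xs \<approx> right_value ys"
proof -
  let ?ys = "map (\<lambda>(g, h). (\<lambda>m. (-1) * g m, h)) ys"
  have "right_value (xs @ ?ys) \<approx> 0"
  proof (rule right_value_tensor_zero)
    show "sym_list (xs @ ?ys)"
      using assms sym_list_scale[of ys "-1"] by simp
    show "tensor_sum (xs @ ?ys) = (\<lambda>_. 0)"
      unfolding tensor_sum_simps tensor_sum_scale assms(3) by simp
  qed
  moreover have "right_value (xs @ ?ys) \<approx> right_value xs + kscal (- 1) * right_value ys"
    unfolding right_value_simps by (intro cg_add cg_refl right_value_scale assms)
  ultimately have "0 \<approx> right_value xs + kscal (- 1) * right_value ys"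
    by (rule cg_trans[OF cg_sym])
  from cg_sym[OF cg_add[OF this cg_refl[of D \<mu> "[Red k]" "[Red k]" "right_value ys"]]] show ?thesis
    by (simp add: kscal_uminus)
qed

text \<open>Both sides are multiplicative in \<open>f\<close>, so it is enough to know the slide for power sums, on which
  the coproduct is given.\<close>

lemma left_value_exists:
  assumes \<delta>: "is_coproduct \<delta>" and "f \<in> SymI"
  shows "\<exists>xs. sym_list xs \<and> \<delta> f = tensor_sum xs \<and> left_image f \<approx> right_value xs"
  using assms(2)
proof (induction rule: SymI_induct)
  case one
  have "ser_one = tensor_sum [(ser_one, ser_one :: ('i, 'k) ser)]"
    by (auto simp: tensor_sum_simps tensor_def ser_one_def zero_prod_def)
  then have "\<delta> ser_one = tensor_sum [(ser_one, ser_one)]"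
    using \<delta> by (simp add: is_coproduct_def)
  moreover have "left_image ser_one \<approx> right_value [(ser_one, ser_one)]"
    using cg_trans[OF left_image_one cg_sym[OF right_image_one]] by (simp add: root_value_one)
  ultimately show ?case
    by (intro exI[of _ "[(ser_one, ser_one)]"]) (simp add: SymI_one)
next
  case (p i r g)
  then obtain xs where xs: "sym_list xs" "\<delta> g = tensor_sum xs" "left_image g \<approx> right_value xs"
    by blast
  let ?p = "sym_p i r :: ('i, 'k) ser"
  let ?ys = "map (\<lambda>(g, h). (ser_mult ?p g, h)) xs" and ?zs = "map (\<lambda>(g, h). (g, ser_mult ?p h)) xs"
  have "\<delta> (ser_mult ?p g) = ser_mult (\<lambda>x. (?p \<otimes> ser_one) x + (ser_one \<otimes> ?p) x) (tensor_sum xs)"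
  proof -
    have "\<forall>f\<in>SymI. \<forall>g\<in>SymI. \<delta> (ser_mult f g) = ser_mult (\<delta> f) (\<delta> g)"
      "\<forall>i. \<forall>r\<ge>1. \<delta> (sym_p i r) = (\<lambda>x. (sym_p i r \<otimes> ser_one) x + (ser_one \<otimes> sym_p i r) x)"
      using \<delta> by (simp_all add: is_coproduct_def)
    from this(1)[rule_format, OF SymI_sym_p p(2), of i r] this(2)[rule_format, OF p(1), of i]
    have "\<delta> (ser_mult ?p g) = ser_mult (\<delta> ?p) (\<delta> g)"
      "\<delta> ?p = (\<lambda>x. (?p \<otimes> ser_one) x + (ser_one \<otimes> ?p) x)" .
    then show ?thesis
      by (simp only: xs(2))
  qed
  also have "\<dots> = tensor_sum (?ys @ ?zs)"
    by (simp add: ser_mult_add_left ser_mult_tensor_sum ser_mult_one_left tensor_sum_simps)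
  finally have \<delta>_eq: "\<delta> (ser_mult ?p g) = tensor_sum (?ys @ ?zs)" .
  have sym: "sym_list (?ys @ ?zs)"
    using xs(1) by (auto simp: sym_list_def intro: SymI_mult SymI_sym_p)
  have vals: "sym_list xs \<Longrightarrow> right_image ?p * right_value xs \<approx> right_value (map (\<lambda>(g, h). (ser_mult ?p g, h)) xs) \<and>
      root_value ?p * right_value xs = right_value (map (\<lambda>(g, h). (g, ser_mult ?p h)) xs)" for xs
  proof (induction xs)
    case (Cons x xs)
    obtain g h where x: "x = (g, h)" by (cases x)
    have gh: "g \<in> SymI" "h \<in> SymI" "sym_list xs"
      using Cons.prems by (auto simp: x)
    have "right_image ?p * right_value (x # xs) = root_value h * (right_image ?p * right_image g) + right_image ?p * right_value xs"
      by (simp add: x distrib_left root_value_left_commute)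
    also have "\<dots> \<approx> root_value h * right_image (ser_mult ?p g) + right_value (map (\<lambda>(g, h). (ser_mult ?p g, h)) xs)"
      using gh Cons.IH by (intro cg_add cg_left[OF root_value_hom] cg_sym[OF right_image_mult] SymI_sym_p) auto
    finally have "right_image ?p * right_value (x # xs) \<approx> right_value (map (\<lambda>(g, h). (ser_mult ?p g, h)) (x # xs))"
      by (simp add: x)
    moreover have "root_value ?p * right_value (x # xs) = right_value (map (\<lambda>(g, h). (g, ser_mult ?p h)) (x # xs))"
      using Cons.IH gh by (simp add: x distrib_left root_value_mult SymI_sym_p mult.assoc)
    ultimately show ?case ..
  qed simp
  have "left_image (ser_mult ?p g) \<approx> left_image ?p * left_image g"
    using p by (intro left_image_mult SymI_sym_p)
  also have "\<dots> \<approx> (root_value ?p + right_image ?p) * right_value xs"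
    using p xs by (intro cg_mult[of _ _ "[Red k]"] power_sum_left hom_add root_value_hom right_image_hom left_image_hom SymI_sym_p) auto
  also have "\<dots> = root_value ?p * right_value xs + right_image ?p * right_value xs"
    by (simp add: distrib_right)
  also have "\<dots> \<approx> right_value ?zs + right_value ?ys"
    using vals[OF xs(1)] by (intro cg_add) auto
  also have "\<dots> = right_value (?ys @ ?zs)"
    by simp
  finally show ?case
    using \<delta>_eq sym by blast
next
  case (add f g)
  then obtain xs ys where "sym_list xs" "\<delta> f = tensor_sum xs" "left_image f \<approx> right_value xs"
      "sym_list ys" "\<delta> g = tensor_sum ys" "left_image g \<approx> right_value ys"
    by blast
  moreover from this add have "left_image (\<lambda>m. f m + g m) \<approx> right_value xs + right_value ys"
    by (intro cg_trans[OF left_image_add cg_add])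
  moreover have "\<delta> (\<lambda>m. f m + g m) = (\<lambda>x. \<delta> f x + \<delta> g x)"
    using \<delta> add by (simp add: is_coproduct_def)
  ultimately show ?case
    by (intro exI[of _ "xs @ ys"]) (simp add: tensor_sum_simps)
next
  case (scale c f)
  then obtain xs where xs: "sym_list xs" "\<delta> f = tensor_sum xs" "left_image f \<approx> right_value xs"
    by blast
  let ?xs = "map (\<lambda>(g, h). (\<lambda>m. c * g m, h)) xs"
  have "left_image (\<lambda>m. c * f m) \<approx> kscal c * left_image f"
    using scale by (intro left_image_scale)
  also have "\<dots> \<approx> kscal c * right_value xs"
    by (intro cg_kscal xs)
  also have "\<dots> \<approx> right_value ?xs"
    by (intro cg_sym[OF right_value_scale] xs)
  finally have "left_image (\<lambda>m. c * f m) \<approx> right_value ?xs" .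
  moreover have "\<delta> (\<lambda>m. c * f m) = (\<lambda>x. c * \<delta> f x)"
    using \<delta> scale by (simp add: is_coproduct_def)
  ultimately show ?case
    using xs by (intro exI[of _ ?xs]) (simp add: tensor_sum_scale sym_list_scale)
qed

lemma bubble_slide:
  fixes g g' :: "nat \<Rightarrow> ('i, 'k) ser"
  assumes \<delta>: "is_coproduct \<delta>" and f: "f \<in> SymI"
    and g: "\<And>s. s < N \<Longrightarrow> g s \<in> SymI" "\<And>s. s < N \<Longrightarrow> g' s \<in> SymI"
    and eq: "\<delta> f = (\<lambda>x. \<Sum>s<N. (g s \<otimes> g' s) x)"
  shows "left_image f \<approx> (\<Sum>s<N. root_value (g' s) * right_image (g s))"
proof -
  let ?ys = "map (\<lambda>s. (g s, g' s)) [0..<N]"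
  have sum: "(\<Sum>s\<leftarrow>[0..<N]. F s) = (\<Sum>s<N. F s)" for F :: "nat \<Rightarrow> 'z::comm_monoid_add"
    by (simp add: interv_sum_list_conv_sum_set_nat lessThan_atLeast0)
  obtain xs where xs: "sym_list xs" "\<delta> f = tensor_sum xs" "left_image f \<approx> right_value xs"
    using left_value_exists[OF \<delta> f] by blast
  have "tensor_sum ?ys = (\<lambda>x. \<Sum>s<N. (g s \<otimes> g' s) x)"
    by (simp add: tensor_sum_def comp_def sum)
  then have "tensor_sum xs = tensor_sum ?ys"
    using xs(2) eq by simp
  then have "right_value xs \<approx> right_value ?ys"
    using xs g by (intro right_value_unique) (auto simp: sym_list_def)
  moreover have "right_value ?ys = (\<Sum>s<N. root_value (g' s) * right_image (g s))"
    by (simp add: right_value_def comp_def sum)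
  ultimately show ?thesis
    using cg_trans[OF xs(3)] by simp
qed

end


section \<open>Homogeneity of the relations\<close>

text \<open>The degree of a diagram whose rightmost region has weight \<open>\<nu>\<close>.\<close>

definition ddeg :: "('i, 'r, 'k) stendhal_data \<Rightarrow> 'r weight \<Rightarrow> 'i diagram \<Rightarrow> int" where
  "ddeg D \<nu> d = (\<Sum>(L, g, R)\<leftarrow>slices d. gen_deg D (wtw D R + \<nu>) g)"

lemma diag_deg_eq: "diag_deg D d = ddeg D 0 d"
  by (simp add: diag_deg_def ddeg_def)

lemma ddeg_add: "ddeg D \<nu> (d + e) = ddeg D \<nu> d + ddeg D \<nu> e"
  and ddeg_zero [simp]: "ddeg D \<nu> 0 = 0"
  by (simp_all add: ddeg_def plus_diagram_def zero_diagram_def)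

lemma ddeg_whisker: "ddeg D \<nu> (whisker_diag L R d) = ddeg D (wtw D R + \<nu>) d"
proof -
  have "(\<Sum>(L, g, R)\<leftarrow>map (whisker_slice L R) xs. gen_deg D (wtw D R + \<nu>) g) =
      (\<Sum>(L, g, R')\<leftarrow>xs. gen_deg D (wtw D R' + (wtw D R + \<nu>)) g)" for xs
    by (induction xs) (auto simp: wtw_append add.assoc)
  then show ?thesis
    by (simp add: ddeg_def whisker_diag_def)
qed

definition homog :: "('i, 'r, 'k::comm_ring_1) stendhal_data \<Rightarrow> 'r weight \<Rightarrow> int \<Rightarrow> ('i, 'k) lin \<Rightarrow> bool" where
  "homog D \<nu> e u \<longleftrightarrow> (\<forall>d\<in>keys u. \<forall>M\<in>keys (lookup u d). ddeg D \<nu> d + 2 * int (mdeg M) = e)"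

lemma homog_iff:
  "homog D \<nu> e u \<longleftrightarrow> (\<forall>d M. lookup (lookup u d) M \<noteq> 0 \<longrightarrow> ddeg D \<nu> d + 2 * int (mdeg M) = e)"
proof -
  have "d \<in> keys u \<and> M \<in> keys (lookup u d) \<longleftrightarrow> lookup (lookup u d) M \<noteq> 0" for d M
    by (cases "lookup u d = 0") (simp_all add: in_keys_iff)
  then show ?thesis
    unfolding homog_def by blast
qed

lemma homog_zero [simp]: "homog D \<nu> e 0"
  by (simp add: homog_def)

lemma homog_add: "homog D \<nu> e u \<Longrightarrow> homog D \<nu> e v \<Longrightarrow> homog D \<nu> e (u + v)"
  unfolding homog_iff lookup_add by (metis add.right_neutral)

lemma homog_uminus: "homog D \<nu> e u \<Longrightarrow> homog D \<nu> e (- u)"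
  unfolding homog_iff by simp

lemma homog_diff: "homog D \<nu> e u \<Longrightarrow> homog D \<nu> e v \<Longrightarrow> homog D \<nu> e (u - v)"
  using homog_add[OF _ homog_uminus, of D \<nu> e u v] by simp

lemma homog_sum: "(\<And>x. x \<in> X \<Longrightarrow> homog D \<nu> e (f x)) \<Longrightarrow> homog D \<nu> e (sum f X)"
  by (induction X rule: infinite_finite_induct) (auto intro: homog_add)

lemma homog_single: "homog D \<nu> e (single d a) \<longleftrightarrow> (\<forall>M\<in>keys a. ddeg D \<nu> d + 2 * int (mdeg M) = e)"
  by (auto simp: homog_def split: if_splits)

lemma homog_mult:
  assumes "homog D \<nu> e u" "homog D \<nu> e' v"
  shows "homog D \<nu> (e + e') (u * v)"
proof -
  have "u * v = (\<Sum>d\<in>keys u. single d (lookup u d)) * (\<Sum>d\<in>keys v. single d (lookup v d))"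
    by (rule arg_cong2[where f="(*)", OF sum_single_keys sum_single_keys])
  also have "\<dots> = (\<Sum>d\<in>keys u. \<Sum>d'\<in>keys v. single (d + d') (lookup u d * lookup v d'))"
    by (simp add: sum_product mult_single)
  also have "homog D \<nu> (e + e') \<dots>"
  proof (intro homog_sum, unfold homog_single, intro ballI)
    fix d d' M assume d: "d \<in> keys u" "d' \<in> keys v" and "M \<in> keys (lookup u d * lookup v d')"
    then obtain a b where ab: "a \<in> keys (lookup u d)" "b \<in> keys (lookup v d')" "M = a + b"
      using keys_mult by blast
    then have "ddeg D \<nu> d + 2 * int (mdeg a) = e" "ddeg D \<nu> d' + 2 * int (mdeg b) = e'"
      using assms d by (auto simp: homog_def)
    then show "ddeg D \<nu> (d + d') + 2 * int (mdeg M) = e + e'"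
      by (simp add: ab(3) ddeg_add mdeg_add)
  qed
  finally show ?thesis .
qed

lemma homog_mult': "homog D \<nu> e u \<Longrightarrow> homog D \<nu> e' v \<Longrightarrow> e + e' = e'' \<Longrightarrow> homog D \<nu> e'' (u * v)"
  using homog_mult by blast

lemma homog_dgm: "homog D \<nu> (ddeg D \<nu> d) (dgm d)"
  by (simp add: dgm_def homog_single)

lemma homog_scal: "(\<And>M. M \<in> keys a \<Longrightarrow> 2 * int (mdeg M) = e) \<Longrightarrow> homog D \<nu> e (scal a)"
  by (simp add: scal_def homog_single)

lemma homog_kscal [simp]: "homog D \<nu> 0 (kscal c)"
  unfolding kscal_def by (rule homog_scal) (simp split: if_splits)

lemma homog_one [simp]: "homog D \<nu> 0 1"
  using homog_kscal[of D \<nu> 1] by simp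

lemma homog_sl: "gen_deg D (wtw D R + \<nu>) g = e \<Longrightarrow> homog D \<nu> e (sl L g R)"
  using homog_dgm[of D \<nu> "Diagram [(L, g, R)]"] by (simp add: sl_def ddeg_def)

lemma homog_power: "homog D \<nu> e u \<Longrightarrow> homog D \<nu> (int n * e) (u ^ n)"
  by (induction n) (auto simp: algebra_simps intro: homog_mult')

lemma homog_power': "homog D \<nu> e u \<Longrightarrow> int n * e = e' \<Longrightarrow> homog D \<nu> e' (u ^ n)"
  using homog_power by blast

lemma homog_whisker:
  assumes "homog D (wtw D R + \<nu>) e u"
  shows "homog D \<nu> e (whisker L u R)"
  unfolding whisker_def push_def
proof (rule homog_sum)
  fix d assume "d \<in> keys u"
  then show "homog D \<nu> e (single (whisker_diag L R d) (lookup u d))"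
    using assms unfolding homog_single ddeg_whisker by (simp add: homog_def)
qed

lemma eval_red_sym_e_homog:
  "homog D \<nu> (2 * int p) (scal ((-1) ^ p * eval_red D k (sym_e i p)))"
proof (rule homog_scal)
  have m1: "(-1) ^ p * eval_red D k (sym_e i p) = (if even p then eval_red D k (sym_e i p) else - eval_red D k (sym_e i p))"
    by simp
  fix M assume "M \<in> keys ((-1) ^ p * eval_red D k (sym_e i p) :: ('a, 'c) zpoly)"
  then have "M \<in> keys (eval_red D k (sym_e i p) :: ('a, 'c) zpoly)"
    unfolding m1 by (auto simp: in_keys_iff split: if_splits)
  then have "M \<in> (\<Union>m\<in>{m. sym_e i p m \<noteq> (0 :: 'c) \<and> (\<forall>(i, j)\<in>keys m. j < red_mult D k i)}.
      keys (single (zmono k m) (sym_e i p m :: 'c)))"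
    unfolding eval_red_def by (rule subsetD[OF keys_sum])
  then show "2 * int (mdeg M) = 2 * int p"
    by (auto simp: mdeg_push sym_e_def split: if_splits)
qed

lemma wt_dual: "is_black x \<Longrightarrow> wt D x + wt D (dual x) = 0"
  by (cases x) auto

lemma wtw_gen: "valid_gen g \<Longrightarrow> wtw D (gtop g) = wtw D (gbot g)"
  by (cases g) (auto simp: wtw_Cons wt_dual)

context stendhal
begin

lemma cartan_sym: "cartan D i j = cartan D j i"
  using datum by (simp add: stendhal_datum_def)

lemma coroot_simple_root: "coroot D i (simple_root D j) = cartan D i j"
  by (simp add: cartan_def)

lemma coroot_diff: "coroot D i (x - y) = coroot D i x - coroot D i y"
  using coroot_add[of i x "- y"] by (simp add: coroot_uminus)

lemmas degree_simps = wtw_Cons coroot_add coroot_uminus coroot_diff coroot_simple_root cartan_self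

lemma bubble_homog:
  "homog D \<nu> (2 * (d + 1 - coroot D i \<nu>)) (bubble (Up i) d)"
  "homog D \<nu> (2 * (d + 1 + coroot D i \<nu>)) (bubble (Down i) d)"
  unfolding bubble_def
  by (cases "d \<ge> 0"; simp; (intro homog_mult' homog_power' homog_sl refl | simp)+)+

lemma cw_homog: "homog D \<nu> (2 * r) (cw D \<nu> i r)"
  and ccw_homog: "homog D \<nu> (2 * r) (ccw D \<nu> i r)"
  using bubble_homog(1)[of \<nu> "coroot D i \<nu> - 1 + r" i] bubble_homog(2)[of \<nu> "- coroot D i \<nu> - 1 + r" i]
  by (simp_all add: cw_def ccw_def)

lemma black_rel_homog:
  assumes "black_rel D \<nu> S T u v"
  shows "\<exists>e. homog D \<nu> e u \<and> homog D \<nu> e v"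
  using assms
proof cases
  case (interchange g h M)
  then show ?thesis
    by (intro exI[of _ "gen_deg D (wtw D (M @ gtop h) + \<nu>) g + gen_deg D \<nu> h"])
      (auto intro!: homog_mult' homog_sl simp: wtw_append wtw_gen)
next
  case (zigzag_left x)
  then show ?thesis
    by (intro exI[of _ 0]; cases x) (auto intro!: homog_mult' homog_sl simp: degree_simps)
next
  case (zigzag_right x)
  then show ?thesis
    by (intro exI[of _ 0]; cases x) (auto intro!: homog_mult' homog_sl simp: degree_simps)
next
  case (dot_cap x)
  then show ?thesis
    by (intro exI[of _ "2 + gen_deg D \<nu> (Cap x)"]; cases x) (auto intro!: homog_mult' homog_sl)
next
  case (dot_cup x)
  then show ?thesis
    by (intro exI[of _ "2 + gen_deg D \<nu> (Cup x)"]; cases x) (auto intro!: homog_mult' homog_sl)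
next
  case (pitchfork_cap x y)
  then show ?thesis
    by (intro exI[of _ "gen_deg D \<nu> (Cap x) + gen_deg D \<nu> (Cross x y)"]; cases x; cases y)
      (auto intro!: homog_mult' homog_sl simp: degree_simps cartan_sym)
next
  case (pitchfork_cup x y)
  then show ?thesis
    by (intro exI[of _ "gen_deg D \<nu> (Cup x) + gen_deg D \<nu> (Cross y x)"]; cases x; cases y)
      (auto intro!: homog_mult' homog_sl simp: degree_simps cartan_sym)
next
  case (dot_cross_left i j)
  then show ?thesis
    by (intro exI[of _ "2 - cartan D i j"]) (auto intro!: homog_add homog_mult' homog_sl simp: cartan_self)
next
  case (dot_cross_right i j)
  then show ?thesis
    by (intro exI[of _ "2 - cartan D i j"]) (auto intro!: homog_add homog_mult' homog_sl simp: cartan_self)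
next
  case (cross_cross i j)
  have "cartan D i j = -1" if "i \<noteq> j" "cartan D i j \<noteq> 0"
  proof -
    have "\<forall>i j. i \<noteq> j \<longrightarrow> cartan D i j \<in> {0, -1}"
      using datum by (simp add: stendhal_datum_def)
    then show ?thesis using that by blast
  qed
  then show ?thesis
    using cross_cross cartan_sym[of i j]
    by (intro exI[of _ "- 2 * cartan D i j"]) (auto intro!: homog_add homog_mult' homog_sl homog_kscal)
next
  case (braid i j k)
  then show ?thesis
    using cartan_sym[of i j]
    by (intro exI[of _ "- cartan D i j - cartan D i k - cartan D j k"])
      (auto intro!: homog_diff homog_mult' homog_sl simp: cartan_self)
next
  case (mixed_up_down i j)
  then show ?thesis
    by (intro exI[of _ 0]) (auto intro!: homog_mult' homog_sl)
next
  case (mixed_down_up i j)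
  then show ?thesis
    by (intro exI[of _ 0]) (auto intro!: homog_mult' homog_sl)
next
  case (cw_neg r i)
  then show ?thesis
    using cw_homog by auto
next
  case (ccw_neg r i)
  then show ?thesis
    using ccw_homog by auto
next
  case (cw_zero i)
  then show ?thesis
    using cw_homog[of \<nu> 0 i] by auto
next
  case (ccw_zero i)
  then show ?thesis
    using ccw_homog[of \<nu> 0 i] by auto
next
  case (grassmannian i N)
  then show ?thesis
    by (intro exI[of _ "2 * int N"]) (auto intro!: homog_sum homog_mult'[OF ccw_homog cw_homog])
next
  case (inverse_up_down i)
  have "homog D \<nu> 0 (\<Sum>(a, b, c)\<in>{(a, b, c :: nat). int (a + b + c) = coroot D i \<nu> - 1}.
      sl [] (Dot (Up i)) [Down i] ^ a * sl [] (Cup (Up i)) [] * ccw D \<nu> i (int b)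
      * sl [] (Cap (Up i)) [] * sl [] (Dot (Up i)) [Down i] ^ c :: ('i, 'k) lin)"
    by (auto intro!: homog_sum homog_mult' homog_power' homog_sl ccw_homog)
  then show ?thesis
    using inverse_up_down
    by (intro exI[of _ 0]) (auto intro!: homog_add homog_diff homog_uminus homog_mult' homog_sl)
next
  case (inverse_down_up i)
  have "homog D \<nu> 0 (\<Sum>(a, b, c)\<in>{(a, b, c :: nat). int (a + b + c) = - coroot D i \<nu> - 1}.
      sl [] (Dot (Down i)) [Up i] ^ a * sl [] (Cup (Down i)) [] * cw D \<nu> i (int b)
      * sl [] (Cap (Down i)) [] * sl [] (Dot (Down i)) [Up i] ^ c :: ('i, 'k) lin)"
    by (auto intro!: homog_sum homog_mult' homog_power' homog_sl cw_homog)
  then show ?thesis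
    using inverse_down_up
    by (intro exI[of _ 0]) (auto intro!: homog_add homog_diff homog_uminus homog_mult' homog_sl)
qed

text \<open>Moving a red string across a cap changes the weight of the region at the cap; the degrees agree
  because the weight of the red string pairs with the coroots to the numbers \<open>red_mult\<close>, which needs
  the label to be one of the given dominant weights.\<close>

lemma red_rel_homog:
  assumes "red_rel D S T u v" "\<And>k. Red k \<in> set S \<Longrightarrow> 1 \<le> k \<and> k \<le> num_red D"
  shows "\<exists>e. homog D \<nu> e u \<and> homog D \<nu> e v"
  using assms(1)
proof cases
  case (dot_right x k)
  then show ?thesis
    by (intro exI[of _ "2 + gen_deg D \<nu> (Cross x (Red k))"]; cases x) (auto intro!: homog_mult' homog_sl)
next
  case (dot_left x k)
  then show ?thesis
    by (intro exI[of _ "2 + gen_deg D \<nu> (Cross (Red k) x)"]; cases x) (auto intro!: homog_mult' homog_sl)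
next
  case (up_red i k)
  then show ?thesis
    by (intro exI[of _ 0]) (auto intro!: homog_mult' homog_sl)
next
  case (red_up k i)
  then show ?thesis
    by (intro exI[of _ 0]) (auto intro!: homog_mult' homog_sl)
next
  case (red_cap x k)
  then have "coroot D i (red_weight D k) = int (red_mult D k i)" for i
    using assms(2)[of k] by (intro coroot_red_weight) auto
  then show ?thesis
    using red_cap
    by (intro exI[of _ "gen_deg D \<nu> (Cap x) + gen_deg D \<nu> (Cross x (Red k))"]; cases x)
      (auto intro!: homog_mult' homog_sl simp: degree_simps)
next
  case (red_cup x k)
  then have "coroot D i (red_weight D k) = int (red_mult D k i)" for i
    using assms(2)[of k] by (intro coroot_red_weight) auto
  then show ?thesis
    using red_cup
    by (intro exI[of _ "gen_deg D \<nu> (Cup x) + gen_deg D \<nu> (Cross (Red k) x)"]; cases x)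
      (auto intro!: homog_mult' homog_sl simp: degree_simps)
next
  case (red_left_to_right k i j)
  then show ?thesis
    by (intro exI[of _ "- cartan D i j"]) (auto intro!: homog_mult' homog_sl)
next
  case (red_right_to_left i j k)
  then show ?thesis
    by (intro exI[of _ "- cartan D i j"]) (auto intro!: homog_mult' homog_sl)
next
  case (red_middle i k j)
  then show ?thesis
    by (intro exI[of _ "- cartan D i j"]) (auto intro!: homog_mult' homog_sl)
next
  case (down_red i k)
  then show ?thesis
    by (intro exI[of _ "2 * int (red_mult D k i)"])
      (auto intro!: homog_sum homog_mult' homog_power' homog_sl eval_red_sym_e_homog simp: of_nat_diff)
next
  case (red_down k i)
  then show ?thesis
    by (intro exI[of _ "2 * int (red_mult D k i)"])
      (auto intro!: homog_sum homog_mult' homog_power' homog_sl eval_red_sym_e_homog simp: of_nat_diff)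
next
  case (down_red_down i k j)
  have "homog D \<nu> (2 * int (red_mult D k i) - 2) (\<Sum>(r, p, q)\<in>{(r, p, q). r + p + q + 1 = red_mult D k i}.
      scal ((-1) ^ r * eval_red D k (sym_e i r)) * sl [] (Dot (Down i)) [Red k, Down i] ^ p *
      sl [Down i, Red k] (Dot (Down i)) [] ^ q :: ('i, 'k) lin)"
    by (auto intro!: homog_sum homog_mult' homog_power' homog_sl eval_red_sym_e_homog)
  then show ?thesis
    using down_red_down
    by (intro exI[of _ "int (red_mult D k i) + int (red_mult D k j) - cartan D i j"])
      (auto intro!: homog_add homog_mult' homog_sl simp: cartan_self)
qed


section \<open>Homogeneous components of relations are relations\<close>

lemma lookup_hpart:
  "lookup (lookup (hpart D s u) d) M = (if diag_deg D d + 2 * int (mdeg M) = s then lookup (lookup u d) M else 0)"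
proof -
  let ?K = "\<lambda>d'. {M' \<in> keys (lookup u d'). diag_deg D d' + 2 * int (mdeg M') = s}"
  have "lookup (lookup (hpart D s u) d) M =
      (\<Sum>d'\<in>keys u. \<Sum>M'\<in>?K d'. if d' = d \<and> M' = M then lookup (lookup u d') M' else 0)"
    unfolding hpart_def lookup_sum by (intro sum.cong refl) (auto simp: lookup_single when_def)
  also have "\<dots> = (\<Sum>d'\<in>keys u. if d' = d then (\<Sum>M'\<in>?K d. if M' = M then lookup (lookup u d) M' else 0) else 0)"
    by (intro sum.cong refl) auto
  also have "\<dots> = (if diag_deg D d + 2 * int (mdeg M) = s then lookup (lookup u d) M else 0)"
    by (auto simp: in_keys_iff)
  finally show ?thesis .
qed

lemma hpart_add: "hpart D s (u + v) = hpart D s u + hpart D s v"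
  by (rule poly_mapping_eqI, rule poly_mapping_eqI) (simp add: lookup_hpart lookup_add)

lemma hpart_diff: "hpart D s (u - v) = hpart D s u - hpart D s v"
  by (rule poly_mapping_eqI, rule poly_mapping_eqI) (simp add: lookup_hpart lookup_minus)

lemma hpart_zero [simp]: "hpart D s 0 = 0"
  by (simp add: hpart_def)

lemma hpart_sum: "hpart D s (sum f X) = (\<Sum>x\<in>X. hpart D s (f x))"
  by (induction X rule: infinite_finite_induct) (auto simp: hpart_add)

lemma hpart_homog: "homog D 0 e u \<Longrightarrow> hpart D s u = (if e = s then u else 0)"
  by (rule poly_mapping_eqI, rule poly_mapping_eqI) (auto simp: lookup_hpart homog_iff diag_deg_eq)

text \<open>The component picks out the monomials of \<open>a\<close> of complementary degree, and symmetry of the scalar is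
  preserved because permuting the indeterminates preserves the degree.\<close>

lemma hpart_scal_mult:
  assumes "a \<in> Alam D" "homog D 0 e w"
  shows "\<exists>a'\<in>Alam D. hpart D s (scal a * w) = scal a' * w"
proof -
  define a' where "a' = (\<Sum>M | M \<in> keys a \<and> 2 * int (mdeg M) + e = s. single M (lookup a M))"
  have lookup_a': "lookup a' M = (if 2 * int (mdeg M) + e = s then lookup a M else 0)" for M
    unfolding a'_def lookup_sum lookup_single when_def by (auto simp: in_keys_iff)
  have "a' \<in> Alam D"
  proof -
    have "keys a' \<subseteq> keys a"
      by (auto simp: in_keys_iff lookup_a' split: if_splits)
    then show ?thesis
      using assms(1) unfolding Alam_def lookup_a' mem_Collect_eq mdeg_push by auto
  qed
  moreover have "hpart D s (scal a * w) = scal a' * w"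
  proof -
    have "scal a * w = (\<Sum>M\<in>keys a. scal (single M (lookup a M)) * w)"
      by (subst (1) sum_single_keys[of a]) (simp only: scal_sum sum_distrib_right)
    then have "hpart D s (scal a * w) = (\<Sum>M\<in>keys a. hpart D s (scal (single M (lookup a M)) * w))"
      by (simp only: hpart_sum)
    also have "\<dots> = (\<Sum>M\<in>keys a. if 2 * int (mdeg M) + e = s then scal (single M (lookup a M)) * w else 0)"
      using assms(2) by (intro sum.cong refl hpart_homog homog_mult homog_scal) (auto split: if_splits)
    also have "\<dots> = scal a' * w"
      unfolding a'_def scal_sum sum_distrib_right by (subst sum.inter_filter[symmetric]) auto
    finally show ?thesis .
  qed
  ultimately show ?thesis by blast
qed

lemma diag_reds:
  assumes "diag S d T"
  shows "filter (\<lambda>s. \<not> is_black s) T = filter (\<lambda>s. \<not> is_black s) S"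
proof -
  have "valid_gen g \<Longrightarrow> filter (\<lambda>s. \<not> is_black s) (gtop g) = filter (\<lambda>s. \<not> is_black s) (gbot g)" for g :: "'a gen"
  proof (cases g)
    case (Cup x)
    moreover assume "valid_gen g"
    ultimately show ?thesis by (cases x) auto
  next
    case (Cap x)
    moreover assume "valid_gen g"
    ultimately show ?thesis by (cases x) auto
  qed auto
  then have "slices_from_to S xs T \<Longrightarrow> filter (\<lambda>s. \<not> is_black s) T = filter (\<lambda>s. \<not> is_black s) S" for xs
    by (induction S xs T rule: slices_from_to.induct) auto
  then show ?thesis
    using assms by (auto simp: diag_def)
qed

lemma stendhal_word_reds:
  assumes "stendhal_word D S" "Red k \<in> set S"
  shows "1 \<le> k \<and> k \<le> num_red D"
proof -
  have "Red k \<in> set (filter (\<lambda>s. \<not> is_black s) S)"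
    using assms(2) by simp
  then show ?thesis
    using assms(1) unfolding stendhal_word_def by auto
qed

text \<open>The labels of the red strings in any relation that occurs are those of the source, since slices
  preserve the sequence of red strings.\<close>

lemma X_span_hpart:
  assumes S: "stendhal_word D S" and "x \<in> X_span D S T"
  shows "hpart D s x \<in> X_span D S T"
  using assms(2) unfolding X_span_def
proof induction
  case zero
  then show ?case by (simp add: rel_span.zero)
next
  case (add u v)
  then show ?case by (simp add: hpart_add rel_span.add)
next
  case (rel a R' S' T' u v d L' d')
  have word: "stendhal_word D (L' @ S' @ R')"
    using S diag_reds[OF rel(3)] by (simp add: stendhal_word_def)
  have "\<exists>e. homog D (wtw D R') e (u - v)"
    using rel(2)
  proof (elim disjE conjE)
    assume "black_rel D (wtw D R') S' T' u v"
    then show ?thesis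
      using black_rel_homog homog_diff by blast
  next
    assume "red_rel D S' T' u v"
    moreover have "1 \<le> k \<and> k \<le> num_red D" if "Red k \<in> set S'" for k
      using stendhal_word_reds[OF word, of k] that by simp
    ultimately show ?thesis
      using red_rel_homog homog_diff by metis
  next
    assume "u = 1" "v = 0"
    then show ?thesis
      by (intro exI[of _ 0]) simp
  qed
  then obtain e where "homog D 0 (ddeg D 0 d' + e + ddeg D 0 d) (dgm d' * whisker L' (u - v) R' * dgm d)"
    using homog_whisker[of D R' 0 _ "u - v" L'] by (metis add.right_neutral homog_dgm homog_mult)
  from hpart_scal_mult[OF rel(1) this, of s] obtain a' where a': "a' \<in> Alam D"
    "hpart D s (scal a * dgm d' * whisker L' (u - v) R' * dgm d) = scal a' * dgm d' * whisker L' (u - v) R' * dgm d"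
    by (auto simp: mult.assoc)
  show ?case
    unfolding a'(2) using a'(1) rel(2-4) by (rule rel_span.rel)
qed

end

unbundle no fps_syntax

section \<open>Bubbles slide through red strings\<close>

theorem proposition2:
  fixes D :: "('i::finite, 'r, 'k::field_char_0) stendhal_data"
    and b :: "'r weight \<Rightarrow> ('i, 'k) ser \<Rightarrow> ('i, 'k) lin"
    and \<delta> :: "('i, 'k) ser \<Rightarrow> ('i, 'k) ser2"
    and f :: "('i, 'k) ser" and N :: nat and g g' :: "nat \<Rightarrow> ('i, 'k) ser"
    and \<mu> :: "'r weight" and k :: nat and L R S T :: "'i word" and d d' :: "'i diagram"
  assumes "stendhal_datum D"
    and "1 \<le> k" and "k \<le> num_red D"
    and "\<And>\<nu>. is_bubble_hom D \<nu> (b \<nu>)"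
    and "is_coproduct \<delta>"
    and "f \<in> SymI" and "\<And>s. s < N \<Longrightarrow> g s \<in> SymI" and "\<And>s. s < N \<Longrightarrow> g' s \<in> SymI"
    and "\<delta> f = (\<lambda>x. \<Sum>s<N. (g s \<otimes> g' s) x)"
    and "stendhal_word D (L @ Red k # R)" and "wtw D R = \<mu>"
    and "diag S d (L @ Red k # R)" and "diag (L @ Red k # R) d' T"
  shows "X_eq D S T
           (dgm d' * whisker L (b (\<mu> + red_weight D k) f) (Red k # R) * dgm d)
           (dgm d' * (\<Sum>s<N. scal (eval_red D k (g' s)) * whisker (L @ [Red k]) (b \<mu> (g s)) R) * dgm d)"
proof -
  interpret bubble_homs D k \<mu> b
    using assms(1-4) by unfold_locales auto
  let ?W = "L @ Red k # R"
  let ?u = "whisker L (b (\<mu> + red_weight D k) f) (Red k # R)"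
  let ?v = "\<Sum>s<N. scal (eval_red D k (g' s)) * whisker (L @ [Red k]) (b \<mu> (g s)) R"
  have u: "?u = whisker L (left_image f) R"
    by (simp add: left_image_def lft_def whisker_whisker add.commute)
  have v: "?v = whisker L (\<Sum>s<N. root_value (g' s) * right_image (g s)) R"
    by (simp add: right_image_def rgt_def root_value_def whisker_sum whisker_mult whisker_whisker)
  have hom: "?u \<in> hom D ?W ?W" "?v \<in> hom D ?W ?W"
    unfolding u v using assms(6-8)
    by (auto intro!: hom_whisker'[of _ _ "[Red k]" "[Red k]"] hom_sum hom_mult[of _ _ "[Red k]" "[Red k]"] left_image_hom right_image_hom root_value_hom)
  have homs: "dgm d' * ?u * dgm d \<in> hom D S T" "dgm d' * ?v * dgm d \<in> hom D S T"
    using hom assms(12,13) by (auto intro!: hom_mult[of _ _ ?W] hom_dgm)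
  have "cg D 0 ?W ?W ?u ?v"
    unfolding u v using bubble_slide[OF assms(5-9)] assms(11) by (auto intro: cg_whisker')
  then have "cg D 0 S T (dgm d' * ?u * dgm d) (dgm d' * ?v * dgm d)"
    by (intro cg_right[OF hom_dgm[OF assms(12)]] cg_left[OF hom_dgm[OF assms(13)]])
  then have diff: "dgm d' * ?u * dgm d - dgm d' * ?v * dgm d \<in> X_span D S T"
    unfolding cg_def X_span_def by (rule rel_span_mono[rotated]) (auto simp: local_rel_def)
  have "stendhal_word D S"
    using assms(10) diag_reds[OF assms(12)] by (simp add: stendhal_word_def)
  then have "hpart D s (dgm d' * ?u * dgm d) - hpart D s (dgm d' * ?v * dgm d) \<in> X_span D S T" for s
    using X_span_hpart[OF _ diff, of s] by (simp add: hpart_diff)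
  then show ?thesis
    unfolding X_eq_def using homs by blast
qed

end
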